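(* Let $p\ge1$, $k,\ell>0$, $n\in\mathbb{R}$, and let $\varphi:[1,\infty)\to[1,\infty)$ be an increasing and strictly convex function satisfying $\varphi(1)=1$ and $\varphi''(t)>c_0$ for some constant $c_0>0$ and for a.e. $t\in[1,\infty)$. Then there exist $\varepsilon_0>0$ and $C>0$, depending only on $k,\ell,n,\varphi$ and $p$, such that if $f\in\mathcal{F}$ satisfies $f=f^*$ on $\partial Q_1$ and $$\int_{Q_1}\varphi(K(z,f))\,d\mathcal{L}^2(z)\le(1+\varepsilon)\int_{Q_1}\varphi(K(z,f^* ))\,d\mathcal{L}^2(z)$$ for some $0<\varepsilon<\varepsilon_0$, then $$\left(\int_{Q_1}|f-f^*|^p(z)\,d\mathcal{L}^2(z)\right)^{\frac1p}\le C\,\varepsilon^{\frac{1}{2p}}.$$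
   Context: $\mathcal{L}^2$ is Lebesgue measure on $\mathbb{C}=\mathbb{R}^2$. For $k,\ell>0$, $n\in\mathbb{R}$, let $Q_1=\{x+iy:\ x\in[0,\ell],\ y\in[0,1]\}$. Finite distortion: an orientation-preserving map $f$ between (closures of) bounded planar domains $\Omega,\Omega'$ has finite distortion if $f\in W^{1,1}(\Omega,\Omega')$, its Jacobian $J(\cdot,f)\in L^1(\Omega)$, and there is a measurable $K:\Omega\to\mathbb{R}\cup\{\infty\}$ with $1\le K(z)<\infty$ and $|Df(z)|^2\le K(z)J(z,f)$ for a.e. $z\in\Omega$, where $|Df|=|f_z|+|f_{\bar z}|$ and $J(z,f)=|f_z|^2-|f_{\bar z}|^2$. The linear distortion of $f$ is defined a.e. by $K(z,f)=\frac{|f_z(z)|+|f_{\bar z}(z)|}{|f_z(z)|-|f_{\bar z}(z)|}$ if $|f_{\bar z}(z)|<|f_z(z)|$ and $K(z,f)=1$ otherwise. $\mathcal{F}$ is the class of all orientation-preserving homeomorphisms $f$ of $Q_1$ onto its image in $\mathbb{C}$, $f\in W^{1,1}(Q_1)$, of finite distortion, such that $f(0)=0$, $f(x+i)=f(x)+i$ for $x\in[0,\ell]$, and $f(\ell+iy)=f(iy)+k\ell+in\ell$ for $y\in[0,1]$. The linear stretch map is $f^*(x+iy)=kx+inx+iy$ on $Q_1$; it belongs to $\mathcal{F}$. *)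

theory Defs
  imports "HOL-Analysis.Analysis" "HOL-Complex_Analysis.Winding_Numbers"
begin

section \<open>Weak derivatives and Sobolev maps on planar open sets\<close>

primrec Ck :: "nat \<Rightarrow> (complex \<Rightarrow> real) \<Rightarrow> bool" where
  "Ck 0 h \<longleftrightarrow> continuous_on UNIV h"
| "Ck (Suc m) h \<longleftrightarrow>
     h differentiable_on UNIV \<and> (\<forall>v. Ck m (\<lambda>z. frechet_derivative h (at z) v))"

definition test_functions :: "complex set \<Rightarrow> (complex \<Rightarrow> real) set" where
  "test_functions \<Omega> =
     {h. (\<forall>m. Ck m h) \<and> compact (closure {z. h z \<noteq> 0}) \<and> closure {z. h z \<noteq> 0} \<subseteq> \<Omega>}"

definition locally_integrable :: "complex set \<Rightarrow> (complex \<Rightarrow> complex) \<Rightarrow> bool" where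
  "locally_integrable \<Omega> f \<longleftrightarrow> (\<forall>A. compact A \<and> A \<subseteq> \<Omega> \<longrightarrow> set_integrable lebesgue A f)"

text \<open>\<open>g\<close> is a weak derivative of \<open>f\<close> in the (real) direction \<open>v\<close> on the open set \<open>\<Omega>\<close>.\<close>

definition is_weak_deriv ::
    "complex set \<Rightarrow> complex \<Rightarrow> (complex \<Rightarrow> complex) \<Rightarrow> (complex \<Rightarrow> complex) \<Rightarrow> bool" where
  "is_weak_deriv \<Omega> v f g \<longleftrightarrow>
     locally_integrable \<Omega> f \<and> locally_integrable \<Omega> g \<and>
     (\<forall>h \<in> test_functions \<Omega>.
        (LINT z:\<Omega>|lebesgue. frechet_derivative h (at z) v *\<^sub>R f z)
          = - (LINT z:\<Omega>|lebesgue. h z *\<^sub>R g z))"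

text \<open>A chosen representative: weak derivatives are unique only up to null sets, and
  everything below depends on them only up to null sets.\<close>

definition weak_deriv :: "complex set \<Rightarrow> complex \<Rightarrow> (complex \<Rightarrow> complex) \<Rightarrow> complex \<Rightarrow> complex" where
  "weak_deriv \<Omega> v f = (SOME g. is_weak_deriv \<Omega> v f g)"

definition W11 :: "complex set \<Rightarrow> (complex \<Rightarrow> complex) \<Rightarrow> bool" where
  "W11 \<Omega> f \<longleftrightarrow> set_integrable lebesgue \<Omega> f \<and>
     (\<forall>v \<in> {1, \<i>}. \<exists>g. is_weak_deriv \<Omega> v f g \<and> set_integrable lebesgue \<Omega> g)"

section \<open>Distortion\<close>

text \<open>Wirtinger derivatives, in the weak sense.\<close>

definition dz :: "complex set \<Rightarrow> (complex \<Rightarrow> complex) \<Rightarrow> complex \<Rightarrow> complex" where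
  "dz \<Omega> f z = (weak_deriv \<Omega> 1 f z - \<i> * weak_deriv \<Omega> \<i> f z) / 2"

definition dzbar :: "complex set \<Rightarrow> (complex \<Rightarrow> complex) \<Rightarrow> complex \<Rightarrow> complex" where
  "dzbar \<Omega> f z = (weak_deriv \<Omega> 1 f z + \<i> * weak_deriv \<Omega> \<i> f z) / 2"

definition norm_D :: "complex set \<Rightarrow> (complex \<Rightarrow> complex) \<Rightarrow> complex \<Rightarrow> real" where
  "norm_D \<Omega> f z = cmod (dz \<Omega> f z) + cmod (dzbar \<Omega> f z)"

definition Jac :: "complex set \<Rightarrow> (complex \<Rightarrow> complex) \<Rightarrow> complex \<Rightarrow> real" where
  "Jac \<Omega> f z = (cmod (dz \<Omega> f z))\<^sup>2 - (cmod (dzbar \<Omega> f z))\<^sup>2"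

definition finite_distortion :: "complex set \<Rightarrow> (complex \<Rightarrow> complex) \<Rightarrow> bool" where
  "finite_distortion \<Omega> f \<longleftrightarrow>
     W11 \<Omega> f \<and> set_integrable lebesgue \<Omega> (Jac \<Omega> f) \<and>
     (\<exists>K :: complex \<Rightarrow> ereal. K \<in> borel_measurable (lebesgue_on \<Omega>) \<and>
        (AE z in lebesgue_on \<Omega>. 1 \<le> K z \<and> K z < \<infinity> \<and>
           ereal ((norm_D \<Omega> f z)\<^sup>2) \<le> K z * ereal (Jac \<Omega> f z)))"

definition lin_dist :: "complex set \<Rightarrow> (complex \<Rightarrow> complex) \<Rightarrow> complex \<Rightarrow> real" where
  "lin_dist \<Omega> f z =
     (if cmod (dzbar \<Omega> f z) < cmod (dz \<Omega> f z)
      then (cmod (dz \<Omega> f z) + cmod (dzbar \<Omega> f z)) / (cmod (dz \<Omega> f z) - cmod (dzbar \<Omega> f z))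
      else 1)"

text \<open>Orientation preservation in the topological sense (local degree one). For a map that is
  continuous and injective on the open set \<open>\<Omega>\<close>, the image of each small positively oriented
  circle is a closed path avoiding the image of its centre.\<close>

definition orientation_preserving :: "complex set \<Rightarrow> (complex \<Rightarrow> complex) \<Rightarrow> bool" where
  "orientation_preserving \<Omega> f \<longleftrightarrow>
     (\<forall>z r. 0 < r \<and> cball z r \<subseteq> \<Omega> \<longrightarrow> winding_number (f \<circ> circlepath z r) (f z) = 1)"

section \<open>The admissible class\<close>

definition Q1 :: "real \<Rightarrow> complex set" where
  "Q1 l = {Complex x y | x y. x \<in> {0..l} \<and> y \<in> {0..1}}"

text \<open>Sobolev regularity and (weak) derivatives on the closed rectangle are understood on
  its interior.\<close>

definition admissible :: "real \<Rightarrow> real \<Rightarrow> real \<Rightarrow> (complex \<Rightarrow> complex) set" where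
  "admissible k l n = {f.
     (\<exists>g. homeomorphism (Q1 l) (f ` Q1 l) f g) \<and>
     orientation_preserving (interior (Q1 l)) f \<and>
     finite_distortion (interior (Q1 l)) f \<and>
     f 0 = 0 \<and>
     (\<forall>x \<in> {0..l}. f (Complex x 1) = f (Complex x 0) + \<i>) \<and>
     (\<forall>y \<in> {0..1}. f (Complex l y) = f (Complex 0 y) + Complex (k * l) (n * l))}"

definition linear_stretch :: "real \<Rightarrow> real \<Rightarrow> complex \<Rightarrow> complex" where
  "linear_stretch k n z = Complex (k * Re z) (n * Re z + Im z)"

text \<open>The integrand is nonnegative and may fail to be integrable, hence the
  \<open>ennreal\<close>-valued integral.\<close>

definition mean_distortion :: "(real \<Rightarrow> real) \<Rightarrow> real \<Rightarrow> (complex \<Rightarrow> complex) \<Rightarrow> ennreal" where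
  "mean_distortion \<phi> l f =
     (\<integral>\<^sup>+ z \<in> Q1 l. ennreal (\<phi> (lin_dist (interior (Q1 l)) f z)) \<partial>lebesgue)"

section \<open>Convexity\<close>

definition strictly_convex_on :: "real set \<Rightarrow> (real \<Rightarrow> real) \<Rightarrow> bool" where
  "strictly_convex_on S \<phi> \<longleftrightarrow> convex S \<and>
     (\<forall>x\<in>S. \<forall>y\<in>S. \<forall>u. x \<noteq> y \<and> 0 < u \<and> u < 1 \<longrightarrow>
        \<phi> ((1 - u) * x + u * y) < (1 - u) * \<phi> x + u * \<phi> y)"

text \<open>The second derivative \<open>\<phi>''(t) = d\<close> is the derivative of \<open>\<phi>'\<close>, taken relative to the set on
  which \<open>\<phi>'\<close> exists: a convex \<open>\<phi>\<close> is differentiable only off a countable set, while \<open>deriv\<close>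
  takes unspecified values at the remaining points.\<close>

definition has_second_deriv :: "(real \<Rightarrow> real) \<Rightarrow> real \<Rightarrow> real \<Rightarrow> bool" where
  "has_second_deriv \<phi> d t \<longleftrightarrow>
     \<phi> differentiable (at t) \<and>
     (deriv \<phi> has_real_derivative d) (at t within {s. \<phi> differentiable (at s)})"

end

theory Submission
  imports Defs
begin

text \<open>Write \<open>f\<^sup>*\<close> for the linear stretch, \<open>a\<close>, \<open>b\<close> for the weak Wirtinger derivatives of \<open>f\<close>, \<open>a0\<close>, \<open>b0\<close>
for the constant ones of \<open>f\<^sup>*\<close>, and \<open>K\<close>, \<open>K0\<close> for the two linear distortions. The displacement
\<open>G = f - f\<^sup>*\<close> vanishes on the boundary of the rectangle, so its extension by zero is a compactly
supported Sobolev function on the plane (\<open>zero_extension_weak_derivative\<close>); hence \<open>a - a0\<close> and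
\<open>b - b0\<close> have mean zero. The plan is to show \<open>\<integral>\<bar>b - b0\<bar> = O(sqrt \<epsilon>)\<close> and to recover \<open>G\<close> from
\<open>b - b0\<close>, which is its \<open>dbar\<close>-derivative.

Uniform convexity gives \<open>\<phi> t \<ge> \<phi> K0 + m (t - K0) + c (t - K0)\<^sup>2\<close> (\<open>quadratic_support\<close>), with \<open>m > 0\<close>
unless \<open>K0 = 1\<close>, that is, unless \<open>b0 = 0\<close>. Integration turns the almost minimality of \<open>f\<close> into
\<open>m \<integral>(K - K0) + c \<integral>(K - K0)\<^sup>2 \<le> \<epsilon> T\<close>, where \<open>T\<close> is the mean distortion of \<open>f\<^sup>*\<close>
(\<open>convexity_deficit\<close>). The linear term has a sign. With \<open>s = \<bar>a\<bar> + \<bar>b\<bar>\<close>, \<open>t = \<bar>a\<bar> - \<bar>b\<bar>\<close> one has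
\<open>s = K t\<close> and \<open>J = K t\<^sup>2\<close> for the Jacobian \<open>J\<close>, and expanding \<open>K (t - t0)\<^sup>2\<close> yields
\<open>K - K0 = (2 / t0) (s - s0) - (J - J0) / t0\<^sup>2 + K (t - t0)\<^sup>2 / t0\<^sup>2\<close>.
Here \<open>\<integral>J \<le> \<integral>J0\<close>, because \<open>f\<close> maps the rectangle into its image under \<open>f\<^sup>*\<close>, and \<open>\<integral>(s - s0)\<close> is at
least \<open>\<integral>(\<bar>b\<bar> - Re (\<beta> b))\<close>, where \<open>\<beta>\<close> is the unit number with \<open>\<beta> b0 = \<bar>b0\<bar>\<close>, because the means of
\<open>a - a0\<close> and \<open>b - b0\<close> vanish. So the three nonnegative defects \<open>(K - K0)\<^sup>2\<close>, \<open>K (t - t0)\<^sup>2\<close> and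
\<open>\<bar>b\<bar> - Re (\<beta> b)\<close> all have integrals \<open>O(\<epsilon>)\<close> (the last two only for \<open>m > 0\<close>; for \<open>b0 = 0\<close> the first
suffices), and the arithmetic-geometric mean inequality with weight \<open>sqrt \<epsilon>\<close> bounds
\<open>\<integral>\<bar>b - b0\<bar>\<close> by \<open>O(sqrt \<epsilon>)\<close> (\<open>integral_dbar_defect\<close>).

A Cauchy type formula gives \<open>\<integral>\<bar>G\<bar> \<le> C \<integral>\<bar>G\<^sub>x + \<i> G\<^sub>y\<bar>\<close> (\<open>L1_dbar_bound\<close>), and since \<open>G\<close> is
bounded, \<open>\<integral>\<bar>G\<bar>\<^sup>p\<close> is at most a constant times \<open>\<integral>\<bar>G\<bar>\<close>, which is the claim.

The inequality \<open>\<integral>J \<le> \<bar>f(Q)\<bar>\<close> for a map that is merely \<open>W\<^sup>1\<^sup>,\<^sup>1\<close> and injective is the main analytic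
ingredient. It rests on \<open>differentiable_pieces\<close>: up to a null set the plane is an increasing union of
sets \<open>S j\<close> relative to which \<open>G\<close> is differentiable with its weak gradient as derivative, so that the
change of variables formula applies on each piece. The inclusion of the images
(\<open>homeomorphic_image_subset_by_boundary\<close>) is a connectedness argument.\<close>

section \<open>Smooth test functions\<close>

text \<open>The functions \<open>exp (- 1 / x) / x ^ j\<close>, cut off at zero, are closed under differentiation up to linear
combinations. The algebra that they generate after composition with affine functions is therefore
closed under partial derivatives, which makes all its members smooth by a single induction.\<close>

definition flat :: "nat \<Rightarrow> real \<Rightarrow> real" where
  "flat j x = (if x \<le> 0 then 0 else exp (- (1 / x)) / x ^ j)"

lemma flat_tendsto_0: "(flat j \<longlongrightarrow> 0) (at 0)"
proof (rule filterlim_split_at)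
  show "(flat j \<longlongrightarrow> 0) (at_left 0)"
    by (rule tendsto_eventually) (auto simp: flat_def eventually_at_filter)
  have "((\<lambda>x. (inverse x) ^ j / exp (inverse x :: real)) \<longlongrightarrow> 0) (at_right 0)"
    using tendsto_compose_filtermap
      filterlim_compose[OF tendsto_power_div_exp_0 filterlim_inverse_at_top_right] by auto
  then show "(flat j \<longlongrightarrow> 0) (at_right 0)"
    by (rule Lim_transform_eventually)
       (auto simp: flat_def eventually_at_filter exp_minus field_simps)
qed

lemma flat_has_derivative:
  "(flat j has_real_derivative flat (j + 2) x - real j * flat (j + 1) x) (at x)"
proof -
  consider "x < 0" | "x = 0" | "x > 0" by linarith
  then show ?thesis
  proof cases
    case 1
    have "(flat j has_real_derivative 0) (at x)"
      by (rule has_field_derivative_transform_within_open[of "\<lambda>_. 0" _ _ "{..<0}"])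
         (use 1 in \<open>auto simp: flat_def\<close>)
    then show ?thesis using 1 by (simp add: flat_def)
  next
    case 2
    have "((\<lambda>h. (flat j (0 + h) - flat j 0) / h) \<longlongrightarrow> 0) (at 0)"
      by (rule Lim_transform_eventually[OF flat_tendsto_0[of "Suc j"]])
         (auto simp: flat_def eventually_at_filter field_simps)
    then show ?thesis unfolding 2 by (simp add: DERIV_def flat_def)
  next
    case 3
    have "((\<lambda>x. exp (- (1 / x)) / x ^ j) has_real_derivative
        flat (j + 2) x - real j * flat (j + 1) x) (at x)"
    proof (cases j)
      case 0
      then show ?thesis
        using 3 by (auto intro!: derivative_eq_intros simp: flat_def field_simps power2_eq_square)
    next
      case (Suc i)
      have "((\<lambda>x. exp (- (1 / x)) / x ^ j) has_real_derivative
        ((exp (- (1 / x)) * (1 / x^2)) * x ^ j - exp (- (1 / x)) * (real j * x ^ i)) / (x ^ j * x ^ j)) (at x)"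
        using DERIV_pow[of j x] 3 Suc
        by (intro DERIV_divide) (auto intro!: derivative_eq_intros simp: power2_eq_square)
      also have "((exp (- (1 / x)) * (1 / x^2)) * x ^ j - exp (- (1 / x)) * (real j * x ^ i)) / (x ^ j * x ^ j)
          = flat (j + 2) x - real j * flat (j + 1) x"
        using 3 Suc by (simp add: flat_def field_simps power2_eq_square)
      finally show ?thesis .
    qed
    then show ?thesis
      by (rule has_field_derivative_transform_within_open[of _ _ _ "{0<..}"])
         (use 3 in \<open>auto simp: flat_def\<close>)
  qed
qed

lemma flat_nonneg: "flat j x \<ge> 0"
  by (simp add: flat_def)

lemma flat_0_le_1: "flat 0 x \<le> 1"
  by (simp add: flat_def)

lemma flat_eq_0_iff: "flat j x = 0 \<longleftrightarrow> x \<le> 0"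
  by (simp add: flat_def)

lemma continuous_flat [continuous_intros]: "continuous_on S g \<Longrightarrow> continuous_on S (\<lambda>z. flat j (g z))"
  by (rule continuous_on_compose2[of UNIV "flat j"])
     (auto intro!: continuous_at_imp_continuous_on DERIV_isCont flat_has_derivative)

text \<open>Smoothness in the sense of \<open>Ck\<close> for every order cannot be checked one order at a time; membership in
this class is a certificate of it that is stable under sums, products, translations and derivatives.\<close>

inductive flat_generated :: "(complex \<Rightarrow> real) \<Rightarrow> bool" where
  const: "flat_generated (\<lambda>z. c)"
| flat: "flat_generated (\<lambda>z. flat j (z \<bullet> a + c))"
| add: "flat_generated g \<Longrightarrow> flat_generated h \<Longrightarrow> flat_generated (\<lambda>z. g z + h z)"
| mult: "flat_generated g \<Longrightarrow> flat_generated h \<Longrightarrow> flat_generated (\<lambda>z. g z * h z)"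

lemma flat_generated_derivative:
  assumes "flat_generated h"
  shows "\<exists>h'. (\<forall>z. (h has_derivative (\<lambda>v. h' v z)) (at z)) \<and> (\<forall>v. flat_generated (h' v))"
  using assms
proof induction
  case (const c)
  show ?case by (rule exI[of _ "\<lambda>v z. 0"]) (auto intro: flat_generated.const)
next
  case (flat j a c)
  let ?h' = "\<lambda>v z. (v \<bullet> a) * (flat (j + 2) (z \<bullet> a + c) + (- real j) * flat (j + 1) (z \<bullet> a + c))"
  have "((\<lambda>z. flat j (z \<bullet> a + c)) has_derivative (\<lambda>v. ?h' v z)) (at z)" for z
  proof -
    have "((\<lambda>z. z \<bullet> a + c) has_derivative (\<lambda>v. v \<bullet> a)) (at z)"
      by (auto intro!: derivative_eq_intros)
    from has_derivative_compose[OF this flat_has_derivative[of j, unfolded has_field_derivative_def]]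
    show ?thesis by (simp add: algebra_simps)
  qed
  moreover have "flat_generated (?h' v)" for v
    by (intro flat_generated.intros)
  ultimately show ?case by (intro exI[of _ ?h']) blast
next
  case (add g h)
  then obtain g' h' where
      g': "\<And>z. (g has_derivative (\<lambda>v. g' v z)) (at z)" "\<And>v. flat_generated (g' v)" and
      h': "\<And>z. (h has_derivative (\<lambda>v. h' v z)) (at z)" "\<And>v. flat_generated (h' v)"
    by blast
  show ?case
    by (rule exI[of _ "\<lambda>v z. g' v z + h' v z"])
       (auto intro!: has_derivative_add g' h' flat_generated.add)
next
  case (mult g h)
  then obtain g' h' where
      g': "\<And>z. (g has_derivative (\<lambda>v. g' v z)) (at z)" "\<And>v. flat_generated (g' v)" and
      h': "\<And>z. (h has_derivative (\<lambda>v. h' v z)) (at z)" "\<And>v. flat_generated (h' v)"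
    by blast
  show ?case
    by (rule exI[of _ "\<lambda>v z. g z * h' v z + g' v z * h z"])
       (auto intro!: has_derivative_mult g' h' flat_generated.add flat_generated.mult mult)
qed

lemma flat_generated_differentiable: "flat_generated h \<Longrightarrow> h differentiable (at z)"
  using flat_generated_derivative unfolding differentiable_def by blast

lemma flat_generated_has_derivative:
  "flat_generated h \<Longrightarrow> (h has_derivative frechet_derivative h (at z)) (at z)"
  using flat_generated_differentiable frechet_derivative_works by blast

lemma flat_generated_partial:
  assumes "flat_generated h" shows "flat_generated (\<lambda>z. frechet_derivative h (at z) v)"
proof -
  obtain h' where h': "\<And>z. (h has_derivative (\<lambda>v. h' v z)) (at z)" "\<And>v. flat_generated (h' v)"
    using flat_generated_derivative[OF assms] by blast
  have "(\<lambda>z. frechet_derivative h (at z) v) = h' v"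
    by (rule ext) (simp flip: frechet_derivative_at[OF h'(1)])
  then show ?thesis using h'(2) by simp
qed

lemma flat_generated_continuous: "flat_generated h \<Longrightarrow> continuous_on S h"
  by (simp add: continuous_at_imp_continuous_on differentiable_imp_continuous_within
      flat_generated_differentiable)

lemma flat_generated_Ck: "flat_generated h \<Longrightarrow> Ck m h"
proof (induction m arbitrary: h)
  case 0 then show ?case by (simp add: flat_generated_continuous)
next
  case (Suc m)
  then show ?case
    using flat_generated_partial
    by (auto simp: differentiable_on_def flat_generated_differentiable)
qed

lemma flat_generated_translate:
  assumes "flat_generated h" shows "flat_generated (\<lambda>z. h (z - c))"
  using assms
proof induction
  case (flat j a d)
  have "(\<lambda>z. flat j ((z - c) \<bullet> a + d)) = (\<lambda>z. flat j (z \<bullet> a + (d - c \<bullet> a)))"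
    by (simp add: inner_diff_left algebra_simps)
  then show ?case by (simp add: flat_generated.flat)
qed (auto intro: flat_generated.intros)

lemma flat_generated_test_function:
  assumes "flat_generated h" "{z. h z \<noteq> 0} \<subseteq> A" "compact A" "A \<subseteq> \<Omega>"
  shows "h \<in> test_functions \<Omega>"
proof -
  have "closure {z. h z \<noteq> 0} \<subseteq> A"
    using assms(2,3) by (meson closure_minimal compact_imp_closed)
  then show ?thesis
    using assms unfolding test_functions_def
    by (auto intro: flat_generated_Ck bounded_subset[of A] simp: compact_closure compact_imp_bounded)
qed

definition box_bump :: "real \<Rightarrow> complex \<Rightarrow> complex \<Rightarrow> complex \<Rightarrow> real" where
  "box_bump N a b z =
     flat 0 (N * (Re z - Re a)) * flat 0 (N * (Re b - Re z)) *
     (flat 0 (N * (Im z - Im a)) * flat 0 (N * (Im b - Im z)))"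

lemma flat_generated_box_bump: "flat_generated (box_bump N a b)"
proof -
  have *: "flat_generated (\<lambda>z. flat 0 (N * (Re z - Re a)))" for N a
    using flat_generated.flat[of 0 "of_real N" "- N * Re a"]
    by (simp add: inner_complex_def algebra_simps)
  have **: "flat_generated (\<lambda>z. flat 0 (N * (Im z - Im a)))" for N a
    using flat_generated.flat[of 0 "of_real N * \<i>" "- N * Im a"]
    by (simp add: inner_complex_def algebra_simps)
  have "flat_generated (\<lambda>z. flat 0 (N * (Re b - Re z)))"
       "flat_generated (\<lambda>z. flat 0 (N * (Im b - Im z)))"
    using *[of "-N" b] **[of "-N" b] by (simp_all add: algebra_simps)
  then show ?thesis
    unfolding box_bump_def using * ** by (intro flat_generated.mult)
qed

lemma box_complex: "box a b = {z. Re a < Re z \<and> Re z < Re b \<and> Im a < Im z \<and> Im z < Im b}"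
  by (auto simp: box_def Basis_complex_def)

lemma cbox_complex: "cbox a b = {z. Re a \<le> Re z \<and> Re z \<le> Re b \<and> Im a \<le> Im z \<and> Im z \<le> Im b}"
  by (auto simp: cbox_def Basis_complex_def)

lemma box_bump_support: "N > 0 \<Longrightarrow> {z. box_bump N a b z \<noteq> 0} = box a b"
  by (auto simp: box_bump_def box_complex flat_eq_0_iff not_le zero_less_mult_iff)

lemma box_bump_nonneg: "box_bump N a b z \<ge> 0"
  by (simp add: box_bump_def flat_nonneg)

lemma box_bump_le_1: "box_bump N a b z \<le> 1"
  unfolding box_bump_def by (intro mult_le_one flat_0_le_1 flat_nonneg mult_nonneg_nonneg)

lemma box_bump_outside: "N > 0 \<Longrightarrow> z \<notin> box a b \<Longrightarrow> box_bump N a b z = 0"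
  using box_bump_support[of N a b] by blast

lemma integrable_continuous_support:
  fixes f :: "'a::euclidean_space \<Rightarrow> 'b::{banach, second_countable_topology}"
  assumes "continuous_on UNIV f" "compact A" "\<And>z. z \<notin> A \<Longrightarrow> f z = 0"
  shows "integrable lborel f"
proof -
  have "integrable lborel (\<lambda>x. indicator A x *\<^sub>R f x)"
    using borel_integrable_compact[OF assms(2), of f] assms(1)
    by (auto simp: set_integrable_def intro: continuous_on_subset)
  moreover have "(\<lambda>x. indicator A x *\<^sub>R f x) = f"
    using assms(3) by (auto simp: indicator_def)
  ultimately show ?thesis by simp
qed

text \<open>Supported in the square of side \<open>\<delta>\<close> around the origin, hence in the disc of radius \<open>\<delta>\<close>.\<close>

definition mollifier :: "real \<Rightarrow> complex \<Rightarrow> real" where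
  "mollifier \<delta> z = box_bump 1 (- Complex (\<delta>/2) (\<delta>/2)) (Complex (\<delta>/2) (\<delta>/2)) z /
     (LINT z|lborel. box_bump 1 (- Complex (\<delta>/2) (\<delta>/2)) (Complex (\<delta>/2) (\<delta>/2)) z)"

lemma flat_generated_mollifier: "flat_generated (mollifier \<delta>)"
proof -
  have "mollifier \<delta> = (\<lambda>z. inverse (LINT z|lborel. box_bump 1 (- Complex (\<delta>/2) (\<delta>/2)) (Complex (\<delta>/2) (\<delta>/2)) z) *
     box_bump 1 (- Complex (\<delta>/2) (\<delta>/2)) (Complex (\<delta>/2) (\<delta>/2)) z)"
    by (auto simp: mollifier_def fun_eq_iff field_simps)
  then show ?thesis
    by (auto intro: flat_generated.intros flat_generated_box_bump)
qed

lemma mollifier_nonneg: "mollifier \<delta> z \<ge> 0"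
  unfolding mollifier_def by (intro divide_nonneg_nonneg integral_nonneg_AE) (auto simp: box_bump_nonneg)

lemma mollifier_outside:
  assumes "\<delta> > 0" "cmod z \<ge> \<delta>" shows "mollifier \<delta> z = 0"
proof -
  have "z \<notin> box (- Complex (\<delta>/2) (\<delta>/2)) (Complex (\<delta>/2) (\<delta>/2))"
    using assms cmod_le[of z] by (auto simp: box_complex)
  then show ?thesis by (simp add: mollifier_def box_bump_outside)
qed

lemma continuous_mollifier: "continuous_on S (mollifier \<delta>)"
  by (rule flat_generated_continuous[OF flat_generated_mollifier])

lemma integrable_mollifier: "\<delta> > 0 \<Longrightarrow> integrable lborel (mollifier \<delta>)"
  by (rule integrable_continuous_support[of _ "cball 0 \<delta>"])
     (auto simp: continuous_mollifier intro: mollifier_outside)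

lemma integral_mollifier:
  assumes "\<delta> > 0" shows "(LINT z|lborel. mollifier \<delta> z) = 1"
proof -
  let ?c = "Complex (\<delta>/2) (\<delta>/2)"
  let ?h = "box_bump 1 (- ?c) ?c"
  have int: "integrable lborel ?h"
    by (rule integrable_continuous_support[of _ "cbox (-?c) ?c"])
       (use box_subset_cbox in \<open>auto simp: flat_generated_continuous flat_generated_box_bump intro!: box_bump_outside\<close>)
  have "(LINT z|lborel. ?h z) \<noteq> 0"
  proof
    assume "(LINT z|lborel. ?h z) = 0"
    then have "AE z in lborel. ?h z = 0"
      using integral_nonneg_eq_0_iff_AE[OF int] by (auto simp: box_bump_nonneg)
    then have "AE z in lborel. z \<notin> box (-?c) ?c"
      by eventually_elim (use box_bump_support[of 1 "-?c" ?c] in auto)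
    then have "emeasure lborel (box (-?c) ?c) = 0"
      by (subst (asm) AE_iff_measurable[of "box (-?c) ?c"]) auto
    moreover have "emeasure lborel (box (-?c) ?c) = ennreal (\<delta> * \<delta>)"
      using assms by (subst emeasure_lborel_box) (auto simp: Basis_complex_def)
    ultimately show False using assms by simp
  qed
  then show ?thesis unfolding mollifier_def by simp
qed

section \<open>Approximation and mollification of integrable functions\<close>

definition clamp_norm :: "real \<Rightarrow> complex \<Rightarrow> complex" where
  "clamp_norm N y = (N / max N (cmod y)) *\<^sub>R y"

lemma continuous_clamp_norm: "N > 0 \<Longrightarrow> continuous_on UNIV (clamp_norm N)"
  unfolding clamp_norm_def by (intro continuous_intros) auto

lemma norm_clamp_norm: "N > 0 \<Longrightarrow> cmod (clamp_norm N y) \<le> N"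
  by (simp add: clamp_norm_def max_def field_simps)

lemma norm_clamp_norm': "N > 0 \<Longrightarrow> cmod (clamp_norm N y) \<le> cmod y"
  by (simp add: clamp_norm_def max_def field_simps)

lemma clamp_norm_eq: "N > 0 \<Longrightarrow> cmod y \<le> N \<Longrightarrow> clamp_norm N y = y"
  by (simp add: clamp_norm_def)

definition tent :: "real \<Rightarrow> complex \<Rightarrow> real" where
  "tent N z = max 0 (min 1 (N + 1 - cmod z))"

lemma tent: "0 \<le> tent N z" "tent N z \<le> 1" "cmod z \<ge> N + 1 \<Longrightarrow> tent N z = 0"
    "cmod z \<le> N \<Longrightarrow> tent N z = 1" "continuous_on UNIV (tent N)"
  unfolding tent_def by (auto intro!: continuous_intros)

text \<open>Truncation in the domain by \<open>tent\<close> and in the range by \<open>clamp_norm\<close> makes the approximation of \<open>e\<close> by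
continuous functions, which holds only pointwise almost everywhere for a measurable \<open>e\<close>, dominated.\<close>

lemma L1_approx_continuous:
  fixes e :: "complex \<Rightarrow> complex"
  assumes e: "integrable lborel e" and eta: "\<eta> > 0"
  obtains W R where "continuous_on UNIV W" "\<And>z. cmod z \<ge> R \<Longrightarrow> W z = 0"
    "(LINT z|lborel. cmod (e z - W z)) < \<eta>"
proof -
  have em: "e \<in> borel_measurable borel" using e by simp
  then have "e measurable_on UNIV"
    by (simp add: measurable_on_iff_borel_measurable lebesgue_on_UNIV_eq measurable_completion)
  then obtain N0 g where N0: "negligible N0" and g: "\<And>n. continuous_on UNIV (g n)"
    and lim: "\<And>x. x \<notin> N0 \<Longrightarrow> (\<lambda>n. g n x) \<longlonglongrightarrow> e x"
    unfolding measurable_on_def by auto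
  have ae: "AE x in lborel. x \<notin> N0"
  proof -
    have "AE x in lebesgue. x \<notin> N0"
      using N0 by (simp add: negligible_iff_null_sets AE_not_in)
    then show ?thesis by (simp add: AE_completion_iff)
  qed
  have "((\<lambda>N::real. LINT z|lborel. cmod (e z - tent N z *\<^sub>R clamp_norm N (e z))) \<longlongrightarrow> (LINT z|(lborel :: complex measure). (0::real))) at_top"
  proof (rule integral_dominated_convergence_at_top[where w = "\<lambda>z. 2 * cmod (e z)"])
    show "\<forall>\<^sub>F N in at_top. AE x in lborel. norm (cmod (e x - tent N x *\<^sub>R clamp_norm N (e x))) \<le> 2 * cmod (e x)"
      using eventually_gt_at_top[of "0::real"]
    proof eventually_elim
      case (elim N)
      show ?case
      proof (intro AE_I2)
        fix x
        have "cmod (e x - tent N x *\<^sub>R clamp_norm N (e x)) \<le> cmod (e x) + cmod (tent N x *\<^sub>R clamp_norm N (e x))"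
          by (rule norm_triangle_ineq4)
        also have "cmod (tent N x *\<^sub>R clamp_norm N (e x)) \<le> 1 * cmod (e x)"
          unfolding norm_scaleR using tent(1,2)[of N x] norm_clamp_norm'[OF elim, of "e x"]
          by (intro mult_mono) auto
        finally show "norm (cmod (e x - tent N x *\<^sub>R clamp_norm N (e x))) \<le> 2 * cmod (e x)" by simp
      qed
    qed
    show "AE x in lborel. ((\<lambda>N. cmod (e x - tent N x *\<^sub>R clamp_norm N (e x))) \<longlongrightarrow> 0) at_top"
    proof (intro AE_I2)
      fix x
      have "\<forall>\<^sub>F N in at_top. N > max 0 (max (cmod x) (cmod (e x)))"
        by (rule eventually_gt_at_top)
      then show "((\<lambda>N. cmod (e x - tent N x *\<^sub>R clamp_norm N (e x))) \<longlongrightarrow> 0) at_top"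
        by (intro tendsto_eventually, elim eventually_mono) (auto simp: clamp_norm_eq tent)
    qed
    show "(\<lambda>z. cmod (e z - tent N z *\<^sub>R clamp_norm N (e z))) \<in> borel_measurable lborel" for N
      using em unfolding tent_def clamp_norm_def by measurable
  qed (use e in auto)
  then have "\<forall>\<^sub>F N in at_top. (LINT z|lborel. cmod (e z - tent N z *\<^sub>R clamp_norm N (e z))) < \<eta> / 2"
    using eta by (intro order_tendstoD) auto
  then obtain N where N: "N > 0" "(LINT z|lborel. cmod (e z - tent N z *\<^sub>R clamp_norm N (e z))) < \<eta> / 2"
    using eventually_conj[OF _ eventually_gt_at_top[of "0::real"]]
    by (metis (no_types, lifting) eventually_happens trivial_limit_at_top_linorder)
  let ?w = "\<lambda>n z. tent N z *\<^sub>R clamp_norm N (g n z)"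
  let ?v = "\<lambda>z. tent N z *\<^sub>R clamp_norm N (e z)"
  have cw: "continuous_on UNIV (?w n)" for n
    by (intro continuous_intros tent continuous_on_compose2[OF continuous_clamp_norm[OF N(1)] g]) auto
  have nw: "cmod (tent N z *\<^sub>R clamp_norm N y) \<le> indicator (cball 0 (N+1)) z *\<^sub>R N" for y z
    using tent(1,2)[of N z] tent(3)[of N z] norm_clamp_norm[OF N(1), of y] N(1) mult_mono[of "tent N z" 1 "cmod (clamp_norm N y)" N]
    by (auto simp: indicator_def)
  have "(\<lambda>n. LINT z|lborel. cmod (?v z - ?w n z)) \<longlonglongrightarrow> (LINT z|(lborel :: complex measure). (0::real))"
  proof (rule integral_dominated_convergence[where w = "\<lambda>z. 2 * (indicator (cball 0 (N+1)) z *\<^sub>R N)"])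
    show "integrable lborel (\<lambda>z::complex. 2 * (indicator (cball 0 (N+1)) z *\<^sub>R N))"
      by (intro integrable_mult_right integrable_scaleR_left integrable_real_indicator)
         (auto intro: emeasure_bounded_finite[unfolded infinity_ennreal_def])
    show "AE x in lborel. (\<lambda>n. cmod (?v x - ?w n x)) \<longlonglongrightarrow> 0"
      using ae
    proof eventually_elim
      case (elim x)
      have "isCont (clamp_norm N) (e x)"
        using continuous_clamp_norm[OF N(1)] by (simp add: continuous_on_eq_continuous_at)
      then have "(\<lambda>n. clamp_norm N (g n x)) \<longlonglongrightarrow> clamp_norm N (e x)"
        using lim[OF elim] by (rule isCont_tendsto_compose)
      then have "(\<lambda>n. cmod (?v x - ?w n x)) \<longlonglongrightarrow> cmod (?v x - ?v x)"
        by (intro tendsto_intros)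
      then show ?case by simp
    qed
    show "AE x in lborel. norm (cmod (?v x - ?w n x)) \<le> 2 * (indicator (cball 0 (N+1)) x *\<^sub>R N)" for n
      using nw[of x "e x" for x] nw[of x "g n x" for x] norm_triangle_ineq4[of "?v x" "?w n x" for x]
      by (intro AE_I2) (smt (verit, best) real_norm_def abs_norm_cancel)
    show "(\<lambda>z. cmod (?v z - ?w n z)) \<in> borel_measurable lborel" for n
      using em g[of n, THEN borel_measurable_continuous_onI] unfolding tent_def clamp_norm_def by measurable
  qed auto
  then have "\<forall>\<^sub>F n in sequentially. (LINT z|lborel. cmod (?v z - ?w n z)) < \<eta> / 2"
    using eta by (intro order_tendstoD) auto
  then obtain n where n: "(LINT z|lborel. cmod (?v z - ?w n z)) < \<eta> / 2"
    by (meson eventually_happens trivial_limit_sequentially)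
  have supp: "?w n z = 0" if "cmod z \<ge> N + 1" for z
    using that by (simp add: tent)
  have wint: "integrable lborel (?w n)"
  proof (rule integrable_continuous_support[OF cw, of "cball 0 (N+1)"])
    show "?w n z = 0" if "z \<notin> cball 0 (N+1)" for z using supp[of z] that by auto
  qed auto
  have vint: "integrable lborel ?v"
  proof (rule Bochner_Integration.integrable_bound[OF e])
    show "?v \<in> borel_measurable lborel" using em unfolding tent_def clamp_norm_def by measurable
    show "AE z in lborel. norm (?v z) \<le> norm (e z)"
      using tent(1,2)[of N] norm_clamp_norm'[OF N(1)] by (auto intro!: AE_I2 intro: order_trans[OF mult_mono[of _ 1]])
  qed
  have "(LINT z|lborel. cmod (e z - ?w n z)) \<le> (LINT z|lborel. cmod (e z - ?v z) + cmod (?v z - ?w n z))"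
    using e wint vint
    by (intro Bochner_Integration.integral_mono integrable_add integrable_norm Bochner_Integration.integrable_diff)
       (auto intro: norm_triangle_sub order_trans[OF _ norm_triangle_ineq])
  also have "\<dots> = (LINT z|lborel. cmod (e z - ?v z)) + (LINT z|lborel. cmod (?v z - ?w n z))"
    using e wint vint by (intro Bochner_Integration.integral_add) auto
  finally have "(LINT z|lborel. cmod (e z - ?w n z)) < \<eta>" using N n by linarith
  then show ?thesis using that[OF cw supp] by blast
qed

lemma nn_integral_lborel_translate:
  fixes f :: "complex \<Rightarrow> ennreal"
  assumes "f \<in> borel_measurable borel"
  shows "(\<integral>\<^sup>+ z. f (z + w) \<partial>lborel) = (\<integral>\<^sup>+ z. f z \<partial>lborel)"
proof -
  have "(\<integral>\<^sup>+ z. f z \<partial>lborel) = (\<integral>\<^sup>+ z. f z \<partial>distr lborel borel (\<lambda>z. w + z))"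
    by (simp add: lborel_distr_plus)
  also have "\<dots> = (\<integral>\<^sup>+ z. f (w + z) \<partial>lborel)"
    using assms by (subst nn_integral_distr) auto
  finally show ?thesis by (simp add: add.commute)
qed

lemma integrable_lborel_translate:
  fixes f :: "complex \<Rightarrow> 'b::{banach, second_countable_topology}"
  assumes "integrable lborel f"
  shows "integrable lborel (\<lambda>z. f (z + w))" "(LINT z|lborel. f (z + w)) = (LINT z|lborel. f z)"
proof -
  have "integrable (distr lborel borel (\<lambda>z. w + z)) f" using assms by (simp add: lborel_distr_plus)
  then show "integrable lborel (\<lambda>z. f (z + w))"
    using assms by (subst (asm) integrable_distr_eq) (auto simp: add.commute)
  have "(LINT z|lborel. f z) = (LINT z|distr lborel borel (\<lambda>z. w + z). f z)"
    by (simp add: lborel_distr_plus)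
  also have "\<dots> = (LINT z|lborel. f (w + z))"
    using assms by (subst integral_distr) auto
  finally show "(LINT z|lborel. f (z + w)) = (LINT z|lborel. f z)" by (simp add: add.commute)
qed

lemma L1_translation_continuous:
  fixes e :: "complex \<Rightarrow> complex"
  assumes e: "integrable lborel e" and eta: "\<eta> > 0"
  obtains d where "d > 0" "\<And>w. cmod w < d \<Longrightarrow> (LINT z|lborel. cmod (e (z + w) - e z)) < \<eta>"
proof -
  obtain W R0 where W: "continuous_on UNIV W" "\<And>z. cmod z \<ge> R0 \<Longrightarrow> W z = 0"
    "(LINT z|lborel. cmod (e z - W z)) < \<eta> / 3"
    using L1_approx_continuous[OF e, of "\<eta>/3"] eta by auto
  define R where "R = max 1 R0"
  have R: "R \<ge> 1" "\<And>z. cmod z \<ge> R \<Longrightarrow> W z = 0" using W by (auto simp: R_def)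
  have Wi: "integrable lborel W"
    by (rule integrable_continuous_support[OF W(1), of "cball 0 R"]) (auto intro: R)
  have uc: "uniformly_continuous_on (cball 0 (R + 2)) W"
    using W(1) by (intro compact_uniformly_continuous) (auto intro: continuous_on_subset)
  define A where "A = measure lborel (cball (0::complex) (R + 1))"
  have A: "A \<ge> 0" by (simp add: A_def)
  have "\<eta> / (3 * (A + 1)) > 0" using eta A by simp
  then obtain d0 where d0: "d0 > 0" and
    d0': "\<And>x y. cmod x \<le> R + 2 \<Longrightarrow> cmod y \<le> R + 2 \<Longrightarrow> cmod (y - x) < d0 \<Longrightarrow> cmod (W y - W x) < \<eta> / (3 * (A + 1))"
    using uc unfolding uniformly_continuous_on_def dist_norm
    by (metis mem_cball_0)
  show ?thesis
  proof (rule that[of "min 1 d0"])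
    show "min 1 d0 > 0" using d0 by simp
    fix w assume w: "cmod w < min 1 d0"
    note [simp] = integrable_lborel_translate[OF e] integrable_lborel_translate[OF Wi] e Wi
    have pt: "cmod (W (z + w) - W z) \<le> indicator (cball 0 (R+1)) z * (\<eta> / (3 * (A + 1)))" for z
    proof (cases "cmod z \<le> R + 1")
      case True
      then have "cmod (z + w) \<le> R + 2" using w norm_triangle_ineq[of z w] by auto
      then have "cmod (W (z + w) - W z) < \<eta> / (3 * (A + 1))"
        using d0'[of z "z + w"] True w by auto
      then show ?thesis using True by simp
    next
      case False
      then have "cmod (z + w) \<ge> R" using w norm_diff_ineq[of z w] by auto
      then show ?thesis using False by (simp add: R)
    qed
    have Wd: "(LINT z|lborel. cmod (W (z + w) - W z)) \<le> \<eta> / 3"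
    proof -
      have "(LINT z|lborel. cmod (W (z + w) - W z)) \<le> (LINT z|lborel. indicator (cball 0 (R+1)) (z::complex) * (\<eta> / (3 * (A + 1))))"
      proof (rule Bochner_Integration.integral_mono)
        show "integrable lborel (\<lambda>z::complex. indicat_real (cball 0 (R+1)) z * (\<eta> / (3 * (A + 1))))"
          by (intro integrable_mult_left integrable_real_indicator) (auto intro: emeasure_bounded_finite[unfolded infinity_ennreal_def])
      qed (use pt in auto)
      also have "\<dots> = A * (\<eta> / (3 * (A + 1)))" by (simp add: A_def)
      also have "\<dots> \<le> \<eta> / 3" using A eta by (simp add: field_simps)
      finally show ?thesis .
    qed
    have "(LINT z|lborel. cmod (e (z + w) - e z)) \<le>
       (LINT z|lborel. cmod (e (z + w) - W (z + w)) + cmod (W (z + w) - W z) + cmod (e z - W z))"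
    proof (rule Bochner_Integration.integral_mono)
      fix z
      have "e (z + w) - e z = (e (z + w) - W (z + w)) + (W (z + w) - W z) - (e z - W z)" by simp
      then show "cmod (e (z + w) - e z) \<le> cmod (e (z + w) - W (z + w)) + cmod (W (z + w) - W z) + cmod (e z - W z)"
        by (smt (verit) norm_triangle_ineq norm_triangle_ineq4)
    qed auto
    also have "\<dots> = (LINT z|lborel. cmod (e (z + w) - W (z + w))) + (LINT z|lborel. cmod (W (z + w) - W z))
        + (LINT z|lborel. cmod (e z - W z))"
      by (subst Bochner_Integration.integral_add; simp)+
    also have "(LINT z|lborel. cmod (e (z + w) - W (z + w))) = (LINT z|lborel. cmod (e z - W z))"
      using integrable_lborel_translate(2)[of "\<lambda>z. cmod (e z - W z)" w] by simp
    finally show "(LINT z|lborel. cmod (e (z + w) - e z)) < \<eta>" using Wd W(3) by linarith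
  qed
qed

definition mollify :: "real \<Rightarrow> (complex \<Rightarrow> complex) \<Rightarrow> complex \<Rightarrow> complex" where
  "mollify \<delta> e z = (LINT w|lborel. mollifier \<delta> (w - z) *\<^sub>R e w)"

lemma mollify_shift:
  assumes [measurable]: "e \<in> borel_measurable borel"
  shows "mollify \<delta> e z = (LINT w|lborel. mollifier \<delta> w *\<^sub>R e (z + w))"
proof -
  have [measurable]: "mollifier \<delta> \<in> borel_measurable borel"
    using continuous_mollifier by (rule borel_measurable_continuous_onI)
  have "mollify \<delta> e z = (LINT w|distr lborel borel (\<lambda>w. z + w). mollifier \<delta> (w - z) *\<^sub>R e w)"
    by (simp add: mollify_def lborel_distr_plus)
  also have "\<dots> = (LINT w|lborel. mollifier \<delta> w *\<^sub>R e (z + w))"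
    by (subst integral_distr) auto
  finally show ?thesis .
qed

lemma mollifier_measurable [measurable]: "mollifier \<delta> \<in> borel_measurable borel"
  using continuous_mollifier by (rule borel_measurable_continuous_onI)

lemma bounded_mollifier: "\<delta> > 0 \<Longrightarrow> \<exists>B. \<forall>z. mollifier \<delta> z \<le> B"
proof -
  assume d: "\<delta> > 0"
  have "compact (mollifier \<delta> ` cball 0 \<delta>)"
    by (intro compact_continuous_image continuous_mollifier) auto
  then obtain B where B: "\<And>z. z \<in> cball 0 \<delta> \<Longrightarrow> norm (mollifier \<delta> z) \<le> B"
    by (meson bounded_iff compact_imp_bounded imageI)
  show ?thesis
  proof (intro exI[of _ "max B 0"] allI)
    fix z show "mollifier \<delta> z \<le> max B 0"
      using B[of z] mollifier_outside[OF d, of z] by (cases "cmod z \<le> \<delta>") (auto simp: abs_if split: if_splits)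
  qed
qed

lemma integrable_mollifier_mult:
  assumes "\<delta> > 0" "integrable lborel (e :: complex \<Rightarrow> complex)"
  shows "integrable lborel (\<lambda>w. mollifier \<delta> (w - z) *\<^sub>R e w)"
    "integrable lborel (\<lambda>w. mollifier \<delta> w *\<^sub>R e (z + w))"
proof -
  obtain B where B: "\<And>z. mollifier \<delta> z \<le> B" using bounded_mollifier[OF assms(1)] by blast
  have *: "integrable lborel (\<lambda>w. mollifier \<delta> (w - z) *\<^sub>R f w)" if "integrable lborel f" for z and f :: "complex \<Rightarrow> complex"
  proof (rule Bochner_Integration.integrable_bound[of _ "\<lambda>w. B *\<^sub>R f w"])
    show "AE w in lborel. norm (mollifier \<delta> (w - z) *\<^sub>R f w) \<le> norm (B *\<^sub>R f w)"
      using B by (auto intro!: AE_I2 mult_right_mono simp: mollifier_nonneg intro: order_trans[OF _ abs_ge_self])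
  qed (use that in \<open>auto intro: borel_measurable_scaleR\<close>)
  show "integrable lborel (\<lambda>w. mollifier \<delta> (w - z) *\<^sub>R e w)" using *[OF assms(2)] .
  show "integrable lborel (\<lambda>w. mollifier \<delta> w *\<^sub>R e (z + w))"
    using *[OF integrable_lborel_translate(1)[OF assms(2), of z], of 0] by (simp add: add.commute)
qed

lemma mollify_measurable [measurable]:
  assumes [measurable]: "e \<in> borel_measurable borel"
  shows "mollify \<delta> e \<in> borel_measurable borel"
proof -
  have "(\<lambda>z. LINT w|lborel. mollifier \<delta> (w - z) *\<^sub>R e w) \<in> borel_measurable borel"
    by (rule lborel.borel_measurable_lebesgue_integral) measurable
  then show ?thesis by (simp add: mollify_def[abs_def])
qed

lemma nn_integral_mollifier: "\<delta> > 0 \<Longrightarrow> (\<integral>\<^sup>+w. ennreal (mollifier \<delta> w) \<partial>lborel) = 1"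
  by (subst nn_integral_eq_integral) (auto simp: integrable_mollifier integral_mollifier mollifier_nonneg)

lemma norm_mollify_le:
  assumes "\<delta> > 0" "integrable lborel e"
  shows "ennreal (cmod (mollify \<delta> e z)) \<le> (\<integral>\<^sup>+w. ennreal (mollifier \<delta> w) * ennreal (cmod (e (z + w))) \<partial>lborel)"
proof -
  have [measurable]: "e \<in> borel_measurable borel" using assms by simp
  have "ennreal (cmod (mollify \<delta> e z)) \<le> (\<integral>\<^sup>+w. ennreal (cmod (mollifier \<delta> w *\<^sub>R e (z + w))) \<partial>lborel)"
    unfolding mollify_shift[OF \<open>e \<in> borel_measurable borel\<close>]
    by (rule integral_norm_bound_ennreal[OF integrable_mollifier_mult(2)[OF assms]])
  then show ?thesis by (simp add: mollifier_nonneg ennreal_mult)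
qed

lemma nn_integral_mollify_le:
  assumes "\<delta> > 0" "integrable lborel e"
  shows "(\<integral>\<^sup>+z. ennreal (cmod (mollify \<delta> e z)) \<partial>lborel) \<le> (\<integral>\<^sup>+z. ennreal (cmod (e z)) \<partial>lborel)"
proof -
  have [measurable]: "e \<in> borel_measurable borel" using assms by simp
  have "(\<integral>\<^sup>+z. ennreal (cmod (mollify \<delta> e z)) \<partial>lborel)
      \<le> (\<integral>\<^sup>+z. (\<integral>\<^sup>+w. ennreal (mollifier \<delta> w) * ennreal (cmod (e (z + w))) \<partial>lborel) \<partial>lborel)"
    by (intro nn_integral_mono norm_mollify_le assms)
  also have "\<dots> = (\<integral>\<^sup>+w. (\<integral>\<^sup>+z. ennreal (mollifier \<delta> w) * ennreal (cmod (e (z + w))) \<partial>lborel) \<partial>lborel)"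
    by (rule lborel_pair.Fubini') measurable
  also have "\<dots> = (\<integral>\<^sup>+w. ennreal (mollifier \<delta> w) * (\<integral>\<^sup>+z. ennreal (cmod (e z)) \<partial>lborel) \<partial>lborel)"
    by (simp add: nn_integral_cmult nn_integral_lborel_translate[of "\<lambda>z. ennreal (cmod (e z))"])
  also have "\<dots> = (\<integral>\<^sup>+z. ennreal (cmod (e z)) \<partial>lborel)"
    by (simp add: nn_integral_multc nn_integral_mollifier[OF assms(1)])
  finally show ?thesis .
qed

lemma mollify_minus_eq:
  fixes e :: "complex \<Rightarrow> complex"
  assumes \<delta>: "\<delta> > 0" and e: "integrable lborel e"
  shows "mollify \<delta> e z - e z = (LINT w|lborel. mollifier \<delta> w *\<^sub>R (e (z + w) - e z))"
    and "integrable lborel (\<lambda>w. mollifier \<delta> w *\<^sub>R (e (z + w) - e z))"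
proof -
  have i: "integrable lborel (\<lambda>w. mollifier \<delta> w *\<^sub>R e z)" using integrable_mollifier[OF \<delta>] by simp
  have "mollify \<delta> e z - e z = (LINT w|lborel. mollifier \<delta> w *\<^sub>R e (z + w)) - (LINT w|lborel. mollifier \<delta> w *\<^sub>R e z)"
    using assms by (simp add: mollify_shift integral_mollifier integrable_mollifier)
  then show "mollify \<delta> e z - e z = (LINT w|lborel. mollifier \<delta> w *\<^sub>R (e (z + w) - e z))"
    using i integrable_mollifier_mult(2)[OF assms, of z]
    by (simp add: scaleR_diff_right)
  show "integrable lborel (\<lambda>w. mollifier \<delta> w *\<^sub>R (e (z + w) - e z))"
    using i integrable_mollifier_mult(2)[OF assms, of z] by (simp add: scaleR_diff_right)
qed

text \<open>By Fubini, the error is at most the average of the translation errors \<open>\<integral>\<bar>e (z + w) - e z\<bar>\<close> over \<open>\<bar>w\<bar> < \<delta>\<close>.\<close>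

lemma L1_mollify_tendsto:
  fixes e :: "complex \<Rightarrow> complex"
  assumes e: "integrable lborel e" and eta: "\<eta> > 0"
  obtains d where "d > 0" "\<And>\<delta>. 0 < \<delta> \<Longrightarrow> \<delta> \<le> d \<Longrightarrow>
     (\<integral>\<^sup>+z. ennreal (cmod (mollify \<delta> e z - e z)) \<partial>lborel) \<le> ennreal \<eta>"
proof -
  have [measurable]: "e \<in> borel_measurable borel" using e by simp
  obtain d where d: "d > 0" "\<And>w. cmod w < d \<Longrightarrow> (LINT z|lborel. cmod (e (z + w) - e z)) < \<eta>"
    using L1_translation_continuous[OF e eta] by blast
  show ?thesis
  proof (rule that[OF d(1)])
    fix \<delta> assume dd: "0 < \<delta>" "\<delta> \<le> d"
    have pt: "ennreal (cmod (mollify \<delta> e z - e z)) \<le> (\<integral>\<^sup>+w. ennreal (mollifier \<delta> w) * ennreal (cmod (e (z + w) - e z)) \<partial>lborel)" for z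
      unfolding mollify_minus_eq(1)[OF dd(1) e]
      using integral_norm_bound_ennreal[OF mollify_minus_eq(2)[OF dd(1) e, of z]]
      by (simp add: mollifier_nonneg ennreal_mult)
    have "(\<integral>\<^sup>+z. ennreal (cmod (mollify \<delta> e z - e z)) \<partial>lborel) \<le>
       (\<integral>\<^sup>+z. (\<integral>\<^sup>+w. ennreal (mollifier \<delta> w) * ennreal (cmod (e (z + w) - e z)) \<partial>lborel) \<partial>lborel)"
      by (intro nn_integral_mono pt)
    also have "\<dots> = (\<integral>\<^sup>+w. (\<integral>\<^sup>+z. ennreal (mollifier \<delta> w) * ennreal (cmod (e (z + w) - e z)) \<partial>lborel) \<partial>lborel)"
      by (rule lborel_pair.Fubini') measurable
    also have "\<dots> = (\<integral>\<^sup>+w. ennreal (mollifier \<delta> w) * (\<integral>\<^sup>+z. ennreal (cmod (e (z + w) - e z)) \<partial>lborel) \<partial>lborel)"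
      by (simp add: nn_integral_cmult)
    also have "\<dots> \<le> (\<integral>\<^sup>+w. ennreal (mollifier \<delta> w) * ennreal \<eta> \<partial>lborel)"
    proof (rule nn_integral_mono)
      fix w
      show "ennreal (mollifier \<delta> w) * (\<integral>\<^sup>+z. ennreal (cmod (e (z + w) - e z)) \<partial>lborel) \<le> ennreal (mollifier \<delta> w) * ennreal \<eta>"
      proof (cases "cmod w < \<delta>")
        case True
        have "(\<integral>\<^sup>+z. ennreal (cmod (e (z + w) - e z)) \<partial>lborel) = ennreal (LINT z|lborel. cmod (e (z + w) - e z))"
          using e integrable_lborel_translate(1)[OF e] by (intro nn_integral_eq_integral) auto
        also have "\<dots> \<le> ennreal \<eta>" using d(2)[of w] True dd by (intro ennreal_leI) auto
        finally show ?thesis by (intro mult_left_mono) auto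
      next
        case False then show ?thesis using mollifier_outside[OF dd(1), of w] by simp
      qed
    qed
    also have "\<dots> = ennreal \<eta>"
      by (simp add: nn_integral_multc nn_integral_mollifier[OF dd(1)])
    finally show "(\<integral>\<^sup>+z. ennreal (cmod (mollify \<delta> e z - e z)) \<partial>lborel) \<le> ennreal \<eta>" .
  qed
qed

section \<open>Quadratic support of uniformly convex functions\<close>

lemma strictly_convex_on_imp_convex_on:
  assumes "strictly_convex_on S \<phi>" shows "convex_on S \<phi>"
proof (rule convex_onI)
  show "convex S" using assms by (simp add: strictly_convex_on_def)
  fix t :: real and x y assume *: "0 < t" "t < 1" "x \<in> S" "y \<in> S"
  show "\<phi> ((1 - t) *\<^sub>R x + t *\<^sub>R y) \<le> (1 - t) * \<phi> x + t * \<phi> y"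
  proof (cases "x = y")
    case True then show ?thesis by (simp add: algebra_simps)
  next
    case False then show ?thesis using assms * by (auto simp: strictly_convex_on_def intro: less_imp_le)
  qed
qed

lemma convex_above_tangent:
  assumes "convex_on {1..} (\<phi> :: real \<Rightarrow> real)" "x > 1" "y \<ge> 1" "\<phi> differentiable (at x)"
  shows "\<phi> y \<ge> \<phi> x + deriv \<phi> x * (y - x)"
proof -
  have "(\<phi> has_real_derivative deriv \<phi> x) (at x within {1..})"
    using assms(4) by (meson DERIV_deriv_iff_real_differentiable has_field_derivative_at_within)
  moreover have "x \<in> interior {1..}" using assms(2) by (simp add: interior_real_atLeast)
  ultimately show ?thesis
    using convex_on_imp_above_tangent[OF assms(1), of x y "deriv \<phi> x"] assms(3) by (auto simp: algebra_simps)
qed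

lemma strictly_convex_deriv_strict:
  assumes sc: "strictly_convex_on {1..} (\<phi> :: real \<Rightarrow> real)" and x: "1 < x" "x < y"
    and d: "\<phi> differentiable (at x)" "\<phi> differentiable (at y)"
  shows "deriv \<phi> x < deriv \<phi> y"
proof -
  note c = strictly_convex_on_imp_convex_on[OF sc]
  let ?m = "(x + y) / 2"
  have "\<phi> ?m \<ge> \<phi> x + deriv \<phi> x * (?m - x)" "\<phi> ?m \<ge> \<phi> y + deriv \<phi> y * (?m - y)"
    using convex_above_tangent[OF c, of x ?m] convex_above_tangent[OF c, of y ?m] x d by auto
  moreover have "\<phi> ((1 - 1/2) * x + (1/2) * y) < (1 - 1/2) * \<phi> x + (1/2) * \<phi> y"
    using sc x unfolding strictly_convex_on_def by (elim conjE) (drule bspec[of _ _ x], simp, drule bspec[of _ _ y], simp, drule spec[of _ "1/2"], simp)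
  moreover have "(1 - 1/2) * x + (1/2) * y = ?m" by (simp add: field_simps)
  ultimately have "deriv \<phi> x * (?m - x) + deriv \<phi> y * (?m - y) < 0" by (simp add: field_simps)
  then have "(deriv \<phi> x - deriv \<phi> y) * (y - x) < 0" by (simp add: field_simps)
  then show ?thesis using x by (simp add: mult_less_0_iff)
qed

text \<open>Integrating \<open>\<phi>'' > c0\<close> gives the estimate, but the derivative of \<open>\<phi>\<close> need not be absolutely continuous:
it may jump, and it may have a singular part. Both only help, and the one-dimensional change of
variables formula shows this: strict convexity makes the derivative injective, so on the set \<open>E\<close> of
full measure where \<open>\<phi>''\<close> exists the integral of \<open>\<phi>''\<close> is the measure of the image of \<open>E\<close>, a subset of
the interval between the two values of the derivative.\<close>

lemma deriv_increment_ge: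
  fixes \<phi> :: "real \<Rightarrow> real"
  assumes sc: "strictly_convex_on {1..} \<phi>"
    and ae: "AE t in lebesgue_on {1..}. \<exists>d. has_second_deriv \<phi> d t \<and> d > c0"
    and c0: "c0 > 0" and ab: "1 < a" "a \<le> b"
    and d: "\<phi> differentiable (at a)" "\<phi> differentiable (at b)"
  shows "deriv \<phi> b - deriv \<phi> a \<ge> c0 * (b - a)"
proof -
  let ?good = "{t. \<exists>d. has_second_deriv \<phi> d t \<and> d > c0}"
  define N where "N = {a..b} - ?good"
  define E where "E = {a..b} \<inter> ?good"
  have "AE t in lebesgue. t \<in> {1..} \<longrightarrow> t \<in> ?good"
    using ae by (subst (asm) AE_restrict_space_iff) auto
  then have "AE t in lebesgue. t \<notin> N" by eventually_elim (use ab in \<open>auto simp: N_def\<close>)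
  then have N: "negligible N"
    by (simp add: negligible_iff_null_sets AE_not_in eventually_ae_filter)
       (metis (no_types, lifting) Collect_mono_iff completion.complete2 mem_Collect_eq not_not subsetI)
  have EN: "E = {a..b} - N" by (auto simp: E_def N_def)
  have El: "E \<in> sets lebesgue"
    using N unfolding EN by (intro sets.Diff) (auto simp: negligible_imp_sets)
  define g' where "g' t = (SOME d. has_second_deriv \<phi> d t \<and> d > c0)" for t
  have g': "has_second_deriv \<phi> (g' t) t" "g' t > c0" if "t \<in> E" for t
    using that someI_ex[of "\<lambda>d. has_second_deriv \<phi> d t \<and> d > c0"] by (auto simp: E_def g'_def)
  have ED: "E \<subseteq> {s. \<phi> differentiable (at s)}"
    by (auto simp: E_def has_second_deriv_def)
  have der: "(deriv \<phi> has_real_derivative g' t) (at t within E)" if "t \<in> E" for t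
    using g'(1)[OF that] ED unfolding has_second_deriv_def by (blast intro: DERIV_subset)
  have inj: "inj_on (deriv \<phi>) E"
  proof (rule inj_onI)
    fix x y assume "x \<in> E" "y \<in> E" "deriv \<phi> x = deriv \<phi> y"
    moreover from this have "\<phi> differentiable (at x)" "\<phi> differentiable (at y)" "1 < x" "1 < y"
      using ED ab by (auto simp: E_def)
    ultimately show "x = y"
      using strictly_convex_deriv_strict[OF sc, of x y] strictly_convex_deriv_strict[OF sc, of y x]
      by (cases x y rule: linorder_cases) auto
  qed
  have sub: "deriv \<phi> ` E \<subseteq> {deriv \<phi> a..deriv \<phi> b}"
  proof clarsimp
    fix t assume t: "t \<in> E"
    have mono: "deriv \<phi> x \<le> deriv \<phi> y" if "1 < x" "x \<le> y" "\<phi> differentiable (at x)" "\<phi> differentiable (at y)" for x y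
      using strictly_convex_deriv_strict[OF sc, of x y] that by (cases "x = y") auto
    show "deriv \<phi> a \<le> deriv \<phi> t \<and> deriv \<phi> t \<le> deriv \<phi> b"
      using t ED ab d by (auto simp: E_def intro!: mono)
  qed
  have img: "deriv \<phi> ` E \<in> sets lebesgue"
    using der by (intro differentiable_image_in_sets_lebesgue[OF El])
       (auto simp: differentiable_on_def intro: differentiableI has_field_derivative_imp_has_derivative)
  have imgm: "deriv \<phi> ` E \<in> lmeasurable"
    using img sub by (meson bounded_closed_interval bounded_set_imp_lmeasurable bounded_subset)
  then have "(\<lambda>x. 1::real) absolutely_integrable_on (deriv \<phi> ` E)"
    by (simp add: absolutely_integrable_on_const)
  then have ai: "(\<lambda>x. \<bar>g' x\<bar>) absolutely_integrable_on E" and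
    ie: "integral E (\<lambda>x. \<bar>g' x\<bar>) = integral (deriv \<phi> ` E) (\<lambda>_. 1)"
    using has_absolute_integral_change_of_variables_1'[OF El der inj, of "\<lambda>_. 1" "integral (deriv \<phi> ` E) (\<lambda>_. 1)"]
    by auto
  have Em: "E \<in> lmeasurable"
    using El by (rule bounded_set_imp_lmeasurable[rotated]) (auto simp: E_def intro: bounded_subset[of "{a..b}"])
  have "c0 * (b - a) = c0 * measure lebesgue E"
  proof -
    have "measure lebesgue E = measure lebesgue {a..b}"
      using EN N by (simp add: measure_Diff_null_set negligible_iff_null_sets)
    then show ?thesis using ab by simp
  qed
  also have "\<dots> = integral E (\<lambda>x. c0)"
    using Em by (simp add: lmeasure_integral integral_mult_right[symmetric] mult.commute)
  also have "\<dots> \<le> integral E (\<lambda>x. \<bar>g' x\<bar>)"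
  proof (rule integral_le)
    show "c0 \<le> \<bar>g' x\<bar>" if "x \<in> E" for x using g'(2)[OF that] by simp
  qed (use ai Em in \<open>auto simp: absolutely_integrable_on_def integrable_on_const\<close>)
  also have "\<dots> = measure lebesgue (deriv \<phi> ` E)"
    using ie imgm by (simp add: lmeasure_integral)
  also have "\<dots> \<le> measure lebesgue {deriv \<phi> a..deriv \<phi> b}"
    using sub img by (intro measure_mono_fmeasurable) auto
  also have "\<dots> = deriv \<phi> b - deriv \<phi> a"
    using sub ab strictly_convex_deriv_strict[OF sc, of a b] d by (cases "a = b") auto
  finally show ?thesis .
qed

lemma differentiable_points_dense:
  fixes \<phi> :: "real \<Rightarrow> real"
  assumes ae: "AE t in lebesgue_on {1..}. \<exists>d. has_second_deriv \<phi> d t \<and> d > c0"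
    and ab: "1 \<le> a" "a < b"
  shows "\<exists>t. a < t \<and> t < b \<and> \<phi> differentiable (at t)"
proof (rule ccontr)
  assume no: "\<not> ?thesis"
  have "AE t in lebesgue. t \<in> {1..} \<longrightarrow> (\<exists>d. has_second_deriv \<phi> d t \<and> d > c0)"
    using ae by (subst (asm) AE_restrict_space_iff) auto
  then have "AE t in lebesgue. t \<notin> {a<..<b}"
    by eventually_elim (use no ab in \<open>auto simp: has_second_deriv_def\<close>)
  then have "emeasure lebesgue {a<..<b} = 0"
    by (subst (asm) AE_iff_measurable[of "{a<..<b}"]) auto
  then show False using ab by simp
qed

text \<open>Take any subgradient \<open>m\<close> at \<open>s\<close>. Between \<open>s\<close> and \<open>t\<close> there is a point \<open>p\<close> close to \<open>s\<close> and a point \<open>q\<close>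
about halfway where \<open>\<phi>\<close> is differentiable; the slope at \<open>p\<close> is beyond \<open>m\<close>, the slope at \<open>q\<close> beyond it by
a quarter of \<open>c0 * \<bar>t - s\<bar>\<close>, and this gain acts on at least a quarter of the segment. At \<open>s = 1\<close> the
domain ends and \<open>m = 0\<close> is chosen; for \<open>s > 1\<close> the values at \<open>1\<close> and \<open>s\<close> force \<open>m > 0\<close>.\<close>

lemma quadratic_support:
  fixes \<phi> :: "real \<Rightarrow> real"
  assumes rng: "\<phi> \<in> {1..} \<rightarrow> {1..}"
    and sc: "strictly_convex_on {1..} \<phi>" and one: "\<phi> 1 = 1"
    and ae: "AE t in lebesgue_on {1..}. \<exists>d. has_second_deriv \<phi> d t \<and> d > c0"
    and c0: "c0 > 0" and s: "s \<ge> 1"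
  shows "\<exists>m\<ge>0. (s > 1 \<longrightarrow> m > 0) \<and> (\<forall>t\<ge>1. \<phi> t \<ge> \<phi> s + m * (t - s) + c0 / 16 * (t - s)\<^sup>2)"
proof -
  note c = strictly_convex_on_imp_convex_on[OF sc]
  have "\<exists>m. (\<forall>t\<ge>1. \<phi> t \<ge> \<phi> s + m * (t - s)) \<and> (s = 1 \<longrightarrow> m = 0)"
  proof (cases "s = 1")
    case True then show ?thesis using rng one by (intro exI[of _ 0]) auto
  next
    case False
    then have "s \<in> interior {1..}" using s by (simp add: interior_real_atLeast)
    then show ?thesis
      using convex_le_Inf_differential[OF c, of s] False by blast
  qed
  then obtain m where m: "\<And>t. t \<ge> 1 \<Longrightarrow> \<phi> t \<ge> \<phi> s + m * (t - s)" and m0: "s = 1 \<longrightarrow> m = 0"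
    by blast
  have main: "\<phi> t \<ge> \<phi> s + m * (t - s) + c0 / 16 * (t - s)\<^sup>2" if t: "t \<ge> 1" for t
  proof -
    consider "t = s" | "s < t" | "t < s" by linarith
    then show ?thesis
    proof cases
      case 1 then show ?thesis by simp
    next
      case 2
      define h where "h = t - s"
      have h: "h > 0" "t = s + h" using 2 by (auto simp: h_def)
      obtain p where p: "s < p" "p < s + h / 4" "\<phi> differentiable (at p)"
        using differentiable_points_dense[OF ae, of s "s + h/4"] s h by auto
      obtain q where q: "s + h / 2 < q" "q < s + 3 * h / 4" "\<phi> differentiable (at q)"
        using differentiable_points_dense[OF ae, of "s+h/2" "s + 3*h/4"] s h by auto
      have "\<phi> s \<ge> \<phi> p + deriv \<phi> p * (s - p)" "\<phi> p \<ge> \<phi> s + m * (p - s)"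
        using c s p m by (auto intro!: convex_above_tangent)
      then have "(deriv \<phi> p - m) * (p - s) \<ge> 0" by (simp add: algebra_simps)
      then have mp: "m \<le> deriv \<phi> p" using p by (simp add: zero_le_mult_iff)
      have "c0 * (q - p) \<le> deriv \<phi> q - deriv \<phi> p"
        using deriv_increment_ge[OF sc ae c0, of p q] p q s h by auto
      moreover have "c0 * (h / 4) \<le> c0 * (q - p)" using p q c0 by (intro mult_left_mono) auto
      ultimately have mq: "deriv \<phi> q \<ge> m + c0 * (h / 4)" using mp by linarith
      have "\<phi> t \<ge> \<phi> q + deriv \<phi> q * (t - q)"
        using c s q t h by (auto intro!: convex_above_tangent)
      moreover have "\<phi> q \<ge> \<phi> s + m * (q - s)" using m q s h by auto
      moreover have "deriv \<phi> q * (t - q) \<ge> (m + c0 * (h / 4)) * (t - q)"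
        using mq q h by (intro mult_right_mono) auto
      moreover have "c0 * (h / 4) * (t - q) \<ge> c0 * (h / 4) * (h / 4)"
        using c0 q h by (intro mult_left_mono) auto
      moreover have "m * (q - s) + (m + c0 * (h / 4)) * (t - q) = m * (t - s) + c0 * (h / 4) * (t - q)"
        by (simp add: algebra_simps)
      ultimately have "\<phi> t \<ge> \<phi> s + m * (t - s) + c0 * (h / 4) * (h / 4)" by linarith
      then show ?thesis by (simp add: h_def power2_eq_square)
    next
      case 3
      define h where "h = s - t"
      have h: "h > 0" "t = s - h" using 3 by (auto simp: h_def)
      obtain p where p: "s - h / 4 < p" "p < s" "\<phi> differentiable (at p)"
        using differentiable_points_dense[OF ae, of "s - h/4" s] s h t by auto
      obtain q where q: "s - 3 * h / 4 < q" "q < s - h / 2" "\<phi> differentiable (at q)"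
        using differentiable_points_dense[OF ae, of "s - 3*h/4" "s-h/2"] s h t by auto
      have "\<phi> s \<ge> \<phi> p + deriv \<phi> p * (s - p)" "\<phi> p \<ge> \<phi> s + m * (p - s)"
        using c s p m t h by (auto intro!: convex_above_tangent)
      then have "(deriv \<phi> p - m) * (p - s) \<ge> 0" by (simp add: algebra_simps)
      then have mp: "m \<ge> deriv \<phi> p" using p by (simp add: zero_le_mult_iff)
      have "c0 * (p - q) \<le> deriv \<phi> p - deriv \<phi> q"
        using deriv_increment_ge[OF sc ae c0, of q p] p q s h t by auto
      moreover have "c0 * (h / 4) \<le> c0 * (p - q)" using p q c0 by (intro mult_left_mono) auto
      ultimately have mq: "deriv \<phi> q \<le> m - c0 * (h / 4)" using mp by linarith
      have "\<phi> t \<ge> \<phi> q + deriv \<phi> q * (t - q)"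
        using c s q t h by (auto intro!: convex_above_tangent)
      moreover have "\<phi> q \<ge> \<phi> s + m * (q - s)" using m q s h t by auto
      moreover have "deriv \<phi> q * (t - q) \<ge> (m - c0 * (h / 4)) * (t - q)"
        using mq q h by (intro mult_right_mono_neg) auto
      moreover have "c0 * (h / 4) * (q - t) \<ge> c0 * (h / 4) * (h / 4)"
        using c0 q h by (intro mult_left_mono) auto
      moreover have "m * (q - s) + (m - c0 * (h / 4)) * (t - q) = m * (t - s) + c0 * (h / 4) * (q - t)"
        by (simp add: field_simps)
      ultimately have "\<phi> t \<ge> \<phi> s + m * (t - s) + c0 * (h / 4) * (h / 4)" by linarith
      moreover have "c0 * (h / 4) * (h / 4) = c0 / 16 * (t - s)\<^sup>2"
        by (simp add: h_def power2_eq_square field_simps)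
      ultimately show ?thesis by linarith
    qed
  qed
  have "m > 0" if "s > 1"
  proof -
    have "\<phi> 1 \<ge> \<phi> s + m * (1 - s) + c0 / 16 * (1 - s)\<^sup>2" using main by simp
    moreover have "\<phi> s \<ge> 1" using rng s by auto
    moreover have "c0 / 16 * (1 - s)\<^sup>2 > 0" using c0 that by simp
    ultimately have "m * (s - 1) > 0" using one by (simp add: algebra_simps)
    then show ?thesis using that by (simp add: zero_less_mult_iff)
  qed
  then show ?thesis using main m0 s by (intro exI[of _ m]) (auto intro: less_imp_le simp: le_less)
qed

section \<open>Extension by zero across the boundary of a rectangle\<close>

lemma measurable_case_prod_Complex [measurable]:
  "(\<lambda>(x, y). Complex x y) \<in> borel_measurable (lborel \<Otimes>\<^sub>M lborel)"
proof -
  have "(\<lambda>p. complex_of_real (fst p) + \<i> * complex_of_real (snd p)) \<in> borel_measurable (lborel \<Otimes>\<^sub>M lborel)"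
    by measurable
  then show ?thesis by (simp add: case_prod_beta Complex_eq)
qed

lemma lborel_complex_eq_distr:
  "lborel = distr (lborel \<Otimes>\<^sub>M lborel) borel (\<lambda>(x, y). Complex x y)"
proof (rule lborel_eqI)
  fix l u :: complex assume le: "\<And>b. b \<in> Basis \<Longrightarrow> l \<bullet> b \<le> u \<bullet> b"
  have "(\<lambda>(x, y). Complex x y) -` box l u \<inter> space (lborel \<Otimes>\<^sub>M lborel) = {Re l<..<Re u} \<times> {Im l<..<Im u}"
    by (auto simp: box_complex space_pair_measure)
  then have "emeasure (distr (lborel \<Otimes>\<^sub>M lborel) borel (\<lambda>(x, y). Complex x y)) (box l u)
     = ennreal (Re u - Re l) * ennreal (Im u - Im l)"
    using le[of 1] le[of \<i>]
    by (simp add: emeasure_distr lborel.emeasure_pair_measure_Times Basis_complex_def)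
  also have "\<dots> = (\<Prod>b\<in>Basis. (u - l) \<bullet> b)"
    using le[of 1] le[of \<i>] by (simp add: Basis_complex_def ennreal_mult)
  finally show "emeasure (distr (lborel \<Otimes>\<^sub>M lborel) borel (\<lambda>(x, y). Complex x y)) (box l u) = (\<Prod>b\<in>Basis. (u - l) \<bullet> b)" .
qed simp

lemma nn_integral_complex_product:
  assumes [measurable]: "f \<in> borel_measurable borel" "g \<in> borel_measurable borel"
  shows "(\<integral>\<^sup>+z. f (Re z) * g (Im z) \<partial>lborel) = (\<integral>\<^sup>+x. f x \<partial>lborel) * (\<integral>\<^sup>+y. g y \<partial>lborel)"
proof -
  have "(\<integral>\<^sup>+z. f (Re z) * g (Im z) \<partial>lborel) = (\<integral>\<^sup>+p. f (fst p) * g (snd p) \<partial>(lborel \<Otimes>\<^sub>M lborel))"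
    by (subst lborel_complex_eq_distr, subst nn_integral_distr) (auto simp: case_prod_beta)
  also have "\<dots> = (\<integral>\<^sup>+x. (\<integral>\<^sup>+y. f x * g y \<partial>lborel) \<partial>lborel)"
    by (subst lborel.nn_integral_fst[symmetric]) auto
  also have "\<dots> = (\<integral>\<^sup>+x. f x \<partial>lborel) * (\<integral>\<^sup>+y. g y \<partial>lborel)"
    by (simp add: nn_integral_cmult nn_integral_multc)
  finally show ?thesis .
qed

definition inset :: "real \<Rightarrow> complex" where "inset s = Complex s s"

text \<open>The cutoffs vanish within distance \<open>1 / n\<close> of the boundary of the rectangle and tend to \<open>1\<close> inside. Their
gradients are of order \<open>n\<close> but concentrated near the boundary, with mass bounded independently of \<open>n\<close>.\<close>

definition cutoff :: "complex \<Rightarrow> complex \<Rightarrow> nat \<Rightarrow> complex \<Rightarrow> real" where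
  "cutoff a b n = box_bump (real n) (a + inset (1 / real n)) (b - inset (1 / real n))"

text \<open>A bound for the gradient of \<open>cutoff a b n\<close>. Each summand is the derivative of a monotone function with
values between \<open>0\<close> and \<open>1\<close>, which makes its integral along a line at most \<open>1\<close>.\<close>

definition cutoff_slope :: "complex \<Rightarrow> complex \<Rightarrow> nat \<Rightarrow> complex \<Rightarrow> real" where
  "cutoff_slope a b n z =
     real n * flat 2 (real n * (Re z - Re a) - 1) + real n * flat 2 (real n * (Re b - Re z) - 1) +
     (real n * flat 2 (real n * (Im z - Im a) - 1) + real n * flat 2 (real n * (Im b - Im z) - 1))"

lemma cutoff_eq:
  "n > 0 \<Longrightarrow> cutoff a b n z =
     flat 0 (real n * (Re z - Re a) - 1) * flat 0 (real n * (Re b - Re z) - 1) *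
     (flat 0 (real n * (Im z - Im a) - 1) * flat 0 (real n * (Im b - Im z) - 1))"
proof -
  assume n: "n > 0"
  have "real n * (x - (y + 1 / real n)) = real n * (x - y) - 1"
    "real n * (x - 1 / real n - y) = real n * (x - y) - 1" for x y
    using n by (simp_all add: field_simps)
  then show ?thesis by (simp add: cutoff_def box_bump_def inset_def)
qed

lemma flat_generated_cutoff: "flat_generated (cutoff a b n)"
  by (simp add: cutoff_def flat_generated_box_bump)

lemma cutoff_bounds: "0 \<le> cutoff a b n z" "cutoff a b n z \<le> 1"
  by (simp_all add: cutoff_def box_bump_nonneg box_bump_le_1)

lemma cutoff_support:
  assumes "n > 0"
  shows "{z. cutoff a b n z \<noteq> 0} \<subseteq> cbox (a + inset (1 / real n)) (b - inset (1 / real n))"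
    "cbox (a + inset (1 / real n)) (b - inset (1 / real n)) \<subseteq> box a b"
proof -
  show "{z. cutoff a b n z \<noteq> 0} \<subseteq> cbox (a + inset (1 / real n)) (b - inset (1 / real n))"
    using assms box_subset_cbox unfolding cutoff_def by (subst box_bump_support) auto
  define s where "s = 1 / real n"
  have "s > 0" using assms by (simp add: s_def)
  then show "cbox (a + inset (1 / real n)) (b - inset (1 / real n)) \<subseteq> box a b"
    unfolding s_def[symmetric] cbox_complex box_complex by (auto simp: inset_def)
qed

lemma cutoff_slope_nonneg: "cutoff_slope a b n z \<ge> 0"
  unfolding cutoff_slope_def by (intro add_nonneg_nonneg mult_nonneg_nonneg flat_nonneg) auto

lemma cutoff_derivative_le:
  assumes n: "n > 0" and v: "\<bar>Re v\<bar> \<le> 1" "\<bar>Im v\<bar> \<le> 1"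
  shows "\<bar>frechet_derivative (cutoff a b n) (at z) v\<bar> \<le> cutoff_slope a b n z"
proof -
  define N where "N = real n"
  let ?A = "\<lambda>z. flat 0 (N * (Re z - Re a) - 1)" and ?B = "\<lambda>z. flat 0 (N * (Re b - Re z) - 1)"
  let ?C = "\<lambda>z. flat 0 (N * (Im z - Im a) - 1)" and ?D = "\<lambda>z. flat 0 (N * (Im b - Im z) - 1)"
  let ?A' = "flat 2 (N * (Re z - Re a) - 1)" and ?B' = "flat 2 (N * (Re b - Re z) - 1)"
  let ?C' = "flat 2 (N * (Im z - Im a) - 1)" and ?D' = "flat 2 (N * (Im b - Im z) - 1)"
  have fl: "((\<lambda>z. flat 0 (g z)) has_derivative (\<lambda>v. g' v * flat 2 (g z))) (at z)"
    if "(g has_derivative g') (at z)" for g g' and z :: complex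
    using has_derivative_compose[OF that flat_has_derivative[of 0, unfolded has_field_derivative_def]]
    by (simp add: mult.commute numeral_2_eq_2)
  have A: "(?A has_derivative (\<lambda>v. (N * Re v) * ?A')) (at z)"
    by (rule fl) (auto intro!: derivative_eq_intros)
  have B: "(?B has_derivative (\<lambda>v. (- (N * Re v)) * ?B')) (at z)"
    by (rule fl) (auto intro!: derivative_eq_intros)
  have C: "(?C has_derivative (\<lambda>v. (N * Im v) * ?C')) (at z)"
    by (rule fl) (auto intro!: derivative_eq_intros)
  have D: "(?D has_derivative (\<lambda>v. (- (N * Im v)) * ?D')) (at z)"
    by (rule fl) (auto intro!: derivative_eq_intros)
  let ?der = "\<lambda>v. (?A z * ?B z) * (?C z * ((- (N * Im v)) * ?D') + ((N * Im v) * ?C') * ?D z)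
      + (?A z * ((- (N * Re v)) * ?B') + ((N * Re v) * ?A') * ?B z) * (?C z * ?D z)"
  have "((\<lambda>z. ?A z * ?B z * (?C z * ?D z)) has_derivative ?der) (at z)"
    by (intro has_derivative_mult A B C D)
  moreover have "cutoff a b n = (\<lambda>z. ?A z * ?B z * (?C z * ?D z))"
    using n by (auto simp: cutoff_eq N_def)
  ultimately have "(cutoff a b n has_derivative ?der) (at z)" by simp
  from frechet_derivative_at[OF this, symmetric]
  have eq: "frechet_derivative (cutoff a b n) (at z) = ?der" .
  have f: "0 \<le> flat j x" "flat 0 x \<le> 1" for j x by (simp_all add: flat_nonneg flat_0_le_1)
  have N: "N > 0" using n by (simp add: N_def)
  have m: "\<bar>p * (q * r)\<bar> \<le> \<bar>r\<bar>" if "0 \<le> p" "p \<le> 1" "0 \<le> q" "q \<le> 1" for p q r :: real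
  proof -
    have "\<bar>p * (q * r)\<bar> = (p * q) * \<bar>r\<bar>" using that by (simp add: abs_mult)
    also have "\<dots> \<le> 1 * \<bar>r\<bar>" using that by (intro mult_right_mono mult_le_one) auto
    finally show ?thesis by simp
  qed
  have e: "\<bar>N * t * x\<bar> \<le> N * x" if "\<bar>t\<bar> \<le> 1" "x \<ge> 0" for t x
  proof -
    have "\<bar>N * t * x\<bar> = \<bar>t\<bar> * (N * x)" using that N by (simp add: abs_mult)
    also have "\<dots> \<le> 1 * (N * x)" using that N by (intro mult_right_mono) auto
    finally show ?thesis by simp
  qed
  have "?der v = - (?A z * ?B z * (?C z * (N * Im v * ?D'))) + ?A z * ?B z * (?D z * (N * Im v * ?C'))
     - (?C z * ?D z * (?A z * (N * Re v * ?B'))) + ?C z * ?D z * (?B z * (N * Re v * ?A'))"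
    by (simp add: algebra_simps)
  moreover have "\<bar>?A z * ?B z * (?C z * (N * Im v * ?D'))\<bar> \<le> N * ?D'"
    "\<bar>?A z * ?B z * (?D z * (N * Im v * ?C'))\<bar> \<le> N * ?C'"
    "\<bar>?C z * ?D z * (?A z * (N * Re v * ?B'))\<bar> \<le> N * ?B'"
    "\<bar>?C z * ?D z * (?B z * (N * Re v * ?A'))\<bar> \<le> N * ?A'"
    by (rule order_trans[OF m e], auto intro!: mult_le_one f mult_nonneg_nonneg simp: v)+
  ultimately show ?thesis
    unfolding eq cutoff_slope_def N_def[symmetric] by linarith
qed

lemma cutoff_tendsto:
  assumes "z \<in> box a b" shows "(\<lambda>n. cutoff a b n z) \<longlonglongrightarrow> 1"
proof -
  have "(\<lambda>n. flat 0 (real n * c - 1)) \<longlonglongrightarrow> 1" if "c > 0" for c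
  proof -
    have lim: "filterlim (\<lambda>n. real n * c - 1) at_top sequentially"
      using that by real_asymp
    have "((\<lambda>x::real. exp (- (1 / x))) \<longlongrightarrow> 1) at_top" by real_asymp
    from filterlim_compose[OF this lim] have "(\<lambda>n. exp (- (1 / (real n * c - 1)))) \<longlonglongrightarrow> 1" .
    then show ?thesis
      by (rule Lim_transform_eventually)
         (use filterlim_at_top_dense[THEN iffD1, OF lim, rule_format, of 0] in \<open>auto simp: flat_def elim: eventually_mono\<close>)
  qed
  then have "(\<lambda>n. flat 0 (real n * (Re z - Re a) - 1) * flat 0 (real n * (Re b - Re z) - 1) *
     (flat 0 (real n * (Im z - Im a) - 1) * flat 0 (real n * (Im b - Im z) - 1))) \<longlonglongrightarrow> 1 * 1 * (1 * 1)"
    using assms unfolding box_complex by (intro tendsto_mult) auto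
  then have "(\<lambda>n. flat 0 (real n * (Re z - Re a) - 1) * flat 0 (real n * (Re b - Re z) - 1) *
     (flat 0 (real n * (Im z - Im a) - 1) * flat 0 (real n * (Im b - Im z) - 1))) \<longlonglongrightarrow> 1" by simp
  then show ?thesis
    by (rule Lim_transform_eventually)
       (rule eventually_mono[OF eventually_gt_at_top[of 0]], simp add: cutoff_eq)
qed

lemma flat_measurable [measurable]: "flat j \<in> borel_measurable borel"
  by (rule borel_measurable_continuous_onI) (intro continuous_intros)

lemma cutoff_slope_measurable [measurable]: "cutoff_slope a b n \<in> borel_measurable borel"
  unfolding cutoff_slope_def[abs_def] by measurable

lemma nn_integral_slope_le_1:
  assumes "p \<le> q" "\<And>x. (F has_real_derivative f x) (at x)" "\<And>x. f x \<ge> 0" "f \<in> borel_measurable borel"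
    "\<And>x. 0 \<le> F x" "\<And>x. F x \<le> 1"
  shows "(\<integral>\<^sup>+x. ennreal (f x) * indicator {p..q} x \<partial>lborel) \<le> 1"
proof -
  have "(\<integral>\<^sup>+x. ennreal (f x) * indicator {p..q} x \<partial>lborel) = ennreal (F q - F p)"
    using assms by (intro nn_integral_FTC_Icc) (auto intro: has_field_derivative_at_within)
  also have "\<dots> \<le> 1" using assms(5)[of p] assms(6)[of q] by (simp add: ennreal_le_1)
  finally show ?thesis .
qed

lemma nn_integral_cutoff_slope:
  assumes "a \<in> cbox a b"
  shows "(\<integral>\<^sup>+z. ennreal (cutoff_slope a b n z) * indicator (cbox a b) z \<partial>lborel)
    \<le> ennreal (2 * (Re b - Re a) + 2 * (Im b - Im a))"
proof -
  have le: "Re a \<le> Re b" "Im a \<le> Im b" using assms by (auto simp: cbox_complex)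
  have ind: "indicator (cbox a b) z = indicator {Re a..Re b} (Re z) * (indicator {Im a..Im b} (Im z) :: ennreal)" for z
    by (auto simp: indicator_def cbox_complex)
  let ?p = "\<lambda>\<alpha> x. real n * flat 2 (real n * (x - \<alpha>) - 1)"
  let ?q = "\<lambda>\<beta> x. real n * flat 2 (real n * (\<beta> - x) - 1)"
  have p: "(\<integral>\<^sup>+x. ennreal (?p \<alpha> x) * indicator {r..s} x \<partial>lborel) \<le> 1" if "r \<le> s" for \<alpha> r s
  proof (rule nn_integral_slope_le_1[OF that, of "\<lambda>x. flat 0 (real n * (x - \<alpha>) - 1)"])
    show "((\<lambda>x. flat 0 (real n * (x - \<alpha>) - 1)) has_real_derivative ?p \<alpha> x) (at x)" for x
      by (rule DERIV_cong[OF DERIV_chain2[OF flat_has_derivative]])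
         (auto intro!: derivative_eq_intros simp: numeral_2_eq_2)
  qed (auto simp: flat_nonneg flat_0_le_1)
  have q: "(\<integral>\<^sup>+x. ennreal (?q \<alpha> x) * indicator {r..s} x \<partial>lborel) \<le> 1" if "r \<le> s" for \<alpha> r s
  proof (rule nn_integral_slope_le_1[OF that, of "\<lambda>x. 1 - flat 0 (real n * (\<alpha> - x) - 1)"])
    have "((\<lambda>x. flat 0 (real n * (\<alpha> - x) - 1)) has_real_derivative - ?q \<alpha> x) (at x)" for x
      by (rule DERIV_cong[OF DERIV_chain2[OF flat_has_derivative]])
         (auto intro!: derivative_eq_intros simp: numeral_2_eq_2)
    then show "((\<lambda>x. 1 - flat 0 (real n * (\<alpha> - x) - 1)) has_real_derivative ?q \<alpha> x) (at x)" for x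
      by (auto intro!: derivative_eq_intros)
  qed (auto simp: flat_nonneg flat_0_le_1)
  have ds: "ennreal (cutoff_slope a b n z) * indicator (cbox a b) z
     = (ennreal (?p (Re a) (Re z)) * indicator {Re a..Re b} (Re z)) * indicator {Im a..Im b} (Im z)
     + (ennreal (?q (Re b) (Re z)) * indicator {Re a..Re b} (Re z)) * indicator {Im a..Im b} (Im z)
     + (indicator {Re a..Re b} (Re z) * (ennreal (?p (Im a) (Im z)) * indicator {Im a..Im b} (Im z))
     + indicator {Re a..Re b} (Re z) * (ennreal (?q (Im b) (Im z)) * indicator {Im a..Im b} (Im z)))" for z
    unfolding ind cutoff_slope_def by (simp add: flat_nonneg indicator_def)
  have "(\<integral>\<^sup>+z. ennreal (cutoff_slope a b n z) * indicator (cbox a b) z \<partial>lborel)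
     = (\<integral>\<^sup>+x. ennreal (?p (Re a) x) * indicator {Re a..Re b} x \<partial>lborel) * (\<integral>\<^sup>+y. indicator {Im a..Im b} y \<partial>lborel)
     + (\<integral>\<^sup>+x. ennreal (?q (Re b) x) * indicator {Re a..Re b} x \<partial>lborel) * (\<integral>\<^sup>+y. indicator {Im a..Im b} y \<partial>lborel)
     + ((\<integral>\<^sup>+x. indicator {Re a..Re b} x \<partial>lborel) * (\<integral>\<^sup>+y. ennreal (?p (Im a) y) * indicator {Im a..Im b} y \<partial>lborel)
     + (\<integral>\<^sup>+x. indicator {Re a..Re b} x \<partial>lborel) * (\<integral>\<^sup>+y. ennreal (?q (Im b) y) * indicator {Im a..Im b} y \<partial>lborel))"
    unfolding ds
    using nn_integral_complex_product[of "\<lambda>x. ennreal (?p (Re a) x) * indicator {Re a..Re b} x" "indicator {Im a..Im b}"]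
      nn_integral_complex_product[of "\<lambda>x. ennreal (?q (Re b) x) * indicator {Re a..Re b} x" "indicator {Im a..Im b}"]
      nn_integral_complex_product[of "indicator {Re a..Re b}" "\<lambda>x. ennreal (?p (Im a) x) * indicator {Im a..Im b} x"]
      nn_integral_complex_product[of "indicator {Re a..Re b}" "\<lambda>x. ennreal (?q (Im b) x) * indicator {Im a..Im b} x"]
    by (simp add: nn_integral_add)
  also have "\<dots> \<le> 1 * ennreal (Im b - Im a) + 1 * ennreal (Im b - Im a) + (ennreal (Re b - Re a) * 1 + ennreal (Re b - Re a) * 1)"
    using le by (intro add_mono mult_mono p q) auto
  also have "\<dots> = ennreal (2 * (Re b - Re a) + 2 * (Im b - Im a))"
    using le by (simp add: ennreal_plus[symmetric] del: ennreal_plus)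
  finally show ?thesis .
qed

lemma cutoff_slope_small:
  assumes d: "d > 0" and eta: "\<eta> > 0"
  shows "\<forall>\<^sub>F n in sequentially. \<forall>z \<in> cbox (a + inset d) (b - inset d). cutoff_slope a b n z \<le> \<eta>"
proof -
  have "(\<lambda>n. 4 * (real n / (real n * d - 1)^2)) \<longlonglongrightarrow> 0" using d by real_asymp
  then have "\<forall>\<^sub>F n in sequentially. 4 * (real n / (real n * d - 1)^2) < \<eta>"
    using eta by (rule order_tendstoD)
  moreover have "\<forall>\<^sub>F n in sequentially. real n * d - 1 > 0" using d by real_asymp
  ultimately show ?thesis
  proof eventually_elim
    case (elim n)
    have fl: "real n * flat 2 x \<le> real n / (real n * d - 1)^2" if "x \<ge> real n * d - 1" for x
    proof -
      have "flat 2 x \<le> 1 / x^2" using that elim by (simp add: flat_def divide_right_mono)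
      also have "\<dots> \<le> 1 / (real n * d - 1)^2" using that elim by (intro divide_left_mono power_mono) auto
      finally have "real n * flat 2 x \<le> real n * (1 / (real n * d - 1)^2)" by (intro mult_left_mono) auto
      then show ?thesis by simp
    qed
    have "real n * d \<le> real n * t" if "t \<ge> d" for t using that by (intro mult_left_mono) auto
    then have "cutoff_slope a b n z \<le> 4 * (real n / (real n * d - 1)^2)" if "z \<in> cbox (a + inset d) (b - inset d)" for z
      using that fl[of "real n * (Re z - Re a) - 1"] fl[of "real n * (Re b - Re z) - 1"]
        fl[of "real n * (Im z - Im a) - 1"] fl[of "real n * (Im b - Im z) - 1"]
      unfolding cutoff_slope_def by (auto simp: cbox_complex inset_def)
    then show ?case using elim by fastforce
  qed
qed

lemma integrable_lebesgue_iff: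
  fixes f :: "complex \<Rightarrow> 'b::{banach, second_countable_topology}"
  assumes "f \<in> borel_measurable borel"
  shows "integrable lebesgue f \<longleftrightarrow> integrable lborel f" "(LINT z|lebesgue. f z) = (LINT z|lborel. f z)"
  by (rule integrable_completion, use assms in simp) (rule integral_completion, use assms in simp)

lemma lborel_measurable_representative:
  fixes e :: "complex \<Rightarrow> complex"
  assumes e: "e \<in> borel_measurable lebesgue"
  obtains e' where "e' \<in> borel_measurable borel" "AE z in lborel. e z = e' z"
proof -
  have "(\<lambda>z. Re (e z)) \<in> borel_measurable lebesgue" "(\<lambda>z. Im (e z)) \<in> borel_measurable lebesgue"
    using e by auto
  then obtain r i where [measurable]: "r \<in> borel_measurable lborel" "i \<in> borel_measurable lborel"
    and ae: "AE z in lborel. Re (e z) = r z" "AE z in lborel. Im (e z) = i z"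
    using completion_ex_borel_measurable_real by metis
  define e' where "e' z = complex_of_real (r z) + \<i> * complex_of_real (i z)" for z
  have m: "e' \<in> borel_measurable borel" unfolding e'_def by measurable
  have "AE z in lborel. e z = e' z"
    using ae by eventually_elim (simp add: e'_def complex_eq_iff)
  then show ?thesis using that m by blast
qed

lemma integrable_lborel_representative:
  fixes e :: "complex \<Rightarrow> complex"
  assumes e: "integrable lebesgue e"
  obtains e' where "integrable lborel e'" "AE z in lebesgue. e z = e' z"
proof -
  obtain e' where m: "e' \<in> borel_measurable borel" and ae: "AE z in lborel. e z = e' z"
    using lborel_measurable_representative[of e] e by auto
  have ae': "AE z in lebesgue. e z = e' z" using ae by (rule AE_completion)
  have "e' \<in> borel_measurable lebesgue" using m by (simp add: measurable_completion)
  with e ae' have "integrable lebesgue e'"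
    by (blast intro: integrable_cong_AE[THEN iffD1] borel_measurable_integrable)
  then have "integrable lborel e'" using integrable_lebesgue_iff(1)[OF m] by blast
  then show ?thesis using ae' by (rule that)
qed

lemma compact_subset_inset_box:
  assumes "compact S" "S \<subseteq> box a b"
  obtains d where "d > 0" "S \<subseteq> cbox (a + inset d) (b - inset d)"
proof (cases "S = {}")
  case True then show ?thesis using that[of 1] by simp
next
  case False
  let ?f = "\<lambda>z. min (min (Re z - Re a) (Re b - Re z)) (min (Im z - Im a) (Im b - Im z))"
  have "continuous_on S ?f" by (intro continuous_intros)
  then obtain z0 where z0: "z0 \<in> S" "\<And>z. z \<in> S \<Longrightarrow> ?f z0 \<le> ?f z"
    using continuous_attains_inf[OF assms(1) False, of ?f] by auto
  have "?f z0 > 0" using z0(1) assms(2) by (auto simp: box_complex)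
  moreover have "S \<subseteq> cbox (a + inset (?f z0)) (b - inset (?f z0))"
    using z0(2) by (fastforce simp: cbox_complex inset_def)
  ultimately show ?thesis by (rule that)
qed

text \<open>Test the weak derivative with \<open>h\<close> times a cutoff and let the cutoff tend to \<open>1\<close>. The term with the
derivative of the cutoff tends to zero: away from the boundary the slope of the cutoff is uniformly
small, and near the boundary \<open>G\<close> is small, by continuity, while the mass of the slope stays bounded.\<close>

lemma zero_extension_weak_derivative:
  fixes G g :: "complex \<Rightarrow> complex"
  assumes wd: "is_weak_deriv (box a b) v G g" and v: "\<bar>Re v\<bar> \<le> 1" "\<bar>Im v\<bar> \<le> 1"
    and cont: "continuous_on UNIV G" and G0: "\<And>z. z \<notin> box a b \<Longrightarrow> G z = 0"
    and gi: "set_integrable lebesgue (box a b) g" and h: "flat_generated h" and ne: "a \<in> cbox a b"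
  shows "(LINT z|lborel. frechet_derivative h (at z) v *\<^sub>R G z) = - (LINT z:box a b|lebesgue. h z *\<^sub>R g z)"
proof -
  let ?\<Omega> = "box a b"
  let ?c = "cutoff a b"
  let ?dh = "\<lambda>z. frechet_derivative h (at z) v"
  let ?dc = "\<lambda>n z. frechet_derivative (?c n) (at z) v"
  have G0': "G z = 0" if "z \<notin> cbox a b" for z using G0 box_subset_cbox that by blast
  have ch: "continuous_on UNIV h" "continuous_on UNIV ?dh"
    using h flat_generated_partial[OF h] by (auto intro: flat_generated_continuous)
  have cc: "continuous_on UNIV (?c n)" "continuous_on UNIV (?dc n)" for n
    using flat_generated_cutoff flat_generated_partial[OF flat_generated_cutoff]
    by (auto intro: flat_generated_continuous)
  note [measurable] = borel_measurable_continuous_onI[OF ch(1)] borel_measurable_continuous_onI[OF ch(2)]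
    borel_measurable_continuous_onI[OF cc(1)] borel_measurable_continuous_onI[OF cc(2)] borel_measurable_continuous_onI[OF cont]
  have int: "integrable lborel (\<lambda>z. q z *\<^sub>R G z)" if "continuous_on UNIV q" for q :: "complex \<Rightarrow> real"
    by (rule integrable_continuous_support[of _ "cbox a b"])
       (use that cont G0' in \<open>auto intro!: continuous_intros\<close>)
  obtain M where M: "M > 0" "\<And>z. z \<in> cbox a b \<Longrightarrow> \<bar>h z\<bar> \<le> M"
  proof -
    have "bounded (h ` cbox a b)"
      using ch(1) by (intro compact_imp_bounded compact_continuous_image) (auto intro: continuous_on_subset)
    then obtain M where "\<And>z. z \<in> cbox a b \<Longrightarrow> \<bar>h z\<bar> \<le> M" by (auto simp: bounded_iff)
    then show ?thesis using that[of "max M 1"] by fastforce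
  qed
  obtain B where B: "B > 0" "\<And>z. cmod (G z) \<le> B"
  proof -
    have "bounded (G ` cbox a b)"
      using cont by (intro compact_imp_bounded compact_continuous_image) (auto intro: continuous_on_subset)
    then obtain B where "\<And>z. z \<in> cbox a b \<Longrightarrow> cmod (G z) \<le> B" by (auto simp: bounded_iff)
    then show ?thesis using that[of "max B 1"] G0' by (metis less_max_iff_disj max.coboundedI1 norm_zero zero_less_one less_imp_le)
  qed
  have dT: "frechet_derivative (\<lambda>z. h z * ?c n z) (at z) v = h z * ?dc n z + ?dh z * ?c n z" for n z
  proof -
    have "((\<lambda>z. h z * ?c n z) has_derivative (\<lambda>v. h z * frechet_derivative (?c n) (at z) v + frechet_derivative h (at z) v * ?c n z)) (at z)"
      by (intro has_derivative_mult flat_generated_has_derivative h flat_generated_cutoff)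
    from fun_cong[OF frechet_derivative_at[OF this, symmetric], of v] show ?thesis .
  qed
  have ident: "(LINT z|lborel. (h z * ?dc n z) *\<^sub>R G z) + (LINT z|lborel. (?dh z * ?c n z) *\<^sub>R G z)
     = - (LINT z:?\<Omega>|lebesgue. (h z * ?c n z) *\<^sub>R g z)" if n: "n > 0" for n
  proof -
    have "(\<lambda>z. h z * ?c n z) \<in> test_functions ?\<Omega>"
    proof (rule flat_generated_test_function)
      show "{z. h z * ?c n z \<noteq> 0} \<subseteq> cbox (a + inset (1 / real n)) (b - inset (1 / real n))"
        using cutoff_support(1)[OF n, of a b] by auto
    qed (use cutoff_support(2)[OF n, of a b] h in \<open>auto intro: flat_generated.mult flat_generated_cutoff\<close>)
    then have "(LINT z:?\<Omega>|lebesgue. frechet_derivative (\<lambda>z. h z * ?c n z) (at z) v *\<^sub>R G z)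
       = - (LINT z:?\<Omega>|lebesgue. (h z * ?c n z) *\<^sub>R g z)"
      using wd unfolding is_weak_deriv_def by blast
    also have "(LINT z:?\<Omega>|lebesgue. frechet_derivative (\<lambda>z. h z * ?c n z) (at z) v *\<^sub>R G z)
        = (LINT z|lebesgue. (h z * ?dc n z + ?dh z * ?c n z) *\<^sub>R G z)"
      unfolding set_lebesgue_integral_def dT
      by (intro Bochner_Integration.integral_cong) (use G0 in \<open>auto simp: indicator_def\<close>)
    also have "\<dots> = (LINT z|lborel. (h z * ?dc n z + ?dh z * ?c n z) *\<^sub>R G z)"
      by (rule integrable_lebesgue_iff) measurable
    also have "\<dots> = (LINT z|lborel. (h z * ?dc n z) *\<^sub>R G z + (?dh z * ?c n z) *\<^sub>R G z)"
      by (simp add: scaleR_add_left)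
    also have "\<dots> = (LINT z|lborel. (h z * ?dc n z) *\<^sub>R G z) + (LINT z|lborel. (?dh z * ?c n z) *\<^sub>R G z)"
      using ch cc by (intro Bochner_Integration.integral_add int continuous_intros)
    finally show ?thesis .
  qed
  have lim1: "(\<lambda>n. LINT z|lborel. (?dh z * ?c n z) *\<^sub>R G z) \<longlonglongrightarrow> (LINT z|lborel. ?dh z *\<^sub>R G z)"
  proof (rule integral_dominated_convergence[where w = "\<lambda>z. norm (?dh z *\<^sub>R G z)"])
    show "AE z in lborel. (\<lambda>n. (?dh z * ?c n z) *\<^sub>R G z) \<longlonglongrightarrow> ?dh z *\<^sub>R G z"
    proof (rule AE_I2)
      fix z
      show "(\<lambda>n. (?dh z * ?c n z) *\<^sub>R G z) \<longlonglongrightarrow> ?dh z *\<^sub>R G z"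
      proof (cases "z \<in> ?\<Omega>")
        case True
        then have "(\<lambda>n. (?dh z * ?c n z) *\<^sub>R G z) \<longlonglongrightarrow> (?dh z * 1) *\<^sub>R G z"
          by (intro tendsto_intros cutoff_tendsto)
        then show ?thesis by simp
      qed (simp add: G0)
    qed
    show "AE z in lborel. norm ((?dh z * ?c n z) *\<^sub>R G z) \<le> norm (?dh z *\<^sub>R G z)" for n
      using cutoff_bounds[of a b n]
      by (auto intro!: AE_I2 mult_right_mono mult_left_le simp: abs_mult)
    show "integrable lborel (\<lambda>z. norm (?dh z *\<^sub>R G z))" by (rule integrable_norm[OF int[OF ch(2)]])
  qed measurable
  have lim3: "(\<lambda>n. LINT z:?\<Omega>|lebesgue. (h z * ?c n z) *\<^sub>R g z) \<longlonglongrightarrow> (LINT z:?\<Omega>|lebesgue. h z *\<^sub>R g z)"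
    unfolding set_lebesgue_integral_def
  proof (rule integral_dominated_convergence[where w = "\<lambda>z. M * norm (indicator ?\<Omega> z *\<^sub>R g z)"])
    have gm: "(\<lambda>z. indicator ?\<Omega> z *\<^sub>R g z) \<in> borel_measurable lebesgue"
      using gi unfolding set_integrable_def by auto
    have hm: "q \<in> borel_measurable lebesgue" if "q \<in> borel_measurable borel" for q :: "complex \<Rightarrow> real"
      using that by (simp add: measurable_completion)
    have "(\<lambda>z. h z *\<^sub>R (indicator ?\<Omega> z *\<^sub>R g z)) \<in> borel_measurable lebesgue"
      by (intro borel_measurable_scaleR gm hm) measurable
    then show "(\<lambda>z. indicator ?\<Omega> z *\<^sub>R h z *\<^sub>R g z) \<in> borel_measurable lebesgue"
      by (simp add: mult.commute)
    have "(\<lambda>z. (h z * ?c n z) *\<^sub>R (indicator ?\<Omega> z *\<^sub>R g z)) \<in> borel_measurable lebesgue" for n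
      by (intro borel_measurable_scaleR gm hm) measurable
    then show "(\<lambda>z. indicator ?\<Omega> z *\<^sub>R (h z * ?c n z) *\<^sub>R g z) \<in> borel_measurable lebesgue" for n
      by (simp add: mult_ac)
    show "integrable lebesgue (\<lambda>z. M * norm (indicator ?\<Omega> z *\<^sub>R g z))"
      using gi unfolding set_integrable_def by (intro integrable_mult_right integrable_norm)
    show "AE z in lebesgue. (\<lambda>n. indicator ?\<Omega> z *\<^sub>R (h z * ?c n z) *\<^sub>R g z) \<longlonglongrightarrow> indicator ?\<Omega> z *\<^sub>R h z *\<^sub>R g z"
    proof (rule AE_I2)
      fix z
      show "(\<lambda>n. indicator ?\<Omega> z *\<^sub>R (h z * ?c n z) *\<^sub>R g z) \<longlonglongrightarrow> indicator ?\<Omega> z *\<^sub>R h z *\<^sub>R g z"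
      proof (cases "z \<in> ?\<Omega>")
        case True
        then have "(\<lambda>n. (h z * ?c n z) *\<^sub>R g z) \<longlonglongrightarrow> (h z * 1) *\<^sub>R g z"
          by (intro tendsto_intros cutoff_tendsto)
        then show ?thesis using True by simp
      qed simp
    qed
    show "AE z in lebesgue. norm (indicator ?\<Omega> z *\<^sub>R (h z * ?c n z) *\<^sub>R g z) \<le> M * norm (indicator ?\<Omega> z *\<^sub>R g z)" for n
    proof (rule AE_I2)
      fix z
      show "norm (indicator ?\<Omega> z *\<^sub>R (h z * ?c n z) *\<^sub>R g z) \<le> M * norm (indicator ?\<Omega> z *\<^sub>R g z)"
      proof (cases "z \<in> ?\<Omega>")
        case True
        then have "\<bar>h z\<bar> * ?c n z \<le> M * 1"
          using M cutoff_bounds[of a b n z] box_subset_cbox by (intro mult_mono) auto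
        then show ?thesis using True cutoff_bounds(1)[of a b n z]
          by (auto simp: abs_mult mult.assoc[symmetric] intro!: mult_right_mono)
      qed simp
    qed
  qed
  \<comment> \<open>This is the boundary term.\<close>
  have lim2: "(\<lambda>n. LINT z|lborel. (h z * ?dc n z) *\<^sub>R G z) \<longlonglongrightarrow> 0"
  proof (rule tendstoI)
    fix \<eta> :: real assume eta: "\<eta> > 0"
    define C where "C = 2 * (Re b - Re a) + 2 * (Im b - Im a)"
    define A where "A = measure lborel (cbox a b)"
    have CA: "C \<ge> 0" "A \<ge> 0" using ne by (auto simp: C_def A_def cbox_complex)
    \<comment> \<open>The bound \<open>\<eta>1\<close> is for \<open>G\<close> near the boundary, \<open>\<eta>2\<close> for the slope of the cutoff away from it.\<close>
    define \<eta>1 where "\<eta>1 = \<eta> / (4 * M * (C + 1))"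
    define \<eta>2 where "\<eta>2 = \<eta> / (4 * M * B * (A + 1))"
    have e12: "\<eta>1 > 0" "\<eta>2 > 0" using eta CA M B by (auto simp: \<eta>1_def \<eta>2_def)
    let ?S = "{z \<in> cbox a b. \<eta>1 \<le> cmod (G z)}"
    have "closed {z. \<eta>1 \<le> cmod (G z)}"
      using cont by (intro closed_Collect_le continuous_intros)
    moreover have "?S = cbox a b \<inter> {z. \<eta>1 \<le> cmod (G z)}" by auto
    ultimately have "compact ?S" by (metis compact_cbox compact_Int_closed)
    moreover have "?S \<subseteq> ?\<Omega>" using G0 e12 by fastforce
    ultimately obtain d where d: "d > 0" "?S \<subseteq> cbox (a + inset d) (b - inset d)"
      by (rule compact_subset_inset_box)
    show "\<forall>\<^sub>F n in sequentially. dist (LINT z|lborel. (h z * ?dc n z) *\<^sub>R G z) 0 < \<eta>"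
      using cutoff_slope_small[OF d(1) e12(2), of a b] eventually_gt_at_top[of 0]
    proof eventually_elim
      case (elim n)
      have pt: "ennreal (norm ((h z * ?dc n z) *\<^sub>R G z)) \<le>
         ennreal (M * \<eta>1) * (ennreal (cutoff_slope a b n z) * indicator (cbox a b) z)
         + ennreal (M * B * \<eta>2) * indicator (cbox a b) z" for z
      proof (cases "z \<in> cbox a b")
        case True
        have "norm ((h z * ?dc n z) *\<^sub>R G z) \<le> M * cutoff_slope a b n z * cmod (G z)"
          using M(2)[OF True] cutoff_derivative_le[OF elim(2) v, of a b z] cutoff_slope_nonneg[of a b n z] M(1)
          by (auto simp: abs_mult intro!: mult_right_mono mult_mono)
        also have "\<dots> \<le> M * \<eta>1 * cutoff_slope a b n z + M * B * \<eta>2"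
        proof (cases "z \<in> cbox (a + inset d) (b - inset d)")
          case True
          then have "M * cutoff_slope a b n z * cmod (G z) \<le> M * \<eta>2 * B"
            using elim(1) B M(1) e12 cutoff_slope_nonneg[of a b n z] by (intro mult_mono) auto
          moreover have "0 \<le> M * \<eta>1 * cutoff_slope a b n z"
            using M e12 cutoff_slope_nonneg[of a b n z] by simp
          ultimately show ?thesis by (simp add: mult_ac)
        next
          case False
          then have "cmod (G z) \<le> \<eta>1" using d(2) True by fastforce
          then have "M * cutoff_slope a b n z * cmod (G z) \<le> M * cutoff_slope a b n z * \<eta>1"
            using M cutoff_slope_nonneg[of a b n z] by (intro mult_left_mono) auto
          moreover have "0 \<le> M * B * \<eta>2" using M B e12 by simp
          ultimately show ?thesis by (simp add: mult_ac)
        qed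
        finally show ?thesis
          using True M B e12 cutoff_slope_nonneg[of a b n z]
          by (simp add: ennreal_mult[symmetric] ennreal_plus[symmetric] ennreal_leI del: ennreal_plus)
      qed (simp add: G0')
      have "ennreal (norm (LINT z|lborel. (h z * ?dc n z) *\<^sub>R G z)) \<le> (\<integral>\<^sup>+z. ennreal (norm ((h z * ?dc n z) *\<^sub>R G z)) \<partial>lborel)"
        using ch cc by (intro integral_norm_bound_ennreal int continuous_intros)
      also have "\<dots> \<le> (\<integral>\<^sup>+z. ennreal (M * \<eta>1) * (ennreal (cutoff_slope a b n z) * indicator (cbox a b) z)
         + ennreal (M * B * \<eta>2) * indicator (cbox a b) z \<partial>lborel)"
        by (intro nn_integral_mono pt)
      also have "\<dots> = ennreal (M * \<eta>1) * (\<integral>\<^sup>+z. ennreal (cutoff_slope a b n z) * indicator (cbox a b) z \<partial>lborel)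
          + ennreal (M * B * \<eta>2) * emeasure lborel (cbox a b)"
        by (subst nn_integral_add) (auto simp: nn_integral_cmult)
      also have "\<dots> \<le> ennreal (M * \<eta>1) * ennreal C + ennreal (M * B * \<eta>2) * ennreal A"
        unfolding C_def A_def using nn_integral_cutoff_slope[OF ne]
        by (intro add_mono mult_left_mono) (auto simp: emeasure_lborel_cbox_eq intro: emeasure_eq_ennreal_measure[THEN eq_refl])
      also have "\<dots> = ennreal (M * \<eta>1 * C + M * B * \<eta>2 * A)"
        using M B e12 CA by (simp add: ennreal_mult[symmetric] ennreal_plus[symmetric] del: ennreal_plus)
      finally have "norm (LINT z|lborel. (h z * ?dc n z) *\<^sub>R G z) \<le> M * \<eta>1 * C + M * B * \<eta>2 * A"
        by (rule ennreal_le_iff[THEN iffD1, rotated]) (use M B e12 CA in auto)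
      moreover have "M * \<eta>1 * C \<le> \<eta> / 4"
      proof -
        have "M * \<eta>1 * C = (\<eta> / 4) * (C / (C + 1))" using M CA by (simp add: \<eta>1_def)
        also have "\<dots> \<le> (\<eta> / 4) * 1" using CA eta by (intro mult_left_mono) auto
        finally show ?thesis by simp
      qed
      moreover have "M * B * \<eta>2 * A \<le> \<eta> / 4"
      proof -
        have "M * B * \<eta>2 * A = (\<eta> / 4) * (A / (A + 1))" using M B CA by (simp add: \<eta>2_def)
        also have "\<dots> \<le> (\<eta> / 4) * 1" using CA eta by (intro mult_left_mono) auto
        finally show ?thesis by simp
      qed
      ultimately show ?case using eta by simp
    qed
  qed
  have "(\<lambda>n. - (LINT z:?\<Omega>|lebesgue. (h z * ?c n z) *\<^sub>R g z)) \<longlonglongrightarrow> 0 + (LINT z|lborel. ?dh z *\<^sub>R G z)"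
    by (rule Lim_transform_eventually[OF tendsto_add[OF lim2 lim1]])
       (rule eventually_mono[OF eventually_gt_at_top[of 0]], rule ident)
  moreover have "(\<lambda>n. - (LINT z:?\<Omega>|lebesgue. (h z * ?c n z) *\<^sub>R g z)) \<longlonglongrightarrow> - (LINT z:?\<Omega>|lebesgue. h z *\<^sub>R g z)"
    by (intro tendsto_intros lim3)
  ultimately show ?thesis using LIMSEQ_unique by fastforce
qed

section \<open>Weak derivatives: uniqueness and calculus\<close>

lemma integrable_mult_bounded_continuous:
  fixes q :: "complex \<Rightarrow> real" and e :: "complex \<Rightarrow> complex"
  assumes e: "integrable lebesgue e" and q: "continuous_on UNIV q" and B: "\<And>z. \<bar>q z\<bar> \<le> B"
  shows "integrable lebesgue (\<lambda>z. q z *\<^sub>R e z)"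
proof (rule Bochner_Integration.integrable_bound[of _ "\<lambda>z. B *\<^sub>R e z"])
  have "q \<in> borel_measurable lebesgue"
    using borel_measurable_continuous_onI[OF q] by (simp add: measurable_completion)
  then show "(\<lambda>z. q z *\<^sub>R e z) \<in> borel_measurable lebesgue" using e by auto
  have "B \<ge> 0" using B[of undefined] by (meson abs_ge_zero order_trans)
  then show "AE z in lebesgue. norm (q z *\<^sub>R e z) \<le> norm (B *\<^sub>R e z)"
    using B by (auto intro!: AE_I2 mult_right_mono)
qed (use e in auto)

lemma abs_mollifier_bounded: "\<delta> > 0 \<Longrightarrow> \<exists>B. \<forall>z. \<bar>mollifier \<delta> z\<bar> \<le> B"
  using bounded_mollifier[of \<delta>] mollifier_nonneg[of \<delta>] by auto

text \<open>Translates of the mollifier are test functions, so all mollifications of the difference at small scale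
vanish in an inner rectangle, and they converge to the difference in the mean.\<close>

lemma weak_deriv_unique_inner:
  assumes g: "is_weak_deriv (box a b) v f g1" "is_weak_deriv (box a b) v f g2" and s: "s > 0"
  shows "AE z in lebesgue. z \<in> cbox (a + inset (2 * s)) (b - inset (2 * s)) \<longrightarrow> g1 z = g2 z"
proof -
  let ?\<Omega> = "box a b"
  define B' where "B' = cbox (a + inset s) (b - inset s)"
  define B where "B = cbox (a + inset (2 * s)) (b - inset (2 * s))"
  have B': "compact B'" "B' \<subseteq> ?\<Omega>"
  proof -
    show "compact B'" by (simp add: B'_def)
    show "B' \<subseteq> ?\<Omega>" unfolding B'_def cbox_complex box_complex using s by (auto simp: inset_def)
  qed
  define e1 where "e1 z = indicator B' z *\<^sub>R g1 z" for z
  define e2 where "e2 z = indicator B' z *\<^sub>R g2 z" for z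
  have i: "integrable lebesgue e1" "integrable lebesgue e2"
    using g B' unfolding is_weak_deriv_def locally_integrable_def set_integrable_def e1_def e2_def by auto
  then have "integrable lebesgue (\<lambda>z. e1 z - e2 z)" by auto
  then obtain e where e: "integrable lborel e" and ae: "AE z in lebesgue. e1 z - e2 z = e z"
    by (rule integrable_lborel_representative)
  have [measurable]: "e \<in> borel_measurable borel" using e by auto
  have m0: "mollify \<delta> e z = 0" if z: "z \<in> B" and \<delta>: "0 < \<delta>" "\<delta> < s" for z \<delta>
  proof -
    define h where "h w = mollifier \<delta> (w - z)" for w
    have hg: "flat_generated h"
      unfolding h_def by (rule flat_generated_translate) (rule flat_generated_mollifier)
    have ch: "continuous_on UNIV h" using hg by (rule flat_generated_continuous)
    obtain M where M: "\<And>w. \<bar>h w\<bar> \<le> M" using abs_mollifier_bounded[OF \<delta>(1)] by (auto simp: h_def)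
    have supp: "h w = 0" if "w \<notin> B'" for w
    proof -
      have "\<bar>Re (w - z)\<bar> \<ge> \<delta> \<or> \<bar>Im (w - z)\<bar> \<ge> \<delta>"
        using that z \<delta> by (auto simp: B_def B'_def cbox_complex inset_def)
      then have "cmod (w - z) \<ge> \<delta>" using abs_Re_le_cmod[of "w - z"] abs_Im_le_cmod[of "w - z"] by linarith
      then show ?thesis using \<delta> by (simp add: h_def mollifier_outside)
    qed
    then have "{w. h w \<noteq> 0} \<subseteq> B'" by auto
    then have "h \<in> test_functions ?\<Omega>" using flat_generated_test_function[OF hg _ B'] by blast
    then have eq: "(LINT w:?\<Omega>|lebesgue. h w *\<^sub>R g1 w) = (LINT w:?\<Omega>|lebesgue. h w *\<^sub>R g2 w)"
      using g unfolding is_weak_deriv_def by (metis neg_equal_iff_equal)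
    have conv: "(LINT w:?\<Omega>|lebesgue. h w *\<^sub>R g w) = (LINT w|lebesgue. h w *\<^sub>R (indicator B' w *\<^sub>R g w))" for g
      unfolding set_lebesgue_integral_def using supp B'
      by (intro Bochner_Integration.integral_cong) (auto simp: indicator_def)
    have "mollify \<delta> e z = (LINT w|lborel. h w *\<^sub>R e w)" by (simp add: mollify_def h_def)
    also have "\<dots> = (LINT w|lebesgue. h w *\<^sub>R e w)"
    proof (rule integrable_lebesgue_iff(2)[symmetric])
      note [measurable] = borel_measurable_continuous_onI[OF ch]
      show "(\<lambda>w. h w *\<^sub>R e w) \<in> borel_measurable borel" by measurable
    qed
    also have "\<dots> = (LINT w|lebesgue. h w *\<^sub>R (e1 w - e2 w))"
    proof (rule integral_cong_AE)
      have "h \<in> borel_measurable lebesgue" "e \<in> borel_measurable lebesgue"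
        using borel_measurable_continuous_onI[OF ch] by (auto simp: measurable_completion)
      then show "(\<lambda>w. h w *\<^sub>R e w) \<in> borel_measurable lebesgue"
        "(\<lambda>w. h w *\<^sub>R (e1 w - e2 w)) \<in> borel_measurable lebesgue" using i by auto
      show "AE w in lebesgue. h w *\<^sub>R e w = h w *\<^sub>R (e1 w - e2 w)"
        using ae by eventually_elim simp
    qed
    also have "\<dots> = (LINT w|lebesgue. h w *\<^sub>R e1 w) - (LINT w|lebesgue. h w *\<^sub>R e2 w)"
      unfolding scaleR_diff_right
      by (intro Bochner_Integration.integral_diff integrable_mult_bounded_continuous[OF _ ch M] i)
    also have "\<dots> = 0" using eq unfolding conv e1_def e2_def by simp
    finally show ?thesis .
  qed
  have "(\<integral>\<^sup>+z. ennreal (cmod (e z)) * indicator B z \<partial>lborel) \<le> ennreal \<eta>" if \<eta>: "\<eta> > 0" for \<eta>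
  proof -
    obtain d where d: "d > 0" and d': "\<And>\<delta>. 0 < \<delta> \<Longrightarrow> \<delta> \<le> d \<Longrightarrow>
        (\<integral>\<^sup>+z. ennreal (cmod (mollify \<delta> e z - e z)) \<partial>lborel) \<le> ennreal \<eta>"
      using L1_mollify_tendsto[OF e \<eta>] by blast
    define \<delta> where "\<delta> = min d (s / 2)"
    have \<delta>: "0 < \<delta>" "\<delta> \<le> d" "\<delta> < s" using d s by (auto simp: \<delta>_def)
    have "(\<integral>\<^sup>+z. ennreal (cmod (e z)) * indicator B z \<partial>lborel) \<le> (\<integral>\<^sup>+z. ennreal (cmod (mollify \<delta> e z - e z)) \<partial>lborel)"
      by (intro nn_integral_mono) (auto simp: indicator_def m0[OF _ \<delta>(1,3)])
    then show ?thesis using d'[OF \<delta>(1,2)] by (rule order_trans)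
  qed
  then have "(\<integral>\<^sup>+z. ennreal (cmod (e z)) * indicator B z \<partial>lborel) \<le> 0"
    by (intro ennreal_le_epsilon[where y = 0]) simp
  then have "AE z in lborel. ennreal (cmod (e z)) * indicator B z = 0"
    by (subst (asm) le_zero_eq, subst (asm) nn_integral_0_iff_AE) (auto simp: B_def)
  then have "AE z in lebesgue. ennreal (cmod (e z)) * indicator B z = 0" by (rule AE_completion)
  with ae show ?thesis
  proof eventually_elim
    case (elim z)
    have "z \<in> B'" if "z \<in> B" using that s by (auto simp: B_def B'_def cbox_complex inset_def)
    then show ?case using elim by (auto simp: B_def[symmetric] e1_def e2_def indicator_def split: if_splits)
  qed
qed

lemma weak_deriv_unique:
  assumes g: "is_weak_deriv (box a b) v f g1" "is_weak_deriv (box a b) v f g2"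
  shows "AE z in lebesgue. z \<in> box a b \<longrightarrow> g1 z = g2 z"
proof -
  have "AE z in lebesgue. \<forall>n::nat. z \<in> cbox (a + inset (2 * (1 / real (Suc n)))) (b - inset (2 * (1 / real (Suc n)))) \<longrightarrow> g1 z = g2 z"
    by (subst AE_all_countable) (intro allI weak_deriv_unique_inner[OF g], simp)
  then show ?thesis
  proof eventually_elim
    case (elim z)
    show ?case
    proof
      assume "z \<in> box a b"
      then obtain d where d: "d > 0" "{z} \<subseteq> cbox (a + inset d) (b - inset d)"
        using compact_subset_inset_box[of "{z}" a b] by auto
      obtain n where n: "1 / real (Suc n) < d / 2"
        using d(1) by (metis half_gt_zero inverse_eq_divide reals_Archimedean)
      then have "z \<in> cbox (a + inset (2 * (1 / real (Suc n)))) (b - inset (2 * (1 / real (Suc n))))"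
        using d(2) by (auto simp: cbox_complex inset_def)
      then show "g1 z = g2 z" using elim by blast
    qed
  qed
qed

lemma lborel_integral_eq_integral_cbox:
  fixes q :: "complex \<Rightarrow> complex"
  assumes "continuous_on UNIV q" "\<And>w. w \<notin> cbox a b \<Longrightarrow> q w = 0"
  shows "(LINT w|lborel. q w) = integral (cbox a b) q"
proof -
  have "set_integrable lborel (cbox a b) q"
    using borel_integrable_compact[of "cbox a b" q] assms(1)
    by (auto simp: set_integrable_def intro: continuous_on_subset)
  then have "(LINT w:cbox a b|lborel. q w) = integral (cbox a b) q"
    by (rule set_borel_integral_eq_integral)
  moreover have "(LINT w:cbox a b|lborel. q w) = (LINT w|lborel. q w)"
    unfolding set_lebesgue_integral_def using assms(2)
    by (intro Bochner_Integration.integral_cong) (auto simp: indicator_def)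
  ultimately show ?thesis by simp
qed

text \<open>The integral of the translate \<open>P (z + t *\<^sub>R v)\<close> does not depend on \<open>t\<close>; differentiate it at \<open>t = 0\<close>.\<close>

lemma integral_directional_derivative_0:
  fixes P :: "complex \<Rightarrow> complex"
  assumes der: "\<And>z. (P has_derivative P' z) (at z)" and cont: "continuous_on UNIV (\<lambda>z. P' z v)"
    and supp: "compact X" "\<And>z. z \<notin> X \<Longrightarrow> P z = 0"
  shows "(LINT z|lborel. P' z v) = 0"
proof -
  have cP: "continuous_on UNIV P"
    using der by (auto intro!: continuous_at_imp_continuous_on has_derivative_continuous)
  obtain R where R: "\<And>z. z \<in> X \<Longrightarrow> cmod z \<le> R"
    using compact_imp_bounded[OF supp(1)] by (auto simp: bounded_pos)
  obtain a b where ab: "cball (0::complex) (R + cmod v) \<subseteq> cbox a b"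
    using bounded_subset_cbox_symmetric[OF bounded_cball] by blast
  have P0: "P (z + t *\<^sub>R v) = 0" if "z \<notin> cbox a b" "\<bar>t\<bar> < 1" for z and t :: real
  proof -
    have "\<bar>t\<bar> * cmod v \<le> 1 * cmod v" using that by (intro mult_right_mono) auto
    then have "cmod (z + t *\<^sub>R v) > R"
      using that ab norm_diff_ineq[of z "t *\<^sub>R v"] by (force simp: subset_iff)
    then show ?thesis using supp(2) R by (meson not_le)
  qed
  have dir: "((\<lambda>t. P (z + t *\<^sub>R v)) has_vector_derivative P' (z + t *\<^sub>R v) v) (at t within S)" for z t S
  proof -
    have "((\<lambda>t. z + t *\<^sub>R v) has_derivative (\<lambda>s. s *\<^sub>R v)) (at t)" by (auto intro!: derivative_eq_intros)
    from has_derivative_compose[OF this der]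
    have "((\<lambda>t. P (z + t *\<^sub>R v)) has_derivative (\<lambda>s. s *\<^sub>R P' (z + t *\<^sub>R v) v)) (at t)"
      using has_derivative_bounded_linear[OF der] by (simp add: linear_simps)
    then show ?thesis unfolding has_vector_derivative_def by (rule has_derivative_at_withinI)
  qed
  have cc: "continuous_on S (\<lambda>x. P (f x))" "continuous_on S (\<lambda>x. P' (f x) v)"
    if "continuous_on S f" for S and f :: "'x::topological_space \<Rightarrow> complex"
    using that by (auto intro: continuous_on_compose2[OF cP] continuous_on_compose2[OF cont])
  let ?I = "\<lambda>t. integral (cbox a b) (\<lambda>z. P (z + t *\<^sub>R v))"
  have "(?I has_vector_derivative integral (cbox a b) (\<lambda>z. P' (z + 0 *\<^sub>R v) v)) (at 0 within {-1<..<1})"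
  proof (rule leibniz_rule_vector_derivative)
    show "((\<lambda>t. P (z + t *\<^sub>R v)) has_vector_derivative P' (z + t *\<^sub>R v) v) (at t within {-1<..<1})" for z t
      by (rule dir)
    show "(\<lambda>z. P (z + t *\<^sub>R v)) integrable_on cbox a b" for t
      by (intro integrable_continuous cc continuous_intros)
    show "continuous_on ({-1<..<1} \<times> cbox a b) (\<lambda>(t, z). P' (z + t *\<^sub>R v) v)"
      unfolding case_prod_beta by (intro cc continuous_intros)
  qed auto
  then have "(?I has_vector_derivative integral (cbox a b) (\<lambda>z. P' z v)) (at 0)"
    using at_within_open[of 0 "{-1<..<1::real}"] by simp
  moreover have "?I t = (LINT z|lborel. P z)" if "t \<in> {-1<..<1}" for t
  proof -
    have "?I t = (LINT z|lborel. P (z + t *\<^sub>R v))"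
      using that by (intro lborel_integral_eq_integral_cbox[symmetric] cc P0 continuous_intros) auto
    also have "\<dots> = (LINT z|lborel. P z)"
      by (intro integrable_lborel_translate integrable_continuous_support[OF cP supp])
    finally show ?thesis .
  qed
  then have "(?I has_vector_derivative 0) (at 0)"
    by (intro has_vector_derivative_transform_within_open[OF has_vector_derivative_const, where S = "{-1<..<1}"]) auto
  ultimately have "integral (cbox a b) (\<lambda>z. P' z v) = 0"
    by (rule vector_derivative_unique_at)
  moreover have "P' z v = 0" if "z \<notin> cbox a b" for z
  proof -
    have "((\<lambda>t. P (z + t *\<^sub>R v)) has_vector_derivative 0) (at 0)"
      using P0[OF that]
      by (intro has_vector_derivative_transform_within_open[OF has_vector_derivative_const, where S = "{-1<..<1}"]) auto
    then show ?thesis using vector_derivative_unique_at[OF dir[of z 0]] by simp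
  qed
  ultimately show ?thesis
    by (simp add: lborel_integral_eq_integral_cbox[OF cont, of a b])
qed

lemma test_functionE:
  assumes h: "h \<in> test_functions \<Omega>"
  obtains X where "compact X" "X \<subseteq> \<Omega>" "\<And>z. z \<notin> X \<Longrightarrow> h z = 0"
    "\<And>z v. z \<notin> X \<Longrightarrow> frechet_derivative h (at z) v = 0"
    "\<And>z. (h has_derivative frechet_derivative h (at z)) (at z)"
    "continuous_on UNIV h" "\<And>v. continuous_on UNIV (\<lambda>z. frechet_derivative h (at z) v)"
proof -
  define X where "X = closure {z. h z \<noteq> 0}"
  have X: "compact X" "X \<subseteq> \<Omega>" "\<And>z. z \<notin> X \<Longrightarrow> h z = 0"
    using h closure_subset[of "{z. h z \<noteq> 0}"] by (auto simp: test_functions_def X_def)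
  have "Ck 1 h" using h by (auto simp: test_functions_def)
  then have hd: "\<And>z. (h has_derivative frechet_derivative h (at z)) (at z)"
    and hc: "\<And>v. continuous_on UNIV (\<lambda>z. frechet_derivative h (at z) v)"
    by (auto simp: differentiable_on_def frechet_derivative_works)
  have ch: "continuous_on UNIV h"
    using hd by (auto intro!: continuous_at_imp_continuous_on has_derivative_continuous)
  have dh0: "frechet_derivative h (at z) v = 0" if "z \<notin> X" for z v
  proof -
    have "open (- X)" using X(1) by (simp add: compact_imp_closed open_Compl)
    then have "(h has_derivative (\<lambda>_. 0)) (at z)"
      using that X(3) by (intro has_derivative_transform_within_open[OF has_derivative_const[of 0], of "-X"]) auto
    from fun_cong[OF frechet_derivative_at[OF this, symmetric], of v] show ?thesis .
  qed
  show ?thesis using that[OF X dh0 hd ch hc] .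
qed

lemma is_weak_deriv_linear:
  fixes L :: "complex \<Rightarrow> complex"
  assumes L: "bounded_linear L"
  shows "is_weak_deriv \<Omega> v L (\<lambda>_. L v)"
  unfolding is_weak_deriv_def
proof (intro conjI ballI)
  have cL: "continuous_on S L" for S using L by (rule linear_continuous_on)
  have loc: "locally_integrable \<Omega> q" if "continuous_on UNIV q" for q :: "complex \<Rightarrow> complex"
    unfolding locally_integrable_def
  proof (intro allI impI, elim conjE)
    fix A :: "complex set" assume "compact A"
    then have "set_integrable lborel A q"
      using borel_integrable_compact[of A q] that by (auto simp: set_integrable_def intro: continuous_on_subset)
    then show "set_integrable lebesgue A q"
      unfolding set_integrable_def using integrable_completion[of "\<lambda>x. indicator A x *\<^sub>R q x" lborel] by auto
  qed
  show "locally_integrable \<Omega> L" "locally_integrable \<Omega> (\<lambda>_. L v)"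
    by (intro loc cL continuous_intros)+
  fix h assume h: "h \<in> test_functions \<Omega>"
  then obtain X where X: "compact X" "X \<subseteq> \<Omega>" "\<And>z. z \<notin> X \<Longrightarrow> h z = 0"
    and dX: "\<And>z v. z \<notin> X \<Longrightarrow> frechet_derivative h (at z) v = 0"
    and hd: "\<And>z. (h has_derivative frechet_derivative h (at z)) (at z)"
    and ch: "continuous_on UNIV h" and hc': "\<And>v. continuous_on UNIV (\<lambda>z. frechet_derivative h (at z) v)"
    by (rule test_functionE) (rule that, assumption+)
  let ?dh = "\<lambda>z. frechet_derivative h (at z) v"
  note dh0 = dX[of _ v] and hc = hc'[of v]
  have int: "integrable lborel (\<lambda>z. ?dh z *\<^sub>R L z)" "integrable lborel (\<lambda>z. h z *\<^sub>R L v)"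
    by (rule integrable_continuous_support[OF _ X(1)], use X(3) dh0 in \<open>auto intro!: continuous_intros hc cL ch\<close>)+
  have P: "((\<lambda>z. h z *\<^sub>R L z) has_derivative (\<lambda>w. h z *\<^sub>R L w + frechet_derivative h (at z) w *\<^sub>R L z)) (at z)" for z
    by (intro has_derivative_scaleR hd bounded_linear_imp_has_derivative L)
  have "(LINT z|lborel. h z *\<^sub>R L v + ?dh z *\<^sub>R L z) = 0"
    by (rule integral_directional_derivative_0[OF P _ X(1)]) (use X(3) in \<open>auto intro!: continuous_intros hc cL ch\<close>)
  then have "(LINT z|lborel. ?dh z *\<^sub>R L z) = - (LINT z|lborel. h z *\<^sub>R L v)"
    using int by (simp add: add_eq_0_iff)
  moreover have "(LINT z:\<Omega>|lebesgue. ?dh z *\<^sub>R L z) = (LINT z|lborel. ?dh z *\<^sub>R L z)"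
  proof -
    have "(LINT z:\<Omega>|lebesgue. ?dh z *\<^sub>R L z) = (LINT z|lebesgue. ?dh z *\<^sub>R L z)"
      unfolding set_lebesgue_integral_def using X dh0
      by (intro Bochner_Integration.integral_cong) (auto simp: indicator_def)
    then show ?thesis using int by (simp add: integrable_lebesgue_iff)
  qed
  moreover have "(LINT z:\<Omega>|lebesgue. h z *\<^sub>R L v) = (LINT z|lborel. h z *\<^sub>R L v)"
  proof -
    have "(LINT z:\<Omega>|lebesgue. h z *\<^sub>R L v) = (LINT z|lebesgue. h z *\<^sub>R L v)"
      unfolding set_lebesgue_integral_def using X
      by (intro Bochner_Integration.integral_cong) (auto simp: indicator_def)
    also have "\<dots> = (LINT z|lborel. h z *\<^sub>R L v)"
      using int(2) by (intro integrable_lebesgue_iff(2)) auto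
    finally show ?thesis .
  qed
  ultimately show "(LINT z:\<Omega>|lebesgue. ?dh z *\<^sub>R L z) = - (LINT z:\<Omega>|lebesgue. h z *\<^sub>R L v)" by simp
qed

lemma integrable_test_mult:
  fixes q :: "complex \<Rightarrow> real"
  assumes f: "locally_integrable \<Omega> f" and X: "compact X" "X \<subseteq> \<Omega>"
    and q: "continuous_on UNIV q" "\<And>z. z \<notin> X \<Longrightarrow> q z = 0"
  shows "integrable lebesgue (\<lambda>z. indicator \<Omega> z *\<^sub>R (q z *\<^sub>R f z))"
proof -
  have "bounded (q ` X)"
    using q(1) X(1) by (intro compact_imp_bounded compact_continuous_image) (auto intro: continuous_on_subset)
  then obtain B where B: "\<And>z. z \<in> X \<Longrightarrow> \<bar>q z\<bar> \<le> B" by (auto simp: bounded_iff)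
  have B': "\<bar>q z\<bar> \<le> max B 0" for z using B[of z] q(2)[of z] by (cases "z \<in> X") auto
  have "integrable lebesgue (\<lambda>z. indicator X z *\<^sub>R f z)"
    using f X by (auto simp: locally_integrable_def set_integrable_def)
  from integrable_mult_bounded_continuous[OF this q(1) B']
  have "integrable lebesgue (\<lambda>z. q z *\<^sub>R (indicator X z *\<^sub>R f z))" .
  moreover have "(\<lambda>z. q z *\<^sub>R (indicator X z *\<^sub>R f z)) = (\<lambda>z. indicator \<Omega> z *\<^sub>R (q z *\<^sub>R f z))"
    using X(2) q(2) by (auto simp: fun_eq_iff indicator_def)
  ultimately show ?thesis by metis
qed

lemma is_weak_deriv_diff:
  assumes f: "is_weak_deriv \<Omega> v f F" and g: "is_weak_deriv \<Omega> v g H"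
  shows "is_weak_deriv \<Omega> v (\<lambda>z. f z - g z) (\<lambda>z. F z - H z)"
proof -
  have loc: "locally_integrable \<Omega> f" "locally_integrable \<Omega> F" "locally_integrable \<Omega> g" "locally_integrable \<Omega> H"
    using f g by (auto simp: is_weak_deriv_def)
  show ?thesis
    unfolding is_weak_deriv_def
  proof (intro conjI ballI)
    show "locally_integrable \<Omega> (\<lambda>z. f z - g z)" "locally_integrable \<Omega> (\<lambda>z. F z - H z)"
      using loc by (auto simp: locally_integrable_def intro!: set_integral_diff)
    fix h assume h: "h \<in> test_functions \<Omega>"
    then obtain X where X: "compact X" "X \<subseteq> \<Omega>" "\<And>z. z \<notin> X \<Longrightarrow> h z = 0"
      "\<And>z v. z \<notin> X \<Longrightarrow> frechet_derivative h (at z) v = 0"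
      "\<And>z. (h has_derivative frechet_derivative h (at z)) (at z)"
      "continuous_on UNIV h" "\<And>v. continuous_on UNIV (\<lambda>z. frechet_derivative h (at z) v)"
      by (rule test_functionE) (rule that, assumption+)
    let ?dh = "\<lambda>z. frechet_derivative h (at z) v"
    have i: "set_integrable lebesgue \<Omega> (\<lambda>z. ?dh z *\<^sub>R f z)" "set_integrable lebesgue \<Omega> (\<lambda>z. ?dh z *\<^sub>R g z)"
      "set_integrable lebesgue \<Omega> (\<lambda>z. h z *\<^sub>R F z)" "set_integrable lebesgue \<Omega> (\<lambda>z. h z *\<^sub>R H z)"
      unfolding set_integrable_def
      by (rule integrable_test_mult[OF loc(1) X(1,2,7) X(4)], assumption)
         (rule integrable_test_mult[OF loc(3) X(1,2,7) X(4)], assumption,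
          rule integrable_test_mult[OF loc(2) X(1,2,6) X(3)], assumption,
          rule integrable_test_mult[OF loc(4) X(1,2,6) X(3)], assumption)
    have "(LINT z:\<Omega>|lebesgue. ?dh z *\<^sub>R (f z - g z)) = (LINT z:\<Omega>|lebesgue. ?dh z *\<^sub>R f z) - (LINT z:\<Omega>|lebesgue. ?dh z *\<^sub>R g z)"
      unfolding scaleR_diff_right by (rule set_integral_diff(2)[OF i(1,2)])
    also have "\<dots> = - (LINT z:\<Omega>|lebesgue. h z *\<^sub>R F z) - - (LINT z:\<Omega>|lebesgue. h z *\<^sub>R H z)"
      using f g h unfolding is_weak_deriv_def by simp
    also have "\<dots> = - ((LINT z:\<Omega>|lebesgue. h z *\<^sub>R F z) - (LINT z:\<Omega>|lebesgue. h z *\<^sub>R H z))" by simp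
    also have "\<dots> = - (LINT z:\<Omega>|lebesgue. h z *\<^sub>R (F z - H z))"
      unfolding scaleR_diff_right by (subst set_integral_diff(2)[OF i(3,4)]) (rule refl)
    finally show "(LINT z:\<Omega>|lebesgue. ?dh z *\<^sub>R (f z - g z)) = - (LINT z:\<Omega>|lebesgue. h z *\<^sub>R (F z - H z))" .
  qed
qed

lemma is_weak_deriv_cong:
  assumes f: "is_weak_deriv \<Omega> v f F" and eq: "\<And>z. z \<in> \<Omega> \<Longrightarrow> f z = g z"
  shows "is_weak_deriv \<Omega> v g F"
proof -
  have "set_integrable lebesgue A f \<longleftrightarrow> set_integrable lebesgue A g" if "A \<subseteq> \<Omega>" for A
  proof -
    have "(\<lambda>z. indicator A z *\<^sub>R f z) = (\<lambda>z. indicator A z *\<^sub>R g z)" using eq that by (auto simp: fun_eq_iff indicator_def)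
    then show ?thesis by (simp only: set_integrable_def)
  qed
  moreover have "(LINT z:\<Omega>|lebesgue. q z *\<^sub>R f z) = (LINT z:\<Omega>|lebesgue. q z *\<^sub>R g z)" for q :: "complex \<Rightarrow> real"
    unfolding set_lebesgue_integral_def using eq
    by (intro Bochner_Integration.integral_cong) (auto simp: indicator_def)
  ultimately show ?thesis using f by (simp add: is_weak_deriv_def locally_integrable_def)
qed

text \<open>Exhaust the open rectangle by compact ones: \<open>g\<close> is measurable on each, and the restrictions converge.\<close>

lemma locally_integrable_measurable:
  assumes g: "locally_integrable (box a b) g"
  shows "(\<lambda>z. indicator (box a b) z *\<^sub>R g z) \<in> borel_measurable lebesgue"
proof (rule borel_measurable_LIMSEQ_metric)
  let ?B = "\<lambda>i::nat. cbox (a + inset (1 / real (Suc i))) (b - inset (1 / real (Suc i)))"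
  have sub: "?B i \<subseteq> box a b" for i using cutoff_support(2)[of "Suc i" a b] by simp
  fix i
  have "set_integrable lebesgue (?B i) g"
    using g[unfolded locally_integrable_def, rule_format, of "?B i"] sub[of i] by simp
  then show "(\<lambda>z. indicator (?B i) z *\<^sub>R g z) \<in> borel_measurable lebesgue"
    unfolding set_integrable_def by (rule borel_measurable_integrable)
next
  let ?B = "\<lambda>i::nat. cbox (a + inset (1 / real (Suc i))) (b - inset (1 / real (Suc i)))"
  have sub: "?B i \<subseteq> box a b" for i using cutoff_support(2)[of "Suc i" a b] by simp
  fix z :: complex
  show "(\<lambda>i. indicator (?B i) z *\<^sub>R g z) \<longlonglongrightarrow> indicator (box a b) z *\<^sub>R g z"
  proof (cases "z \<in> box a b")
    case True
    then obtain d where d: "d > 0" "{z} \<subseteq> cbox (a + inset d) (b - inset d)"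
      using compact_subset_inset_box[of "{z}" a b] by auto
    have "(\<lambda>i. 1 / real (Suc i)) \<longlonglongrightarrow> 0" using LIMSEQ_Suc[OF lim_1_over_n] by simp
    from order_tendstoD(2)[OF this d(1)]
    have "\<forall>\<^sub>F i in sequentially. indicator (?B i) z *\<^sub>R g z = indicator (box a b) z *\<^sub>R g z"
    proof eventually_elim
      case (elim i)
      then have "z \<in> ?B i" using d(2) by (auto simp: cbox_complex inset_def)
      then show ?case using True by simp
    qed
    then show ?thesis by (rule tendsto_eventually)
  next
    case False
    then have "z \<notin> ?B i" for i using sub by blast
    then show ?thesis using False by simp
  qed
qed

section \<open>An estimate of Cauchy type\<close>

lemma nn_integral_continuous_Icc:
  fixes q :: "real \<Rightarrow> real"
  assumes "continuous_on UNIV q" "\<And>x. q x \<ge> 0"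
  shows "(\<integral>\<^sup>+x. ennreal (q x) * indicator {a..b} x \<partial>lborel) = ennreal (integral {a..b} q)"
proof -
  have "(q has_integral integral {a..b} q) {a..b}"
    using assms(1) by (intro integrable_integral integrable_continuous_interval) (auto intro: continuous_on_subset)
  then have "((\<lambda>x. indicator {a..b} x * q x) has_integral integral {a..b} q) UNIV"
    by (subst (asm) has_integral_restrict_UNIV[symmetric])
       (simp add: indicator_def of_bool_def if_distrib if_distribR cong: if_cong)
  moreover have [measurable]: "q \<in> borel_measurable borel"
    using assms(1) by (rule borel_measurable_continuous_onI)
  ultimately have "(\<integral>\<^sup>+x. ennreal (indicator {a..b} x * q x) \<partial>lborel) = ennreal (integral {a..b} q)"
    using assms(2) by (intro nn_integral_has_integral_lborel) auto
  moreover have "ennreal (indicator {a..b} x * q x) = ennreal (q x) * indicator {a..b} x" for x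
    by (simp add: indicator_def)
  ultimately show ?thesis by simp
qed

definition polar :: "complex \<Rightarrow> real \<Rightarrow> real \<Rightarrow> complex" where
  "polar w \<theta> r = w + complex_of_real r * (complex_of_real (cos \<theta>) + \<i> * complex_of_real (sin \<theta>))"

lemma continuous_polar [continuous_intros]:
  fixes f :: "'x::t2_space \<Rightarrow> complex"
  shows
  "continuous_on S f \<Longrightarrow> continuous_on S g \<Longrightarrow> continuous_on S h \<Longrightarrow> continuous_on S (\<lambda>x. polar (f x) (g x) (h x))"
  unfolding polar_def by (intro continuous_intros continuous_on_cos continuous_on_sin)

lemma cmod_unit: "cmod (complex_of_real (cos \<theta>) + \<i> * complex_of_real (sin \<theta>)) = 1"
  by (simp add: cmod_def)

text \<open>On the ray from \<open>w\<close> in direction \<open>\<theta>\<close> the radial derivative integrates to \<open>- u w\<close>. It equals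
\<open>exp (- \<i> \<theta>)\<close> times twice the \<open>dbar\<close>-derivative, minus \<open>\<i>\<close> times the derivative in the tangential
direction, and the latter integrates to zero over each circle around \<open>w\<close>.\<close>

lemma pointwise_dbar_bound:
  fixes u a b :: "complex \<Rightarrow> complex"
  assumes der: "\<And>z. (u has_derivative (\<lambda>v. Re v *\<^sub>R a z + Im v *\<^sub>R b z)) (at z)"
    and a: "continuous_on UNIV a" and b: "continuous_on UNIV b" and D: "D > 0"
    and vanish: "\<And>\<theta>. u (polar w \<theta> D) = 0"
  shows "pi * cmod (u w) \<le> integral {0..2*pi} (\<lambda>\<theta>. integral {0..D} (\<lambda>r. cmod ((a (polar w \<theta> r) + \<i> * b (polar w \<theta> r)) / 2)))"
proof -
  let ?p = "polar w"
  define h where "h z = (a z + \<i> * b z) / 2" for z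
  have ca: "continuous_on S (\<lambda>x. a (?p (f x) (g x)))" "continuous_on S (\<lambda>x. b (?p (f x) (g x)))"
    "continuous_on S (\<lambda>x. h (?p (f x) (g x)))"
    if "continuous_on S f" "continuous_on S g" for S and f g :: "'x::t2_space \<Rightarrow> real"
  proof -
    show "continuous_on S (\<lambda>x. a (?p (f x) (g x)))" "continuous_on S (\<lambda>x. b (?p (f x) (g x)))"
      by (rule continuous_on_compose2[OF a] continuous_on_compose2[OF b], intro continuous_intros that, simp)+
    then show "continuous_on S (\<lambda>x. h (?p (f x) (g x)))"
      unfolding h_def by (intro continuous_intros) auto
  qed
  define Rd where "Rd \<theta> r = cos \<theta> *\<^sub>R a (?p \<theta> r) + sin \<theta> *\<^sub>R b (?p \<theta> r)" for \<theta> r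
  define Tg where "Tg \<theta> r = (- sin \<theta>) *\<^sub>R a (?p \<theta> r) + cos \<theta> *\<^sub>R b (?p \<theta> r)" for \<theta> r
  define Hh where "Hh \<theta> r = 2 * cis (- \<theta>) * h (?p \<theta> r)" for \<theta> r
  have split: "Rd \<theta> r = Hh \<theta> r - \<i> * Tg \<theta> r" for \<theta> r
    by (simp add: Rd_def Tg_def Hh_def h_def complex_eq_iff field_simps)
  have cT: "continuous_on S (\<lambda>x. Tg (f x) (g x))" and cH: "continuous_on S (\<lambda>x. Hh (f x) (g x))"
    if "continuous_on S f" "continuous_on S g" for S and f g :: "'x::t2_space \<Rightarrow> real"
    unfolding Tg_def Hh_def by (intro continuous_intros ca that)+
  have R: "integral {0..D} (Rd \<theta>) = - u w" for \<theta>
  proof -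
    have "((\<lambda>r. u (?p \<theta> r)) has_vector_derivative Rd \<theta> r) (at r within {0..D})" for r
    proof -
      have "(?p \<theta> has_derivative (\<lambda>t. complex_of_real t * (complex_of_real (cos \<theta>) + \<i> * complex_of_real (sin \<theta>)))) (at r)"
        unfolding polar_def by (auto intro!: derivative_eq_intros)
      from has_derivative_compose[OF this der]
      have "((\<lambda>r. u (?p \<theta> r)) has_derivative (\<lambda>t. t *\<^sub>R Rd \<theta> r)) (at r)"
        by (rule has_derivative_eq_rhs) (simp add: fun_eq_iff Rd_def scaleR_add_right)
      then show ?thesis
        unfolding has_vector_derivative_def by (rule has_derivative_at_withinI)
    qed
    then have "(Rd \<theta> has_integral u (?p \<theta> D) - u (?p \<theta> 0)) {0..D}"
      using D by (intro fundamental_theorem_of_calculus) auto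
    then show ?thesis using vanish by (simp add: integral_unique polar_def)
  qed
  have T: "integral {0..2*pi} (\<lambda>\<theta>. Tg \<theta> r) = 0" for r
  proof -
    have "((\<lambda>\<theta>. u (?p \<theta> r)) has_vector_derivative r *\<^sub>R Tg \<theta> r) (at \<theta> within {0..2*pi})" for \<theta>
    proof -
      have "((\<lambda>\<theta>. ?p \<theta> r) has_derivative (\<lambda>t. t *\<^sub>R (complex_of_real r * (complex_of_real (- sin \<theta>) + \<i> * complex_of_real (cos \<theta>))))) (at \<theta>)"
        unfolding polar_def by (auto intro!: derivative_eq_intros simp: scaleR_conv_of_real algebra_simps)
      from has_derivative_compose[OF this der]
      have "((\<lambda>\<theta>. u (?p \<theta> r)) has_derivative (\<lambda>t. t *\<^sub>R (r *\<^sub>R Tg \<theta> r))) (at \<theta>)"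
        by (rule has_derivative_eq_rhs) (simp add: fun_eq_iff Tg_def scaleR_add_right scaleR_diff_right mult_ac)
      then show ?thesis
        unfolding has_vector_derivative_def by (rule has_derivative_at_withinI)
    qed
    then have "((\<lambda>\<theta>. r *\<^sub>R Tg \<theta> r) has_integral u (?p (2*pi) r) - u (?p 0 r)) {0..2*pi}"
      by (intro fundamental_theorem_of_calculus) auto
    then have *: "((\<lambda>\<theta>. r *\<^sub>R Tg \<theta> r) has_integral 0) {0..2*pi}" by (simp add: polar_def)
    \<comment> \<open>At the centre, \<open>Tg\<close> is the tangential direction of a constant linear map, a derivative in \<open>\<theta>\<close>.\<close>
    show ?thesis
    proof (cases "r = 0")
      case False
      then show ?thesis using has_integral_cmul[OF *, of "1/r"]
        by (intro integral_unique) (simp)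
    next
      case True
      have "((\<lambda>\<theta>. (cos \<theta>) *\<^sub>R a w + (sin \<theta>) *\<^sub>R b w) has_vector_derivative Tg \<theta> r) (at \<theta> within {0..2*pi})" for \<theta>
        unfolding Tg_def polar_def True
        by (auto intro!: derivative_eq_intros simp: has_vector_derivative_def algebra_simps)
      then have "((\<lambda>\<theta>. Tg \<theta> r) has_integral ((cos (2*pi)) *\<^sub>R a w + (sin (2*pi)) *\<^sub>R b w) - ((cos 0) *\<^sub>R a w + (sin 0) *\<^sub>R b w)) {0..2*pi}"
        by (intro fundamental_theorem_of_calculus) auto
      then show ?thesis by (simp add: integral_unique)
    qed
  qed
  have int: "(\<lambda>r. f \<theta> r) integrable_on {0..D}" if "continuous_on UNIV (\<lambda>r. f \<theta> r)" for f :: "real \<Rightarrow> real \<Rightarrow> complex" and \<theta>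
    using that by (intro integrable_continuous_interval) (auto intro: continuous_on_subset)
  have cint: "continuous_on {0..2*pi} (\<lambda>\<theta>. integral {0..D} (f \<theta>))"
    if "continuous_on UNIV (\<lambda>(\<theta>, r). f \<theta> r)" for f :: "real \<Rightarrow> real \<Rightarrow> 'y::banach"
    using integral_continuous_on_param[of "{0..2*pi}" 0 D f] continuous_on_subset[OF that]
    by (auto simp: cbox_interval)
  have cT2: "continuous_on UNIV (\<lambda>(\<theta>, r). Tg \<theta> r)" and cH2: "continuous_on UNIV (\<lambda>(\<theta>, r). Hh \<theta> r)"
    and ch2: "continuous_on UNIV (\<lambda>(\<theta>, r). cmod (h (?p \<theta> r)))"
    unfolding case_prod_beta by (intro cT cH continuous_intros ca)+
  have "integral {0..2*pi} (\<lambda>\<theta>. integral {0..D} (Tg \<theta>)) = integral {0..D} (\<lambda>r. integral {0..2*pi} (\<lambda>\<theta>. Tg \<theta> r))"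
    using integral_swap_continuous[of 0 0 "2*pi" D Tg] continuous_on_subset[OF cT2]
    by (auto simp: cbox_interval)
  then have T0: "integral {0..2*pi} (\<lambda>\<theta>. integral {0..D} (Tg \<theta>)) = 0" by (simp add: T)
  have eq: "integral {0..D} (Rd \<theta>) = integral {0..D} (Hh \<theta>) - \<i> * integral {0..D} (Tg \<theta>)" for \<theta>
  proof -
    have "integral {0..D} (Rd \<theta>) = integral {0..D} (\<lambda>r. Hh \<theta> r - \<i> * Tg \<theta> r)" by (simp add: split[abs_def])
    also have "\<dots> = integral {0..D} (Hh \<theta>) - integral {0..D} (\<lambda>r. \<i> * Tg \<theta> r)"
      by (intro Henstock_Kurzweil_Integration.integral_diff int cH continuous_intros cT)
    finally show ?thesis by simp
  qed
  have "(\<lambda>\<theta>. integral {0..D} (Hh \<theta>)) integrable_on {0..2*pi}" "(\<lambda>\<theta>. \<i> * integral {0..D} (Tg \<theta>)) integrable_on {0..2*pi}"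
    by (intro integrable_continuous_interval continuous_intros cint cH2 cT2)+
  then have "integral {0..2*pi} (\<lambda>\<theta>. integral {0..D} (Rd \<theta>)) =
     integral {0..2*pi} (\<lambda>\<theta>. integral {0..D} (Hh \<theta>)) - \<i> * integral {0..2*pi} (\<lambda>\<theta>. integral {0..D} (Tg \<theta>))"
    unfolding eq by (simp add: Henstock_Kurzweil_Integration.integral_diff)
  then have main: "- (2 * pi) *\<^sub>R u w = integral {0..2*pi} (\<lambda>\<theta>. integral {0..D} (Hh \<theta>))"
    unfolding R T0 by simp
  have "norm (integral {0..2*pi} (\<lambda>\<theta>. integral {0..D} (Hh \<theta>))) \<le>
      integral {0..2*pi} (\<lambda>\<theta>. 2 * integral {0..D} (\<lambda>r. cmod (h (?p \<theta> r))))"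
  proof (rule integral_norm_bound_integral)
    show "(\<lambda>\<theta>. integral {0..D} (Hh \<theta>)) integrable_on {0..2*pi}"
      by (intro integrable_continuous_interval cint cH2)
    show "(\<lambda>\<theta>. 2 * integral {0..D} (\<lambda>r. cmod (h (?p \<theta> r)))) integrable_on {0..2*pi}"
      by (intro integrable_continuous_interval continuous_intros cint ch2)
    fix \<theta> :: real
    have "norm (integral {0..D} (Hh \<theta>)) \<le> integral {0..D} (\<lambda>r. 2 * cmod (h (?p \<theta> r)))"
      by (rule integral_norm_bound_integral)
         (auto intro!: integrable_continuous_interval cH continuous_intros ca simp: Hh_def norm_mult)
    then show "norm (integral {0..D} (Hh \<theta>)) \<le> 2 * integral {0..D} (\<lambda>r. cmod (h (?p \<theta> r)))" by simp
  qed
  then have "2 * pi * cmod (u w) \<le> 2 * integral {0..2*pi} (\<lambda>\<theta>. integral {0..D} (\<lambda>r. cmod (h (?p \<theta> r))))"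
    unfolding main[symmetric] by simp
  then show ?thesis by (simp add: h_def)
qed

text \<open>Integrate the pointwise bound over \<open>w\<close> and exchange the integrals: for a fixed direction and distance,
\<open>polar\<close> is a translation in \<open>w\<close>. The factor \<open>2 * pi\<close> from the angle, the weight \<open>1 / pi\<close> and the \<open>1 / 2\<close>
in the definition of the \<open>dbar\<close>-derivative cancel.\<close>

lemma L1_dbar_bound_smooth:
  fixes u a b :: "complex \<Rightarrow> complex"
  assumes der: "\<And>z. (u has_derivative (\<lambda>v. Re v *\<^sub>R a z + Im v *\<^sub>R b z)) (at z)"
    and a: "continuous_on UNIV a" and b: "continuous_on UNIV b" and D: "D > 0"
    and vanish: "\<And>w \<theta>. w \<in> S \<Longrightarrow> u (polar w \<theta> D) = 0" and S: "S \<in> sets borel"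
  shows "(\<integral>\<^sup>+w. ennreal (cmod (u w)) * indicator S w \<partial>lborel)
     \<le> ennreal D * (\<integral>\<^sup>+z. ennreal (cmod (a z + \<i> * b z)) \<partial>lborel)"
proof -
  define h where "h z = (a z + \<i> * b z) / 2" for z
  have ch: "continuous_on UNIV h" unfolding h_def by (intro continuous_intros a b) auto
  have chp: "continuous_on S (\<lambda>x. h (polar w (f x) (g x)))"
    if "continuous_on S f" "continuous_on S g" for S w and f g :: "'x::t2_space \<Rightarrow> real"
    by (rule continuous_on_compose2[OF ch], intro continuous_intros that, simp)
  have cu: "continuous_on UNIV u"
    using der by (auto intro!: continuous_at_imp_continuous_on has_derivative_continuous)
  note [measurable] = borel_measurable_continuous_onI[OF ch] borel_measurable_continuous_onI[OF cu] S
  have [measurable]: "(\<lambda>x. polar (f x) (g x) (k x)) \<in> borel_measurable M"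
    if [measurable]: "f \<in> borel_measurable M" "g \<in> borel_measurable M" "k \<in> borel_measurable M" for f g k and M :: "'m measure"
    unfolding polar_def by measurable
  let ?I = "\<lambda>w. \<integral>\<^sup>+\<theta>. (\<integral>\<^sup>+r. ennreal (cmod (h (polar w \<theta> r))) * indicator {0..D} r \<partial>lborel) * indicator {0..2*pi} \<theta> \<partial>lborel"
  have pt: "ennreal (cmod (u w)) * indicator S w \<le> ennreal (1 / pi) * ?I w" for w
  proof (cases "w \<in> S")
    case True
    have c1: "continuous_on UNIV (\<lambda>\<theta>. integral {0..D} (\<lambda>r. cmod (h (polar w \<theta> r))))"
      unfolding cbox_interval[symmetric]
      by (rule integral_continuous_on_param) (auto simp: case_prod_beta intro!: continuous_on_norm chp continuous_intros)
    have "(\<integral>\<^sup>+r. ennreal (cmod (h (polar w \<theta> r))) * indicator {0..D} r \<partial>lborel)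
       = ennreal (integral {0..D} (\<lambda>r. cmod (h (polar w \<theta> r))))" for \<theta>
      by (rule nn_integral_continuous_Icc) (auto intro!: continuous_intros chp)
    then have "?I w = ennreal (integral {0..2*pi} (\<lambda>\<theta>. integral {0..D} (\<lambda>r. cmod (h (polar w \<theta> r)))))"
      using nn_integral_continuous_Icc[OF c1, of 0 "2*pi"] by (simp add: integral_nonneg integrable_continuous_interval continuous_intros chp)
    moreover have "cmod (u w) \<le> (1 / pi) * integral {0..2*pi} (\<lambda>\<theta>. integral {0..D} (\<lambda>r. cmod (h (polar w \<theta> r))))"
      using pointwise_dbar_bound[OF der a b D vanish[OF True]] by (simp add: h_def field_simps)
    ultimately show ?thesis using True by (simp add: ennreal_mult'[symmetric] ennreal_leI)
  qed simp
  have "(\<integral>\<^sup>+w. ennreal (cmod (u w)) * indicator S w \<partial>lborel) \<le> (\<integral>\<^sup>+w. ennreal (1 / pi) * ?I w \<partial>lborel)"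
    by (intro nn_integral_mono pt)
  also have "\<dots> = ennreal (1 / pi) * (\<integral>\<^sup>+w. ?I w \<partial>lborel)"
    by (rule nn_integral_cmult) measurable
  also have "(\<integral>\<^sup>+w. ?I w \<partial>lborel) = (\<integral>\<^sup>+\<theta>. (\<integral>\<^sup>+w. (\<integral>\<^sup>+r. ennreal (cmod (h (polar w \<theta> r))) * indicator {0..D} r \<partial>lborel) * indicator {0..2*pi} \<theta> \<partial>lborel) \<partial>lborel)"
    by (rule lborel_pair.Fubini') measurable
  also have "\<dots> = (\<integral>\<^sup>+\<theta>. (\<integral>\<^sup>+w. (\<integral>\<^sup>+r. ennreal (cmod (h (polar w \<theta> r))) * indicator {0..D} r \<partial>lborel) \<partial>lborel) * indicator {0..2*pi} \<theta> \<partial>lborel)"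
    by (intro nn_integral_cong nn_integral_multc) measurable
  also have "\<dots> = (\<integral>\<^sup>+\<theta>. (\<integral>\<^sup>+r. (\<integral>\<^sup>+w. ennreal (cmod (h (polar w \<theta> r))) * indicator {0..D} r \<partial>lborel) \<partial>lborel) * indicator {0..2*pi} \<theta> \<partial>lborel)"
  proof -
    have "(\<integral>\<^sup>+w. (\<integral>\<^sup>+r. ennreal (cmod (h (polar w \<theta> r))) * indicator {0..D} r \<partial>lborel) \<partial>lborel)
       = (\<integral>\<^sup>+r. (\<integral>\<^sup>+w. ennreal (cmod (h (polar w \<theta> r))) * indicator {0..D} r \<partial>lborel) \<partial>lborel)" for \<theta>
      by (rule lborel_pair.Fubini') measurable
    then show ?thesis by simp
  qed
  also have "\<dots> = (\<integral>\<^sup>+\<theta>. (\<integral>\<^sup>+r. (\<integral>\<^sup>+w. ennreal (cmod (h w)) \<partial>lborel) * indicator {0..D} r \<partial>lborel) * indicator {0..2*pi} \<theta> \<partial>lborel)"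
  proof -
    have "(\<integral>\<^sup>+w. ennreal (cmod (h (polar w \<theta> r))) * indicator {0..D} r \<partial>lborel) = (\<integral>\<^sup>+w. ennreal (cmod (h w)) \<partial>lborel) * indicator {0..D} r" for \<theta> r
      unfolding polar_def
      using nn_integral_lborel_translate[of "\<lambda>z. ennreal (cmod (h z))"]
      by (subst nn_integral_multc) auto
    then show ?thesis by simp
  qed
  also have "\<dots> = (\<integral>\<^sup>+w. ennreal (cmod (h w)) \<partial>lborel) * ennreal D * ennreal (2 * pi)"
    using D by (simp add: nn_integral_cmult)
  also have "ennreal (1 / pi) * \<dots> = ennreal (1 / pi) * ennreal (2 * pi) * ennreal D * (\<integral>\<^sup>+w. ennreal (cmod (h w)) \<partial>lborel)"
    by (simp add: mult_ac)
  also have "ennreal (1 / pi) * ennreal (2 * pi) = 2" by (simp add: ennreal_mult[symmetric])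
  also have "2 * ennreal D * (\<integral>\<^sup>+w. ennreal (cmod (h w)) \<partial>lborel) = ennreal D * (\<integral>\<^sup>+w. 2 * ennreal (cmod (h w)) \<partial>lborel)"
    by (subst nn_integral_cmult) (auto simp: mult_ac)
  also have "(\<integral>\<^sup>+w. 2 * ennreal (cmod (h w)) \<partial>lborel) = (\<integral>\<^sup>+z. ennreal (cmod (a z + \<i> * b z)) \<partial>lborel)"
  proof (rule nn_integral_cong)
    fix z
    have "2 * ennreal (cmod (h z)) = ennreal (2 * cmod (h z))" by (simp add: ennreal_mult)
    also have "2 * cmod (h z) = cmod (a z + \<i> * b z)" by (simp add: h_def norm_divide)
    finally show "2 * ennreal (cmod (h z)) = ennreal (cmod (a z + \<i> * b z))" .
  qed
  finally show ?thesis .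
qed

section \<open>Compactly supported Sobolev functions on the plane\<close>

text \<open>Since \<open>G\<close> has compact support, it can be tested with smooth functions of arbitrary support: the constant
\<open>1\<close> shows that the gradient has mean zero, and translates of the mollifier differentiate \<open>mollify \<delta> G\<close>.\<close>

locale compact_sobolev =
  fixes G V1 V2 :: "complex \<Rightarrow> complex" and X :: "complex set"
  assumes contG: "continuous_on UNIV G"
    and compactX: "compact X" and suppG: "\<And>z. z \<notin> X \<Longrightarrow> G z = 0"
    and int1: "integrable lborel V1" and int2: "integrable lborel V2"
    and weak1: "\<And>h. flat_generated h \<Longrightarrow>
      (LINT z|lborel. frechet_derivative h (at z) 1 *\<^sub>R G z) = - (LINT z|lborel. h z *\<^sub>R V1 z)"
    and weak2: "\<And>h. flat_generated h \<Longrightarrow>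
      (LINT z|lborel. frechet_derivative h (at z) \<i> *\<^sub>R G z) = - (LINT z|lborel. h z *\<^sub>R V2 z)"
begin

lemma integral_gradient_0: "(LINT z|lborel. V1 z) = 0" "(LINT z|lborel. V2 z) = 0"
proof -
  have "frechet_derivative (\<lambda>z::complex. 1::real) (at z) v = 0" for z v
    by (simp add: frechet_derivative_const)
  then show "(LINT z|lborel. V1 z) = 0" "(LINT z|lborel. V2 z) = 0"
    using weak1[OF flat_generated.const[of 1]] weak2[OF flat_generated.const[of 1]] by simp_all
qed

lemma intG: "integrable lborel G"
  by (rule integrable_continuous_support[OF contG compactX suppG])

lemma mollifier_translate_derivative:
  "frechet_derivative (\<lambda>w. mollifier \<delta> (w - z)) (at w) = frechet_derivative (mollifier \<delta>) (at (w - z))"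
proof -
  have "((\<lambda>w. w - z) has_derivative (\<lambda>v. v)) (at w)" by (auto intro!: derivative_eq_intros)
  from has_derivative_compose[OF this flat_generated_has_derivative[OF flat_generated_mollifier[of \<delta>]]]
  have "((\<lambda>w. mollifier \<delta> (w - z)) has_derivative frechet_derivative (mollifier \<delta>) (at (w - z))) (at w)" .
  from frechet_derivative_at[OF this, symmetric] show ?thesis .
qed

lemma mollify_partial:
  "(LINT w|lborel. frechet_derivative (mollifier \<delta>) (at (w - z)) 1 *\<^sub>R G w) = - mollify \<delta> V1 z"
  "(LINT w|lborel. frechet_derivative (mollifier \<delta>) (at (w - z)) \<i> *\<^sub>R G w) = - mollify \<delta> V2 z"
  using weak1[OF flat_generated_translate[OF flat_generated_mollifier], of \<delta> z]
    weak2[OF flat_generated_translate[OF flat_generated_mollifier], of \<delta> z]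
  by (simp_all add: mollify_def mollifier_translate_derivative)

text \<open>Differentiation under the integral sign puts the derivative on the mollifier, and the weak equations
move it to \<open>G\<close>.\<close>

lemma mollify_G_derivative:
  "(mollify \<delta> G has_derivative (\<lambda>v. Re v *\<^sub>R mollify \<delta> V1 z + Im v *\<^sub>R mollify \<delta> V2 z)) (at z)"
  and continuous_mollify_gradient: "continuous_on UNIV (mollify \<delta> V1)" "continuous_on UNIV (mollify \<delta> V2)"
proof -
  obtain a b where ab: "X \<subseteq> cbox a b"
    using bounded_subset_cbox_symmetric[OF compact_imp_bounded[OF compactX]] by blast
  then have G0: "G w = 0" if "w \<notin> cbox a b" for w using suppG that by blast
  define \<rho>1 where "\<rho>1 y = frechet_derivative (mollifier \<delta>) (at y) 1" for y
  define \<rho>2 where "\<rho>2 y = frechet_derivative (mollifier \<delta>) (at y) \<i>" for y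
  note fg = flat_generated_mollifier[of \<delta>]
  have c: "continuous_on UNIV \<rho>1" "continuous_on UNIV \<rho>2"
    unfolding \<rho>1_def \<rho>2_def by (rule flat_generated_continuous[OF flat_generated_partial[OF fg]])+
  have cc: "continuous_on S (\<lambda>x. \<rho>1 (f x))" "continuous_on S (\<lambda>x. \<rho>2 (f x))" "continuous_on S (\<lambda>x. G (f x))"
    "continuous_on S (\<lambda>x. mollifier \<delta> (f x))"
    if "continuous_on S f" for S and f :: "'x::topological_space \<Rightarrow> complex"
    using that by (auto intro: continuous_on_compose2[OF c(1)] continuous_on_compose2[OF c(2)]
      continuous_on_compose2[OF contG] continuous_on_compose2[OF continuous_mollifier[of UNIV]])
  have lin: "frechet_derivative (mollifier \<delta>) (at y) v = Re v * \<rho>1 y + Im v * \<rho>2 y" for y v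
  proof -
    have l: "linear (frechet_derivative (mollifier \<delta>) (at y))"
      using flat_generated_has_derivative[OF fg] has_derivative_linear by blast
    have "v = Re v *\<^sub>R 1 + Im v *\<^sub>R \<i>" by (simp add: complex_eq_iff)
    then have "frechet_derivative (mollifier \<delta>) (at y) v = frechet_derivative (mollifier \<delta>) (at y) (Re v *\<^sub>R 1 + Im v *\<^sub>R \<i>)"
      by simp
    also have "\<dots> = Re v * \<rho>1 y + Im v * \<rho>2 y"
      using l by (simp add: linear_add linear_cmul \<rho>1_def \<rho>2_def)
    finally show ?thesis .
  qed
  have V1: "mollify \<delta> V1 z = - integral (cbox a b) (\<lambda>w. \<rho>1 (w - z) *\<^sub>R G w)" for z
  proof -
    have "- mollify \<delta> V1 z = (LINT w|lborel. \<rho>1 (w - z) *\<^sub>R G w)"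
      using mollify_partial(1)[of \<delta> z] by (simp add: \<rho>1_def)
    also have "\<dots> = integral (cbox a b) (\<lambda>w. \<rho>1 (w - z) *\<^sub>R G w)"
      by (rule lborel_integral_eq_integral_cbox) (auto intro!: continuous_intros cc simp: G0)
    finally show ?thesis by (metis minus_minus)
  qed
  have V2: "mollify \<delta> V2 z = - integral (cbox a b) (\<lambda>w. \<rho>2 (w - z) *\<^sub>R G w)" for z
  proof -
    have "- mollify \<delta> V2 z = (LINT w|lborel. \<rho>2 (w - z) *\<^sub>R G w)"
      using mollify_partial(2)[of \<delta> z] by (simp add: \<rho>2_def)
    also have "\<dots> = integral (cbox a b) (\<lambda>w. \<rho>2 (w - z) *\<^sub>R G w)"
      by (rule lborel_integral_eq_integral_cbox) (auto intro!: continuous_intros cc simp: G0)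
    finally show ?thesis by (metis minus_minus)
  qed
  show "continuous_on UNIV (mollify \<delta> V1)" "continuous_on UNIV (mollify \<delta> V2)"
    unfolding V1[abs_def] V2[abs_def]
    by (intro continuous_on_minus integral_continuous_on_param;
        auto simp: case_prod_beta intro!: continuous_intros cc)+
  define reB where "reB = Blinfun Re"
  define imB where "imB = Blinfun Im"
  have B: "blinfun_apply reB = Re" "blinfun_apply imB = Im"
    by (simp_all add: reB_def imB_def bounded_linear_Blinfun_apply bounded_linear_Re bounded_linear_Im)
  define F where "F z w = blinfun_scaleR_left (G w) o\<^sub>L (- (\<rho>1 (w - z) *\<^sub>R reB + \<rho>2 (w - z) *\<^sub>R imB))" for z w
  have Fv: "blinfun_apply (F z w) v = - (Re v *\<^sub>R (\<rho>1 (w - z) *\<^sub>R G w) + Im v *\<^sub>R (\<rho>2 (w - z) *\<^sub>R G w))" for z w v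
    by (simp add: F_def B blinfun.bilinear_simps scaleR_add_left algebra_simps)
  have cF: "continuous_on S (\<lambda>x. F (f x) (g x))" if "continuous_on S f" "continuous_on S g"
    for S and f g :: "'x::topological_space \<Rightarrow> complex"
    unfolding F_def
    by (intro bounded_bilinear.continuous_on[OF bounded_bilinear_blinfun_compose]
        bounded_linear.continuous_on[OF bounded_linear_blinfun_scaleR_left] cc continuous_intros that)
  have "((\<lambda>z. integral (cbox a b) (\<lambda>w. mollifier \<delta> (w - z) *\<^sub>R G w)) has_derivative integral (cbox a b) (F z)) (at z within UNIV)"
  proof (rule leibniz_rule)
    fix x w :: complex
    have "((\<lambda>x. w - x) has_derivative (\<lambda>v. - v)) (at x)" by (auto intro!: derivative_eq_intros)
    from has_derivative_compose[OF this flat_generated_has_derivative[OF fg]]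
    have "((\<lambda>x. mollifier \<delta> (w - x)) has_derivative (\<lambda>v. frechet_derivative (mollifier \<delta>) (at (w - x)) (- v))) (at x)" .
    from has_derivative_scaleR_left[OF this, of "G w"]
    show "((\<lambda>x. mollifier \<delta> (w - x) *\<^sub>R G w) has_derivative blinfun_apply (F x w)) (at x within UNIV)"
      by (simp add: lin Fv[abs_def] scaleR_add_left scaleR_diff_left algebra_simps)
  next
    show "(\<lambda>w. mollifier \<delta> (w - x) *\<^sub>R G w) integrable_on cbox a b" for x
      by (intro integrable_continuous continuous_intros cc)
    show "continuous_on (UNIV \<times> cbox a b) (\<lambda>(x, t). F x t)"
      unfolding case_prod_beta by (intro cF continuous_intros)
  qed auto
  moreover have "integral (cbox a b) (\<lambda>w. mollifier \<delta> (w - z) *\<^sub>R G w) = mollify \<delta> G z" for z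
    unfolding mollify_def
    by (rule lborel_integral_eq_integral_cbox[symmetric]) (auto intro!: continuous_intros cc simp: G0)
  moreover have "blinfun_apply (integral (cbox a b) (F z)) v = Re v *\<^sub>R mollify \<delta> V1 z + Im v *\<^sub>R mollify \<delta> V2 z" for v
  proof -
    have "F z integrable_on cbox a b" by (intro integrable_continuous cF continuous_intros)
    then have "blinfun_apply (integral (cbox a b) (F z)) v = integral (cbox a b) (\<lambda>w. blinfun_apply (F z w) v)"
      using integral_linear[OF _ blinfun.bounded_linear_left, of "F z" "cbox a b" v] by (simp add: o_def)
    also have "\<dots> = - (integral (cbox a b) (\<lambda>w. Re v *\<^sub>R (\<rho>1 (w - z) *\<^sub>R G w)) + integral (cbox a b) (\<lambda>w. Im v *\<^sub>R (\<rho>2 (w - z) *\<^sub>R G w)))"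
      unfolding Fv integral_neg
      by (subst Henstock_Kurzweil_Integration.integral_add)
         (auto intro!: integrable_continuous continuous_intros cc)
    also have "\<dots> = Re v *\<^sub>R mollify \<delta> V1 z + Im v *\<^sub>R mollify \<delta> V2 z"
      unfolding V1 V2 by (simp only: integral_cmul) simp
    finally show ?thesis .
  qed
  ultimately show "(mollify \<delta> G has_derivative (\<lambda>v. Re v *\<^sub>R mollify \<delta> V1 z + Im v *\<^sub>R mollify \<delta> V2 z)) (at z)"
    by (simp add: fun_eq_iff has_derivative_eq_rhs)
qed

text \<open>Apply the smooth estimate to mollifications of \<open>G\<close> with distance \<open>2 * R + 1\<close>: a point that far from a
point of \<open>X\<close> has modulus at least \<open>R + 1\<close>, where every mollification at scale at most \<open>1\<close> vanishes.
Mollification does not increase the right-hand side.\<close>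

lemma L1_dbar_bound:
  assumes R: "X \<subseteq> cball 0 R" "R > 0"
  shows "(\<integral>\<^sup>+z. ennreal (cmod (G z)) \<partial>lborel)
     \<le> ennreal (2 * R + 1) * (\<integral>\<^sup>+z. ennreal (cmod (V1 z + \<i> * V2 z)) \<partial>lborel)"
proof (rule ennreal_le_epsilon)
  fix \<eta> :: real assume \<eta>: "\<eta> > 0"
  have Xb [measurable]: "X \<in> sets borel" using compactX by (simp add: borel_compact)
  have [measurable]: "G \<in> borel_measurable borel" using contG by (rule borel_measurable_continuous_onI)
  have intV: "integrable lborel (\<lambda>z. V1 z + \<i> * V2 z)" using int1 int2 by auto
  obtain d where d: "d > 0" and d': "\<And>\<delta>. 0 < \<delta> \<Longrightarrow> \<delta> \<le> d \<Longrightarrow>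
        (\<integral>\<^sup>+z. ennreal (cmod (mollify \<delta> G z - G z)) \<partial>lborel) \<le> ennreal \<eta>"
    using L1_mollify_tendsto[OF intG \<eta>] by blast
  define \<delta> where "\<delta> = min d 1"
  have \<delta>: "0 < \<delta>" "\<delta> \<le> d" "\<delta> \<le> 1" using d by (auto simp: \<delta>_def)
  have [measurable]: "mollify \<delta> G \<in> borel_measurable borel" by measurable
  have vanish: "mollify \<delta> G z = 0" if "cmod z \<ge> R + 1" for z
  proof -
    have z0: "mollifier \<delta> (w - z) *\<^sub>R G w = 0" for w
    proof (cases "w \<in> X")
      case True
      then have "cmod w \<le> R" using R by auto
      then have "cmod (w - z) \<ge> \<delta>" using that \<delta> norm_triangle_ineq2[of z w] by (simp add: norm_minus_commute)
      then show ?thesis using \<delta> by (simp add: mollifier_outside)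
    qed (simp add: suppG)
    show ?thesis unfolding mollify_def z0 by simp
  qed
  have lin: "mollify \<delta> V1 z + \<i> * mollify \<delta> V2 z = mollify \<delta> (\<lambda>z. V1 z + \<i> * V2 z) z" for z
  proof -
    have "mollify \<delta> (\<lambda>z. V1 z + \<i> * V2 z) z = (LINT w|lborel. mollifier \<delta> (w - z) *\<^sub>R V1 w + \<i> * (mollifier \<delta> (w - z) *\<^sub>R V2 w))"
      by (simp add: mollify_def scaleR_add_right)
    also have "\<dots> = mollify \<delta> V1 z + \<i> * mollify \<delta> V2 z"
      using integrable_mollifier_mult(1)[OF \<delta>(1) int1, of z] integrable_mollifier_mult(1)[OF \<delta>(1) int2, of z]
      by (subst Bochner_Integration.integral_add) (simp_all add: mollify_def del: mult_scaleR_right)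
    finally show ?thesis by simp
  qed
  have "(\<integral>\<^sup>+z. ennreal (cmod (G z)) \<partial>lborel) \<le>
      (\<integral>\<^sup>+z. ennreal (cmod (mollify \<delta> G z)) * indicator X z + ennreal (cmod (mollify \<delta> G z - G z)) \<partial>lborel)"
  proof (rule nn_integral_mono)
    fix z
    have "cmod (G z) \<le> cmod (mollify \<delta> G z) + cmod (mollify \<delta> G z - G z)"
      using norm_triangle_ineq4[of "mollify \<delta> G z" "mollify \<delta> G z - G z"] by simp
    then show "ennreal (cmod (G z)) \<le> ennreal (cmod (mollify \<delta> G z)) * indicator X z + ennreal (cmod (mollify \<delta> G z - G z))"
      by (cases "z \<in> X") (auto simp: suppG ennreal_plus[symmetric] simp del: ennreal_plus intro: ennreal_leI)
  qed
  also have "\<dots> = (\<integral>\<^sup>+z. ennreal (cmod (mollify \<delta> G z)) * indicator X z \<partial>lborel) + (\<integral>\<^sup>+z. ennreal (cmod (mollify \<delta> G z - G z)) \<partial>lborel)"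
    by (intro nn_integral_add) measurable
  also have "\<dots> \<le> ennreal (2 * R + 1) * (\<integral>\<^sup>+z. ennreal (cmod (mollify \<delta> V1 z + \<i> * mollify \<delta> V2 z)) \<partial>lborel) + ennreal \<eta>"
  proof (intro add_mono d' \<delta> L1_dbar_bound_smooth[OF mollify_G_derivative continuous_mollify_gradient _ _ Xb])
    fix w \<theta> assume "w \<in> X"
    then have "cmod w \<le> R" using R by auto
    moreover have "cmod (polar w \<theta> (2 * R + 1)) \<ge> (2 * R + 1) - cmod w"
    proof -
      let ?e = "complex_of_real (2*R+1) * (complex_of_real (cos \<theta>) + \<i> * complex_of_real (sin \<theta>))"
      have "cmod ?e = 2 * R + 1"
        unfolding norm_mult cmod_unit norm_of_real using R(2) by simp
      then show ?thesis using norm_diff_ineq[of ?e w] by (simp only: polar_def add.commute)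
    qed
    ultimately show "mollify \<delta> G (polar w \<theta> (2 * R + 1)) = 0" by (intro vanish) linarith
  qed (use R in auto)
  also have "(\<integral>\<^sup>+z. ennreal (cmod (mollify \<delta> V1 z + \<i> * mollify \<delta> V2 z)) \<partial>lborel)
      \<le> (\<integral>\<^sup>+z. ennreal (cmod (V1 z + \<i> * V2 z)) \<partial>lborel)"
    unfolding lin by (rule nn_integral_mollify_le[OF \<delta>(1) intV])
  finally show "(\<integral>\<^sup>+z. ennreal (cmod (G z)) \<partial>lborel)
     \<le> ennreal (2 * R + 1) * (\<integral>\<^sup>+z. ennreal (cmod (V1 z + \<i> * V2 z)) \<partial>lborel) + ennreal \<eta>"
    by (simp add: mult_left_mono add_right_mono)
qed

end

section \<open>Differentiability on large pieces\<close>

text \<open>The points where the maximal function of \<open>F\<close> exceeds \<open>\<Lambda> / pi\<close>.\<close>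

definition large_mean_set :: "(complex \<Rightarrow> ennreal) \<Rightarrow> real \<Rightarrow> complex set" where
  "large_mean_set F \<Lambda> = {x. \<exists>r>0. ennreal (\<Lambda> * r\<^sup>2) < (\<integral>\<^sup>+z. F z * indicator (cball x r) z \<partial>lborel)}"

lemma emeasure_cball_complex: "r \<ge> 0 \<Longrightarrow> emeasure lborel (cball (x::complex) r) = ennreal (pi * r\<^sup>2)"
  by (simp add: emeasure_cball unit_ball_vol_2)

lemma open_large_mean_set:
  assumes L: "\<Lambda> > 0" and fin: "(\<integral>\<^sup>+z. F z \<partial>lborel) < \<infinity>"
  shows "open (large_mean_set F \<Lambda>)"
  unfolding open_dist
proof
  fix x assume "x \<in> large_mean_set F \<Lambda>"
  then obtain r where r: "r > 0" "ennreal (\<Lambda> * r\<^sup>2) < (\<integral>\<^sup>+z. F z * indicator (cball x r) z \<partial>lborel)"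
    by (auto simp: large_mean_set_def)
  have "(\<integral>\<^sup>+z. F z * indicator (cball x r) z \<partial>lborel) \<le> (\<integral>\<^sup>+z. F z \<partial>lborel)"
    by (intro nn_integral_mono) (auto simp: indicator_def)
  then have "(\<integral>\<^sup>+z. F z * indicator (cball x r) z \<partial>lborel) < top" using fin by (simp add: le_less_trans)
  then obtain i where i: "(\<integral>\<^sup>+z. F z * indicator (cball x r) z \<partial>lborel) = ennreal i" "i \<ge> 0"
    by (metis ennreal_cases less_irrefl)
  then have li: "\<Lambda> * r\<^sup>2 < i" using r L by (simp add: ennreal_less_iff)
  define r' where "r' = sqrt ((r\<^sup>2 + i / \<Lambda>) / 2)"
  have a: "r\<^sup>2 < i / \<Lambda>" using li L by (simp add: field_simps)
  have r'2: "r'\<^sup>2 = (r\<^sup>2 + i / \<Lambda>) / 2" unfolding r'_def using a by (intro real_sqrt_pow2) (smt (verit) zero_le_power2 divide_nonneg_pos)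
  have "r = sqrt (r\<^sup>2)" using r by simp
  also have "\<dots> < r'" unfolding r'_def using a by (intro real_sqrt_less_mono) simp
  finally have rr: "r < r'" .
  have "r'\<^sup>2 < i / \<Lambda>" using r'2 a by simp
  then have li': "\<Lambda> * r'\<^sup>2 < i" using L by (simp add: field_simps)
  show "\<exists>e>0. \<forall>y. dist y x < e \<longrightarrow> y \<in> large_mean_set F \<Lambda>"
  proof (intro exI[of _ "r' - r"] conjI allI impI)
    fix y assume y: "dist y x < r' - r"
    have "cball x r \<subseteq> cball y r'"
    proof
      fix z assume "z \<in> cball x r"
      then show "z \<in> cball y r'" using y dist_triangle[of y z x] by simp
    qed
    then have "ennreal i \<le> (\<integral>\<^sup>+z. F z * indicator (cball y r') z \<partial>lborel)"
      unfolding i(1)[symmetric] by (intro nn_integral_mono mult_left_mono) (auto simp: indicator_def)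
    moreover have "ennreal (\<Lambda> * r'\<^sup>2) < ennreal i" using li' i(2) L by (simp add: ennreal_less_iff)
    ultimately have "ennreal (\<Lambda> * r'\<^sup>2) < (\<integral>\<^sup>+z. F z * indicator (cball y r') z \<partial>lborel)" by (rule less_le_trans[rotated])
    then show "y \<in> large_mean_set F \<Lambda>"
      using rr r(1) unfolding large_mean_set_def by (intro CollectI exI[of _ r']) auto
  qed (use rr in simp)
qed

text \<open>The weak type inequality for the maximal function, by Vitali's covering lemma: the discs that are
selected are disjoint, and enlarging them five times, their area \<open>25\<close> times, covers the set.\<close>

lemma emeasure_large_mean_set:
  assumes L: "\<Lambda> > 0" and fin: "(\<integral>\<^sup>+z. F z \<partial>lborel) < \<infinity>" and F [measurable]: "F \<in> borel_measurable borel"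
  shows "emeasure lborel (large_mean_set F \<Lambda>) \<le> ennreal (25 * pi / \<Lambda>) * (\<integral>\<^sup>+z. F z \<partial>lborel)"
proof -
  let ?B = "large_mean_set F \<Lambda>"
  obtain T where T: "(\<integral>\<^sup>+z. F z \<partial>lborel) = ennreal T" "T \<ge> 0"
    using fin by (metis ennreal_cases infinity_ennreal_def less_irrefl)
  have "\<forall>x\<in>?B. \<exists>r>0. ennreal (\<Lambda> * r\<^sup>2) < (\<integral>\<^sup>+z. F z * indicator (cball x r) z \<partial>lborel)"
    by (auto simp: large_mean_set_def)
  then obtain r where r: "\<And>x. x \<in> ?B \<Longrightarrow> r x > 0"
      "\<And>x. x \<in> ?B \<Longrightarrow> ennreal (\<Lambda> * (r x)\<^sup>2) < (\<integral>\<^sup>+z. F z * indicator (cball x (r x)) z \<partial>lborel)"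
    by metis
  have rb: "0 < r x \<and> r x \<le> sqrt (T / \<Lambda>)" if "x \<in> ?B" for x
  proof -
    have "(\<integral>\<^sup>+z. F z * indicator (cball x (r x)) z \<partial>lborel) \<le> ennreal T"
      unfolding T(1)[symmetric] by (intro nn_integral_mono) (auto simp: indicator_def)
    then have "ennreal (\<Lambda> * (r x)\<^sup>2) \<le> ennreal T" using r(2)[OF that] by simp
    then have "\<Lambda> * (r x)\<^sup>2 \<le> T" using T(2) by (simp add: ennreal_le_iff)
    then have "(r x)\<^sup>2 \<le> T / \<Lambda>" using L by (simp add: field_simps)
    then show ?thesis using r(1)[OF that] by (simp add: real_le_rsqrt)
  qed
  have "?B \<subseteq> (\<Union>x\<in>?B. cball x (r x))" using r(1) by force
  then obtain C where C: "countable C" "C \<subseteq> ?B"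
    "pairwise (\<lambda>i j. disjnt (cball i (r i)) (cball j (r j))) C" "?B \<subseteq> (\<Union>i\<in>C. cball i (5 * r i))"
    by (rule Vitali_covering_lemma_cballs[OF _ rb])
  define I where "I = to_nat_on C ` C"
  define c where "c = from_nat_into C"
  have cI: "c i \<in> C" if "i \<in> I" for i using that C(1) by (auto simp: I_def c_def)
  have ceq: "i = j" if "i \<in> I" "j \<in> I" "c i = c j" for i j
    using that C(1) by (auto simp: I_def c_def)
  have Cc: "C = c ` I" using C(1) by (force simp: I_def c_def)
  define A where "A i = (if i \<in> I then cball (c i) (5 * r (c i)) else {})" for i
  define D where "D i = (if i \<in> I then cball (c i) (r (c i)) else {})" for i
  have [measurable]: "A i \<in> sets borel" "D i \<in> sets borel" for i by (auto simp: A_def D_def)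
  have BA: "?B \<subseteq> (\<Union>i. A i)" using C(4) unfolding Cc A_def by fastforce
  have disj: "disjoint_family D"
    unfolding disjoint_family_on_def
  proof (intro ballI impI)
    fix i j :: nat assume ij: "i \<noteq> j"
    show "D i \<inter> D j = {}"
    proof (cases "i \<in> I \<and> j \<in> I")
      case True
      then have "c i \<noteq> c j" "c i \<in> C" "c j \<in> C" using ceq ij cI by auto
      then show ?thesis using C(3) True by (auto simp: pairwise_def disjnt_def D_def)
    qed (auto simp: D_def)
  qed
  have AD: "emeasure lborel (A i) \<le> ennreal (25 * pi / \<Lambda>) * (\<integral>\<^sup>+z. F z * indicator (D i) z \<partial>lborel)" for i
  proof (cases "i \<in> I")
    case True
    then have ci: "c i \<in> ?B" using cI C(2) by blast
    have "emeasure lborel (A i) = ennreal (pi * (5 * r (c i))\<^sup>2)"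
      using True r(1)[OF ci] unfolding A_def by (simp add: emeasure_cball_complex)
    also have "pi * (5 * r (c i))\<^sup>2 = (25 * pi / \<Lambda>) * (\<Lambda> * (r (c i))\<^sup>2)"
      using L by (simp add: power_mult_distrib)
    also have "ennreal \<dots> = ennreal (25 * pi / \<Lambda>) * ennreal (\<Lambda> * (r (c i))\<^sup>2)"
      using L by (intro ennreal_mult) auto
    also have "\<dots> \<le> ennreal (25 * pi / \<Lambda>) * (\<integral>\<^sup>+z. F z * indicator (D i) z \<partial>lborel)"
      using r(2)[OF ci] True by (intro mult_left_mono) (auto simp: D_def)
    finally show ?thesis .
  qed (simp add: A_def)
  have "emeasure lborel ?B \<le> emeasure lborel (\<Union>i. A i)" using BA by (intro emeasure_mono) auto
  also have "\<dots> \<le> (\<Sum>i. emeasure lborel (A i))" by (intro emeasure_subadditive_countably) auto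
  also have "\<dots> \<le> (\<Sum>i. ennreal (25 * pi / \<Lambda>) * (\<integral>\<^sup>+z. F z * indicator (D i) z \<partial>lborel))"
    by (intro suminf_le AD) auto
  also have "\<dots> = ennreal (25 * pi / \<Lambda>) * (\<Sum>i. (\<integral>\<^sup>+z. F z * indicator (D i) z \<partial>lborel))"
    by simp
  also have "(\<Sum>i. (\<integral>\<^sup>+z. F z * indicator (D i) z \<partial>lborel)) = (\<Sum>i. emeasure (density lborel F) (D i))"
    by (simp add: emeasure_density)
  also have "\<dots> = emeasure (density lborel F) (\<Union>i. D i)"
    by (intro suminf_emeasure disj) auto
  also have "\<dots> \<le> emeasure (density lborel F) UNIV" by (intro emeasure_mono) auto
  also have "\<dots> = (\<integral>\<^sup>+z. F z \<partial>lborel)" by (subst emeasure_density) auto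
  finally show ?thesis by (simp add: mult_left_mono)
qed

lemma nn_integral_affine_complex:
  assumes [measurable]: "f \<in> borel_measurable borel" and t: "t \<noteq> 0"
  shows "(\<integral>\<^sup>+z. f z \<partial>lborel) = ennreal (t\<^sup>2) * (\<integral>\<^sup>+w. f (x + t *\<^sub>R w) \<partial>(lborel :: complex measure))"
proof -
  have "(\<integral>\<^sup>+z. f z \<partial>lborel) = (\<integral>\<^sup>+z. f z \<partial>density (distr lborel borel (\<lambda>w. x + t *\<^sub>R w)) (\<lambda>_. \<bar>t\<bar> ^ DIM(complex)))"
    using lborel_affine[OF t, of x] by simp
  also have "\<dots> = (\<integral>\<^sup>+w. ennreal (t\<^sup>2) * f (x + t *\<^sub>R w) \<partial>lborel)"
    by (simp add: nn_integral_density nn_integral_distr)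
  also have "\<dots> = ennreal (t\<^sup>2) * (\<integral>\<^sup>+w. f (x + t *\<^sub>R w) \<partial>lborel)"
    by (rule nn_integral_cmult) measurable
  finally show ?thesis .
qed

text \<open>Integrate the gradient along the segments from \<open>x\<close> to the points of the disc. For a fixed proportion \<open>t\<close>
the points of these segments fill the disc of radius \<open>t * R\<close>, over which the integral of \<open>F\<close> is at most
\<open>\<Lambda> * (t * R)\<^sup>2\<close>; the factor \<open>t\<^sup>2\<close> cancels against the Jacobian of the scaling.\<close>

lemma mean_oscillation_le:
  fixes u a b :: "complex \<Rightarrow> complex"
  assumes der: "\<And>z. (u has_derivative (\<lambda>v. Re v *\<^sub>R a z + Im v *\<^sub>R b z)) (at z)"
    and ca: "continuous_on UNIV a" and cb: "continuous_on UNIV b"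
    and F [measurable]: "F \<in> borel_measurable borel" and le: "\<And>z. ennreal (cmod (a z) + cmod (b z)) \<le> F z"
    and x: "x \<notin> large_mean_set F \<Lambda>" and R: "R > 0" and L: "\<Lambda> > 0"
  shows "(\<integral>\<^sup>+z. ennreal (cmod (u z - u x)) * indicator (cball x R) z \<partial>lborel) \<le> ennreal (\<Lambda> * R ^ 3)"
proof -
  have [measurable]: "cball c s \<in> sets borel" for c :: complex and s by simp
  have cu: "continuous_on UNIV u"
    using der by (auto intro!: continuous_at_imp_continuous_on has_derivative_continuous)
  note [measurable] = borel_measurable_continuous_onI[OF cu]
  have mean: "(\<integral>\<^sup>+z. F z * indicator (cball x r) z \<partial>lborel) \<le> ennreal (\<Lambda> * r\<^sup>2)" if "r > 0" for r
    using x[unfolded large_mean_set_def] that by (simp add: not_less) (meson not_le)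
  have seg: "ennreal (cmod (u (x + w) - u x)) \<le> ennreal (cmod w) * (\<integral>\<^sup>+t. F (x + t *\<^sub>R w) * indicator {0..1} t \<partial>lborel)" for w
  proof -
    define q where "q t = cmod (a (x + t *\<^sub>R w)) + cmod (b (x + t *\<^sub>R w))" for t
    have cc: "continuous_on S (\<lambda>t. a (x + t *\<^sub>R w))" "continuous_on S (\<lambda>t. b (x + t *\<^sub>R w))" for S
      by (rule continuous_on_compose2[OF ca] continuous_on_compose2[OF cb], intro continuous_intros, simp)+
    have cq: "continuous_on S q" for S unfolding q_def by (intro continuous_intros cc)
    let ?d = "\<lambda>t. Re w *\<^sub>R a (x + t *\<^sub>R w) + Im w *\<^sub>R b (x + t *\<^sub>R w)"
    have "((\<lambda>t. u (x + t *\<^sub>R w)) has_vector_derivative ?d t) (at t within {0..1})" for t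
    proof -
      have "((\<lambda>t. x + t *\<^sub>R w) has_derivative (\<lambda>s. s *\<^sub>R w)) (at t)" by (auto intro!: derivative_eq_intros)
      from has_derivative_compose[OF this der]
      have "((\<lambda>t. u (x + t *\<^sub>R w)) has_derivative (\<lambda>s. s *\<^sub>R ?d t)) (at t)"
        by (rule has_derivative_eq_rhs) (simp add: fun_eq_iff scaleR_add_right)
      then show ?thesis unfolding has_vector_derivative_def by (rule has_derivative_at_withinI)
    qed
    then have "(?d has_integral u (x + 1 *\<^sub>R w) - u (x + 0 *\<^sub>R w)) {0..1}"
      by (intro fundamental_theorem_of_calculus) auto
    then have "u (x + w) - u x = integral {0..1} ?d" by (simp add: integral_unique)
    also have "cmod \<dots> \<le> integral {0..1} (\<lambda>t. cmod w * q t)"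
    proof (rule integral_norm_bound_integral)
      fix t :: real
      have "cmod (?d t) \<le> \<bar>Re w\<bar> * cmod (a (x + t *\<^sub>R w)) + \<bar>Im w\<bar> * cmod (b (x + t *\<^sub>R w))"
        using norm_triangle_ineq[of "Re w *\<^sub>R a (x + t *\<^sub>R w)" "Im w *\<^sub>R b (x + t *\<^sub>R w)"] by simp
      also have "\<dots> \<le> cmod w * cmod (a (x + t *\<^sub>R w)) + cmod w * cmod (b (x + t *\<^sub>R w))"
        by (intro add_mono mult_right_mono abs_Re_le_cmod abs_Im_le_cmod) auto
      finally show "cmod (?d t) \<le> cmod w * q t" by (simp add: q_def distrib_left)
    qed (auto intro!: integrable_continuous_interval continuous_intros cc cq)
    also have "\<dots> = cmod w * integral {0..1} q" by simp
    finally have "ennreal (cmod (u (x + w) - u x)) \<le> ennreal (cmod w) * ennreal (integral {0..1} q)"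
      by (simp add: ennreal_mult'[symmetric] ennreal_leI)
    also have "ennreal (integral {0..1} q) = (\<integral>\<^sup>+t. ennreal (q t) * indicator {0..1} t \<partial>lborel)"
      by (rule nn_integral_continuous_Icc[symmetric, OF cq]) (simp add: q_def)
    also have "\<dots> \<le> (\<integral>\<^sup>+t. F (x + t *\<^sub>R w) * indicator {0..1} t \<partial>lborel)"
      unfolding q_def by (intro nn_integral_mono mult_right_mono le) auto
    finally show ?thesis by (simp add: mult_left_mono)
  qed
  have inner: "(\<integral>\<^sup>+w. F (x + t *\<^sub>R w) * indicator (cball 0 R) w \<partial>lborel) \<le> ennreal (\<Lambda> * R\<^sup>2)" if t: "t > 0" for t
  proof -
    have "ennreal (t\<^sup>2) * (\<integral>\<^sup>+w. F (x + t *\<^sub>R w) * indicator (cball 0 R) w \<partial>lborel)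
       = ennreal (t\<^sup>2) * (\<integral>\<^sup>+w. F (x + t *\<^sub>R w) * indicator (cball x (t * R)) (x + t *\<^sub>R w) \<partial>lborel)"
    proof -
      have "indicator (cball 0 R) w = (indicator (cball x (t * R)) (x + t *\<^sub>R w) :: ennreal)" for w
        using t by (auto simp: indicator_def dist_norm)
      then show ?thesis by simp
    qed
    also have "\<dots> = (\<integral>\<^sup>+z. F z * indicator (cball x (t * R)) z \<partial>lborel)"
    proof (rule nn_integral_affine_complex[symmetric])
      show "(\<lambda>z. F z * indicator (cball x (t * R)) z) \<in> borel_measurable borel" by measurable
    qed (use t in simp)
    also have "\<dots> \<le> ennreal (\<Lambda> * (t * R)\<^sup>2)" using t R by (intro mean) simp
    also have "\<Lambda> * (t * R)\<^sup>2 = t\<^sup>2 * (\<Lambda> * R\<^sup>2)" by (simp add: power_mult_distrib)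
    also have "ennreal \<dots> = ennreal (t\<^sup>2) * ennreal (\<Lambda> * R\<^sup>2)" using L by (intro ennreal_mult) auto
    finally show ?thesis using t by (subst (asm) ennreal_mult_le_mult_iff) auto
  qed
  have "(\<integral>\<^sup>+z. ennreal (cmod (u z - u x)) * indicator (cball x R) z \<partial>lborel)
     = (\<integral>\<^sup>+w. ennreal (cmod (u (w + x) - u x)) * indicator (cball x R) (w + x) \<partial>lborel)"
    by (rule nn_integral_lborel_translate[symmetric]) measurable
  also have "\<dots> \<le> (\<integral>\<^sup>+w. ennreal R * (\<integral>\<^sup>+t. F (x + t *\<^sub>R w) * indicator {0..1} t * indicator (cball 0 R) w \<partial>lborel) \<partial>lborel)"
  proof (rule nn_integral_mono)
    fix w :: complex
    show "ennreal (cmod (u (w + x) - u x)) * indicator (cball x R) (w + x) \<le>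
       ennreal R * (\<integral>\<^sup>+t. F (x + t *\<^sub>R w) * indicator {0..1} t * indicator (cball 0 R) w \<partial>lborel)"
    proof (cases "cmod w \<le> R")
      case True
      have "ennreal (cmod (u (x + w) - u x)) \<le> ennreal R * (\<integral>\<^sup>+t. F (x + t *\<^sub>R w) * indicator {0..1} t \<partial>lborel)"
        using True by (intro order_trans[OF seg] mult_right_mono ennreal_leI) auto
      then show ?thesis using True by (simp add: add.commute dist_norm)
    next
      case False
      then have "w + x \<notin> cball x R" by (simp add: dist_norm)
      then show ?thesis by simp
    qed
  qed
  also have "\<dots> = ennreal R * (\<integral>\<^sup>+w. (\<integral>\<^sup>+t. F (x + t *\<^sub>R w) * indicator {0..1} t * indicator (cball 0 R) w \<partial>lborel) \<partial>lborel)"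
    by (rule nn_integral_cmult) measurable
  also have "(\<integral>\<^sup>+w. (\<integral>\<^sup>+t. F (x + t *\<^sub>R w) * indicator {0..1} t * indicator (cball 0 R) w \<partial>lborel) \<partial>lborel)
     = (\<integral>\<^sup>+t. (\<integral>\<^sup>+w. F (x + t *\<^sub>R w) * indicator {0..1} t * indicator (cball 0 R) w \<partial>lborel) \<partial>lborel)"
    by (rule lborel_pair.Fubini') measurable
  also have "\<dots> \<le> (\<integral>\<^sup>+t. ennreal (\<Lambda> * R\<^sup>2) * indicator {0..1} (t::real) \<partial>lborel)"
  proof (rule nn_integral_mono_AE)
    have "AE t in lborel. t \<noteq> (0::real)" by (rule AE_lborel_singleton)
    then show "AE t in lborel. (\<integral>\<^sup>+w. F (x + t *\<^sub>R w) * indicator {0..1} t * indicator (cball 0 R) w \<partial>lborel) \<le> ennreal (\<Lambda> * R\<^sup>2) * indicator {0..1} t"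
    proof eventually_elim
      case (elim t)
      show ?case
      proof (cases "t \<in> {0..1}")
        case True
        then show ?thesis using elim inner[of t] by simp
      qed simp
    qed
  qed
  also have "(\<integral>\<^sup>+t. ennreal (\<Lambda> * R\<^sup>2) * indicator {0..1} t \<partial>(lborel :: real measure)) = ennreal (\<Lambda> * R\<^sup>2)"
    by (simp add: nn_integral_cmult)
  also have "ennreal R * ennreal (\<Lambda> * R\<^sup>2) = ennreal (\<Lambda> * R ^ 3)"
    using R L by (simp add: ennreal_mult[symmetric] power3_eq_cube power2_eq_square mult_ac)
  finally show ?thesis by (simp add: mult_left_mono)
qed

text \<open>Compare both values with the values of \<open>u\<close> on the disc around the midpoint with radius \<open>R / 2\<close>, where
\<open>R\<close> is the distance of \<open>x\<close> and \<open>y\<close>; it lies in the discs of radius \<open>R\<close> around \<open>x\<close> and around \<open>y\<close>.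
The constant is \<open>8 / pi < 3\<close>.\<close>

lemma lipschitz_off_large_mean_set:
  fixes u a b :: "complex \<Rightarrow> complex"
  assumes der: "\<And>z. (u has_derivative (\<lambda>v. Re v *\<^sub>R a z + Im v *\<^sub>R b z)) (at z)"
    and ca: "continuous_on UNIV a" and cb: "continuous_on UNIV b"
    and F: "F \<in> borel_measurable borel" and le: "\<And>z. ennreal (cmod (a z) + cmod (b z)) \<le> F z"
    and x: "x \<notin> large_mean_set F \<Lambda>" and y: "y \<notin> large_mean_set F \<Lambda>" and L: "\<Lambda> > 0"
  shows "cmod (u x - u y) \<le> 3 * \<Lambda> * cmod (x - y)"
proof (cases "x = y")
  case False
  define R where "R = cmod (x - y)"
  have R: "R > 0" using False by (simp add: R_def)
  have [measurable]: "cball c s \<in> sets borel" for c :: complex and s by simp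
  have cu: "continuous_on UNIV u"
    using der by (auto intro!: continuous_at_imp_continuous_on has_derivative_continuous)
  note [measurable] = borel_measurable_continuous_onI[OF cu]
  define m where "m = (x + y) / 2"
  have sub: "cball m (R / 2) \<subseteq> cball x R" "cball m (R / 2) \<subseteq> cball y R"
  proof -
    have d: "dist x m = R / 2" "dist y m = R / 2"
    proof -
      have e: "x - m = (x - y) / 2" "y - m = (y - x) / 2" by (simp_all add: m_def field_simps)
      show "dist x m = R / 2" unfolding dist_norm e by (simp add: R_def norm_divide)
      show "dist y m = R / 2" unfolding dist_norm e by (simp add: R_def norm_divide norm_minus_commute)
    qed
    show "cball m (R / 2) \<subseteq> cball x R"
    proof
      fix z assume "z \<in> cball m (R / 2)"
      then show "z \<in> cball x R" using d(1) dist_triangle[of x z m] by simp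
    qed
    show "cball m (R / 2) \<subseteq> cball y R"
    proof
      fix z assume "z \<in> cball m (R / 2)"
      then show "z \<in> cball y R" using d(2) dist_triangle[of y z m] by simp
    qed
  qed
  have "ennreal (cmod (u x - u y) * (pi * (R/2)\<^sup>2)) = (\<integral>\<^sup>+z. ennreal (cmod (u x - u y)) * indicator (cball m (R/2)) z \<partial>lborel)"
    using R by (subst nn_integral_cmult_indicator) (auto simp: emeasure_cball_complex ennreal_mult)
  also have "\<dots> \<le> (\<integral>\<^sup>+z. ennreal (cmod (u z - u x)) * indicator (cball x R) z + ennreal (cmod (u z - u y)) * indicator (cball y R) z \<partial>lborel)"
  proof (rule nn_integral_mono)
    fix z
    have "cmod (u x - u y) \<le> cmod (u z - u x) + cmod (u z - u y)"
      using norm_triangle_ineq4[of "u z - u y" "u z - u x"] by simp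
    then have "ennreal (cmod (u x - u y)) \<le> ennreal (cmod (u z - u x)) + ennreal (cmod (u z - u y))"
      by (simp add: ennreal_plus[symmetric] ennreal_leI del: ennreal_plus)
    then show "ennreal (cmod (u x - u y)) * indicator (cball m (R/2)) z \<le>
        ennreal (cmod (u z - u x)) * indicator (cball x R) z + ennreal (cmod (u z - u y)) * indicator (cball y R) z"
      using sub by (cases "z \<in> cball m (R/2)") (auto simp: subset_iff simp del: mem_cball)
  qed
  also have "\<dots> = (\<integral>\<^sup>+z. ennreal (cmod (u z - u x)) * indicator (cball x R) z \<partial>lborel) + (\<integral>\<^sup>+z. ennreal (cmod (u z - u y)) * indicator (cball y R) z \<partial>lborel)"
    by (rule nn_integral_add) measurable
  also have "\<dots> \<le> ennreal (\<Lambda> * R ^ 3) + ennreal (\<Lambda> * R ^ 3)"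
    by (intro add_mono mean_oscillation_le[OF der ca cb F le _ R L] x y)
  also have "\<dots> = ennreal (2 * (\<Lambda> * R ^ 3))"
    using R L by (simp add: ennreal_plus[symmetric] del: ennreal_plus)
  finally have "cmod (u x - u y) * (pi * (R/2)\<^sup>2) \<le> 2 * (\<Lambda> * R ^ 3)"
    using R L by (subst (asm) ennreal_le_iff) auto
  then have "(R\<^sup>2 / 4) * (pi * cmod (u x - u y)) \<le> (R\<^sup>2 / 4) * (8 * \<Lambda> * R)"
    by (simp add: power2_eq_square power3_eq_cube mult_ac)
  then have "pi * cmod (u x - u y) \<le> 8 * \<Lambda> * R" using R by (subst (asm) mult_le_cancel_left_pos) auto
  moreover have "3 * cmod (u x - u y) \<le> pi * cmod (u x - u y)"
    using pi_gt3 by (intro mult_right_mono) auto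
  moreover have "\<Lambda> * R \<ge> 0" using R L by simp
  ultimately show ?thesis unfolding R_def[symmetric] by linarith
qed simp

lemma mollify_tendsto_pointwise:
  assumes G: "continuous_on UNIV G" "integrable lborel G" and d: "d \<longlonglongrightarrow> 0" "\<And>n. d n > (0::real)"
  shows "(\<lambda>n. mollify (d n) G z) \<longlonglongrightarrow> G z"
proof (rule tendstoI)
  fix \<eta> :: real assume \<eta>: "\<eta> > 0"
  have "isCont G z" using G(1) by (simp add: continuous_on_eq_continuous_at)
  then obtain s where s: "s > 0" "\<And>w. dist w z < s \<Longrightarrow> dist (G w) (G z) < \<eta> / 2"
    using \<eta> by (metis continuous_at_eps_delta half_gt_zero)
  have "\<forall>\<^sub>F n in sequentially. d n < s" using d(1) s(1) by (rule order_tendstoD)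
  then show "\<forall>\<^sub>F n in sequentially. dist (mollify (d n) G z) (G z) < \<eta>"
  proof eventually_elim
    case (elim n)
    have "mollify (d n) G z - G z = (LINT w|lborel. mollifier (d n) w *\<^sub>R (G (z + w) - G z))"
      by (rule mollify_minus_eq(1)[OF d(2) G(2)])
    also have "norm \<dots> \<le> (LINT w|lborel. mollifier (d n) w * (\<eta> / 2))"
    proof (rule Bochner_Integration.integral_norm_bound_integral)
      show "integrable lborel (\<lambda>w. mollifier (d n) w *\<^sub>R (G (z + w) - G z))"
        by (rule mollify_minus_eq(2)[OF d(2) G(2)])
      show "integrable lborel (\<lambda>w. mollifier (d n) w * (\<eta> / 2))" using integrable_mollifier[OF d(2)] by simp
      fix w
      show "norm (mollifier (d n) w *\<^sub>R (G (z + w) - G z)) \<le> mollifier (d n) w * (\<eta> / 2)"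
      proof (cases "cmod w < d n")
        case True
        then have "dist (G (z + w)) (G z) < \<eta> / 2" using elim by (intro s) (simp add: dist_norm)
        then have "mollifier (d n) w * cmod (G (z + w) - G z) \<le> mollifier (d n) w * (\<eta> / 2)"
          by (intro mult_left_mono) (auto simp: dist_norm mollifier_nonneg)
        then show ?thesis by (simp add: mollifier_nonneg)
      qed (use mollifier_outside[OF d(2), of n w] in simp)
    qed
    also have "\<dots> = \<eta> / 2" using d(2) by (simp add: integral_mollifier)
    finally show ?case using \<eta> by (simp add: dist_norm)
  qed
qed

context compact_sobolev
begin

text \<open>Mollify so fast that the gradients of the approximations \<open>g m\<close> converge geometrically in the mean, and
let \<open>F m\<close> be the sum of all gradient increments from \<open>m\<close> on. Off the set \<open>B m\<close> where the means of
\<open>F m\<close> over discs exceed \<open>\<Lambda> m / pi\<close>, every \<open>g l - g m\<close> with \<open>l \<ge> m\<close>, hence \<open>G - g m\<close>, is Lipschitz with constant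
\<open>3 * \<Lambda> m\<close>. The integral of \<open>F m\<close> is \<open>O(1 / 4 ^ m)\<close> and \<open>\<Lambda> m = 1 / 2 ^ m\<close>, so the measures of the \<open>B m\<close>
are summable while the Lipschitz constants tend to zero. By the Borel-Cantelli lemma almost every point
avoids all \<open>B m\<close> from some index \<open>j\<close> on. On the set \<open>S j\<close> of such points \<open>G\<close> differs from the smooth
function \<open>g m\<close> by a function with arbitrarily small Lipschitz constant, so it is differentiable
relative to \<open>S j\<close>.\<close>

lemma differentiable_pieces:
  obtains S :: "nat \<Rightarrow> complex set" where
    "\<And>j. S j \<in> sets borel" "\<And>j. S j \<subseteq> S (Suc j)" "AE z in lborel. \<exists>j. z \<in> S j"
    "\<And>j z. z \<in> S j \<Longrightarrow> (G has_derivative (\<lambda>v. Re v *\<^sub>R V1 z + Im v *\<^sub>R V2 z)) (at z within S j)"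
proof -
  have [measurable]: "V1 \<in> borel_measurable borel" "V2 \<in> borel_measurable borel" using int1 int2 by auto
  define good_scale where "good_scale m \<delta> \<longleftrightarrow> 0 < \<delta> \<and> \<delta> \<le> 1 / real (Suc m) \<and>
     (\<integral>\<^sup>+z. ennreal (cmod (mollify \<delta> V1 z - V1 z)) \<partial>lborel) \<le> ennreal ((1/4)^m) \<and>
     (\<integral>\<^sup>+z. ennreal (cmod (mollify \<delta> V2 z - V2 z)) \<partial>lborel) \<le> ennreal ((1/4)^m)" for m \<delta>
  have "\<exists>\<delta>. good_scale m \<delta>" for m
  proof -
    obtain d1 where d1: "d1 > 0" "\<And>\<delta>. 0 < \<delta> \<Longrightarrow> \<delta> \<le> d1 \<Longrightarrow>
        (\<integral>\<^sup>+z. ennreal (cmod (mollify \<delta> V1 z - V1 z)) \<partial>lborel) \<le> ennreal ((1/4)^m)"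
      using L1_mollify_tendsto[OF int1, of "(1/4)^m"] by auto
    obtain d2 where d2: "d2 > 0" "\<And>\<delta>. 0 < \<delta> \<Longrightarrow> \<delta> \<le> d2 \<Longrightarrow>
        (\<integral>\<^sup>+z. ennreal (cmod (mollify \<delta> V2 z - V2 z)) \<partial>lborel) \<le> ennreal ((1/4)^m)"
      using L1_mollify_tendsto[OF int2, of "(1/4)^m"] by auto
    show ?thesis
      using d1 d2 unfolding good_scale_def by (intro exI[of _ "min (min d1 d2) (1 / real (Suc m))"]) auto
  qed
  then have "\<exists>\<delta>. \<forall>m. good_scale m (\<delta> m)" by (intro choice allI)
  then obtain \<delta> where \<delta>: "\<And>m. 0 < \<delta> m" "\<And>m. \<delta> m \<le> 1 / real (Suc m)"
     "\<And>m. (\<integral>\<^sup>+z. ennreal (cmod (mollify (\<delta> m) V1 z - V1 z)) \<partial>lborel) \<le> ennreal ((1/4)^m)"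
     "\<And>m. (\<integral>\<^sup>+z. ennreal (cmod (mollify (\<delta> m) V2 z - V2 z)) \<partial>lborel) \<le> ennreal ((1/4)^m)"
    unfolding good_scale_def by blast
  define a where "a m = mollify (\<delta> m) V1" for m
  define b where "b m = mollify (\<delta> m) V2" for m
  define g where "g m = mollify (\<delta> m) G" for m
  have ca: "continuous_on UNIV (a m)" and cb: "continuous_on UNIV (b m)" for m
    unfolding a_def b_def by (rule continuous_mollify_gradient)+
  have [measurable]: "a m \<in> borel_measurable borel" "b m \<in> borel_measurable borel" for m
    using ca cb by (auto intro: borel_measurable_continuous_onI)
  have dg: "(g m has_derivative (\<lambda>v. Re v *\<^sub>R a m z + Im v *\<^sub>R b m z)) (at z)" for m z
    unfolding a_def b_def g_def by (rule mollify_G_derivative)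
  have "\<delta> \<longlonglongrightarrow> 0"
    by (rule real_tendsto_sandwich[of "\<lambda>_. 0" _ _ "\<lambda>m. 1 / real (Suc m)"])
       (use \<delta>(1,2) LIMSEQ_Suc[OF lim_1_over_n] in \<open>auto simp: less_imp_le\<close>)
  then have glim: "(\<lambda>m. g m z) \<longlonglongrightarrow> G z" for z
    unfolding g_def using \<delta>(1) by (intro mollify_tendsto_pointwise contG intG)
  define e where "e m z = cmod (a (Suc m) z - a m z) + cmod (b (Suc m) z - b m z)" for m z
  have [measurable]: "e m \<in> borel_measurable borel" for m unfolding e_def by measurable
  have ab4: "(\<integral>\<^sup>+z. ennreal (cmod (a m z - V1 z)) + ennreal (cmod (b m z - V2 z)) \<partial>lborel) \<le> ennreal (2 * (1/4)^m)" for m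
  proof -
    have "(\<integral>\<^sup>+z. ennreal (cmod (a m z - V1 z)) + ennreal (cmod (b m z - V2 z)) \<partial>lborel)
      = (\<integral>\<^sup>+z. ennreal (cmod (a m z - V1 z)) \<partial>lborel) + (\<integral>\<^sup>+z. ennreal (cmod (b m z - V2 z)) \<partial>lborel)"
      by (rule nn_integral_add) measurable
    also have "\<dots> \<le> ennreal ((1/4)^m) + ennreal ((1/4)^m)"
      unfolding a_def b_def by (intro add_mono \<delta>)
    also have "\<dots> = ennreal ((1/4)^m + (1/4)^m)" by (rule ennreal_plus[symmetric]) auto
    finally show ?thesis by simp
  qed
  have e4: "(\<integral>\<^sup>+z. ennreal (e m z) \<partial>lborel) \<le> ennreal (4 * (1/4)^m)" for m
  proof -
    have "(\<integral>\<^sup>+z. ennreal (e m z) \<partial>lborel) \<le>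
       (\<integral>\<^sup>+z. (ennreal (cmod (a (Suc m) z - V1 z)) + ennreal (cmod (b (Suc m) z - V2 z)))
             + (ennreal (cmod (a m z - V1 z)) + ennreal (cmod (b m z - V2 z))) \<partial>lborel)"
    proof (rule nn_integral_mono)
      fix z
      have "e m z \<le> cmod (a (Suc m) z - V1 z) + cmod (b (Suc m) z - V2 z) + (cmod (a m z - V1 z) + cmod (b m z - V2 z))"
        unfolding e_def
        using norm_triangle_ineq4[of "a (Suc m) z - V1 z" "a m z - V1 z"] norm_triangle_ineq4[of "b (Suc m) z - V2 z" "b m z - V2 z"]
        by simp
      then show "ennreal (e m z) \<le> (ennreal (cmod (a (Suc m) z - V1 z)) + ennreal (cmod (b (Suc m) z - V2 z)))
             + (ennreal (cmod (a m z - V1 z)) + ennreal (cmod (b m z - V2 z)))"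
        by (simp add: ennreal_plus[symmetric] ennreal_leI del: ennreal_plus)
    qed
    also have "\<dots> = (\<integral>\<^sup>+z. ennreal (cmod (a (Suc m) z - V1 z)) + ennreal (cmod (b (Suc m) z - V2 z)) \<partial>lborel)
        + (\<integral>\<^sup>+z. ennreal (cmod (a m z - V1 z)) + ennreal (cmod (b m z - V2 z)) \<partial>lborel)"
      by (rule nn_integral_add) measurable
    also have "\<dots> \<le> ennreal (2 * (1/4)^Suc m) + ennreal (2 * (1/4)^m)"
      by (intro add_mono ab4)
    also have "\<dots> = ennreal (2 * (1/4)^Suc m + 2 * (1/4)^m)"
      by (rule ennreal_plus[symmetric]) auto
    also have "\<dots> \<le> ennreal (4 * (1/4)^m)" by (intro ennreal_leI) simp
    finally show ?thesis .
  qed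
  define F where "F m z = (\<Sum>i. ennreal (e (i + m) z))" for m z
  have Fm [measurable]: "F m \<in> borel_measurable borel" for m unfolding F_def by measurable
  have intF: "(\<integral>\<^sup>+z. F m z \<partial>lborel) \<le> ennreal (6 * (1/4)^m)" for m
  proof -
    have "(\<integral>\<^sup>+z. F m z \<partial>lborel) = (\<Sum>i. \<integral>\<^sup>+z. ennreal (e (i + m) z) \<partial>lborel)"
      unfolding F_def by (rule nn_integral_suminf) measurable
    also have "\<dots> \<le> (\<Sum>i. ennreal (4 * (1/4)^(i + m)))"
      by (intro suminf_le e4) auto
    also have "\<dots> = ennreal (\<Sum>i. 4 * (1/4)^(i + m))"
      by (intro suminf_ennreal2) (auto simp: power_add intro!: summable_mult summable_mult2 summable_geometric)
    also have "(\<Sum>i. 4 * (1/4)^(i + m)) = (16/3) * (1/4::real)^m"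
    proof -
      have "(\<lambda>i. (1/4::real)^i) sums (1 / (1 - 1/4))" by (intro geometric_sums) simp
      then have "(\<lambda>i. (4 * (1/4)^m) * (1/4::real)^i) sums ((4 * (1/4)^m) * (1 / (1 - 1/4)))" by (rule sums_mult)
      then show ?thesis by (intro sums_unique[symmetric]) (simp add: power_add mult_ac)
    qed
    also have "ennreal \<dots> \<le> ennreal (6 * (1/4)^m)" by (intro ennreal_leI) simp
    finally show ?thesis .
  qed
  have e_nn: "e m z \<ge> 0" for m z by (simp add: e_def)
  have diff_le: "ennreal (cmod (a l z - a m z) + cmod (b l z - b m z)) \<le> F m z" if "m \<le> l" for m l z
  proof -
    have "cmod (a (m + k) z - a m z) + cmod (b (m + k) z - b m z) \<le> (\<Sum>i<k. e (i + m) z)" for k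
    proof (induction k)
      case (Suc k)
      have "cmod (a (m + Suc k) z - a m z) \<le> cmod (a (m + Suc k) z - a (m + k) z) + cmod (a (m + k) z - a m z)"
        "cmod (b (m + Suc k) z - b m z) \<le> cmod (b (m + Suc k) z - b (m + k) z) + cmod (b (m + k) z - b m z)"
        by (rule order_trans[OF _ norm_triangle_ineq], simp)+
      then show ?case using Suc by (simp add: e_def add.commute)
    qed simp
    then have "ennreal (cmod (a l z - a m z) + cmod (b l z - b m z)) \<le> ennreal (\<Sum>i<l-m. e (i + m) z)"
      using that by (intro ennreal_leI) (metis le_add_diff_inverse)
    also have "\<dots> = (\<Sum>i<l-m. ennreal (e (i + m) z))" using e_nn by simp
    also have "\<dots> \<le> F m z" unfolding F_def by (rule sum_le_suminf) auto
    finally show ?thesis .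
  qed
  define \<Lambda> where "\<Lambda> m = (1/2::real)^m" for m :: nat
  have \<Lambda>: "\<Lambda> m > 0" for m by (simp add: \<Lambda>_def)
  define B where "B m = large_mean_set (F m) (\<Lambda> m)" for m
  have Ffin: "(\<integral>\<^sup>+z. F m z \<partial>lborel) < \<infinity>" for m
    using intF[of m] by (rule le_less_trans) simp
  have Bo: "open (B m)" for m unfolding B_def by (rule open_large_mean_set[OF \<Lambda> Ffin])
  have [measurable]: "B m \<in> sets borel" for m using Bo by (rule borel_open)
  have Bm: "emeasure lborel (B m) \<le> ennreal (150 * pi * (1/2)^m)" for m
  proof -
    have "emeasure lborel (B m) \<le> ennreal (25 * pi / \<Lambda> m) * (\<integral>\<^sup>+z. F m z \<partial>lborel)"
      unfolding B_def by (rule emeasure_large_mean_set[OF \<Lambda> Ffin Fm])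
    also have "\<dots> \<le> ennreal (25 * pi / \<Lambda> m) * ennreal (6 * (1/4)^m)" by (intro mult_left_mono intF) auto
    also have "\<dots> = ennreal ((25 * pi / \<Lambda> m) * (6 * (1/4)^m))" using \<Lambda>[of m] by (intro ennreal_mult[symmetric]) auto
    also have "(25 * pi / \<Lambda> m) * (6 * (1/4)^m) = 150 * pi * (1/2)^m"
    proof -
      have "(1/4::real)^m = (1/2)^m * (1/2)^m" by (simp add: power_mult_distrib[symmetric])
      then show ?thesis by (simp add: \<Lambda>_def)
    qed
    finally show ?thesis .
  qed
  have sumB: "(\<Sum>m. ennreal (150 * pi * (1/2)^m)) \<noteq> \<infinity>"
    by (subst suminf_ennreal2) (auto intro!: summable_mult summable_geometric)
  have AE_B: "AE z in lborel. \<forall>\<^sub>F m in sequentially. z \<in> space lborel - B m"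
  proof (rule borel_cantelli_AE1)
    show "emeasure lborel (B m) < \<infinity>" for m using Bm[of m] by (rule le_less_trans) simp
    have "(\<lambda>m. measure lborel (B m)) = (\<lambda>m. enn2real (emeasure lborel (B m)))" by (simp add: measure_def)
    moreover have "enn2real (emeasure lborel (B m)) \<le> 150 * pi * (1/2)^m" for m
      using enn2real_mono[OF Bm[of m]] by simp
    ultimately have le: "norm (measure lborel (B m)) \<le> 150 * pi * (1/2)^m" for m
      by (metis measure_nonneg abs_of_nonneg real_norm_def)
    show "summable (\<lambda>m. measure lborel (B m))"
    proof (rule summable_comparison_test'[where N = 0])
      show "summable (\<lambda>m. 150 * pi * (1/2::real)^m)" by (intro summable_mult summable_geometric) simp
    qed (rule le)
  qed auto
  have "(\<integral>\<^sup>+z. (\<Sum>m. ennreal (cmod (a m z - V1 z) + cmod (b m z - V2 z))) \<partial>lborel) \<noteq> \<infinity>"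
  proof -
    have "(\<integral>\<^sup>+z. (\<Sum>m. ennreal (cmod (a m z - V1 z) + cmod (b m z - V2 z))) \<partial>lborel)
       = (\<Sum>m. \<integral>\<^sup>+z. ennreal (cmod (a m z - V1 z) + cmod (b m z - V2 z)) \<partial>lborel)"
      by (rule nn_integral_suminf) measurable
    also have "\<dots> \<le> (\<Sum>m. ennreal (2 * (1/4)^m))"
      using ab4 by (intro suminf_le) auto
    also have "\<dots> = ennreal (\<Sum>m. 2 * (1/4)^m)"
      by (intro suminf_ennreal2) (auto intro!: summable_mult summable_geometric)
    finally show ?thesis by (auto simp: top_unique)
  qed
  then have "AE z in lborel. (\<Sum>m. ennreal (cmod (a m z - V1 z) + cmod (b m z - V2 z))) \<noteq> \<infinity>"
    by (intro nn_integral_noteq_infinite) measurable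
  then have AE_V: "AE z in lborel. (\<lambda>m. cmod (a m z - V1 z) + cmod (b m z - V2 z)) \<longlonglongrightarrow> 0"
  proof eventually_elim
    case (elim z)
    then have "summable (\<lambda>m. cmod (a m z - V1 z) + cmod (b m z - V2 z))"
      by (intro summable_suminf_not_top) auto
    then show ?case by (rule summable_LIMSEQ_zero)
  qed
  then obtain N where N: "N \<in> null_sets lborel"
     "{z. \<not> ((\<lambda>m. cmod (a m z - V1 z) + cmod (b m z - V2 z)) \<longlonglongrightarrow> 0)} \<subseteq> N"
    by (auto elim!: AE_E simp: null_sets_def)
  define S where "S j = - (\<Union>m\<in>{j..}. B m) - N" for j
  show ?thesis
  proof (rule that)
    show "S j \<in> sets borel" for j
    proof -
      have "N \<in> sets borel" using N(1) by auto
      moreover have "open (\<Union>m\<in>{j..}. B m)" using Bo by blast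
      ultimately show ?thesis unfolding S_def by (metis borel_closed closed_Compl sets.Diff)
    qed
    show "S j \<subseteq> S (Suc j)" for j unfolding S_def by fastforce
    show "AE z in lborel. \<exists>j. z \<in> S j"
      using AE_B AE_not_in[OF N(1)]
    proof eventually_elim
      case (elim z)
      then obtain j where "\<And>m. m \<ge> j \<Longrightarrow> z \<notin> B m" by (auto simp: eventually_sequentially)
      then have "z \<in> S j" using elim by (auto simp: S_def)
      then show ?case ..
    qed
    fix j x assume x: "x \<in> S j"
    have lip: "cmod ((G y - g m y) - (G x - g m x)) \<le> 3 * \<Lambda> m * cmod (y - x)" if m: "m \<ge> j" and y: "y \<in> S j" for m y
    proof (rule LIMSEQ_le_const2)
      show "(\<lambda>l. cmod ((g l y - g m y) - (g l x - g m x))) \<longlonglongrightarrow> cmod ((G y - g m y) - (G x - g m x))"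
        by (intro tendsto_intros glim)
      show "\<exists>N. \<forall>l\<ge>N. cmod ((g l y - g m y) - (g l x - g m x)) \<le> 3 * \<Lambda> m * cmod (y - x)"
      proof (intro exI allI impI)
        fix l assume l: "l \<ge> m"
        have xy: "x \<notin> B m" "y \<notin> B m" using x y m by (auto simp: S_def)
        show "cmod ((g l y - g m y) - (g l x - g m x)) \<le> 3 * \<Lambda> m * cmod (y - x)"
        proof (rule lipschitz_off_large_mean_set[of "\<lambda>z. g l z - g m z" "\<lambda>z. a l z - a m z" "\<lambda>z. b l z - b m z" "F m"])
          fix z
          show "((\<lambda>z. g l z - g m z) has_derivative (\<lambda>v. Re v *\<^sub>R (a l z - a m z) + Im v *\<^sub>R (b l z - b m z))) (at z)"
            by (rule has_derivative_eq_rhs[OF has_derivative_diff[OF dg dg]])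
               (simp add: fun_eq_iff scaleR_diff_right)
        qed (use xy \<Lambda> diff_le[OF l] Fm in \<open>auto simp: B_def intro!: continuous_intros ca cb\<close>)
      qed
    qed
    have lim0: "(\<lambda>m. cmod (a m x - V1 x) + cmod (b m x - V2 x)) \<longlonglongrightarrow> 0"
      using x N(2) by (auto simp: S_def)
    have bl: "bounded_linear (\<lambda>v. Re v *\<^sub>R p + Im v *\<^sub>R q)" for p q :: complex
      by (intro bounded_linear_add bounded_linear_compose[OF bounded_linear_scaleR_left] bounded_linear_Re bounded_linear_Im)
    show "(G has_derivative (\<lambda>v. Re v *\<^sub>R V1 x + Im v *\<^sub>R V2 x)) (at x within S j)"
      unfolding has_derivative_within_alt
    proof (intro conjI allI impI bl)
      fix \<eta> :: real assume \<eta>: "\<eta> > 0"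
      have "(\<lambda>m. 3 * \<Lambda> m) \<longlonglongrightarrow> 0" unfolding \<Lambda>_def by real_asymp
      from order_tendstoD(2)[OF this, of "\<eta> / 3"]
      have "\<forall>\<^sub>F m in sequentially. 3 * \<Lambda> m < \<eta> / 3" using \<eta> by simp
      moreover have "\<forall>\<^sub>F m in sequentially. cmod (a m x - V1 x) + cmod (b m x - V2 x) < \<eta> / 3"
        using order_tendstoD(2)[OF lim0, of "\<eta> / 3"] \<eta> by simp
      ultimately have "\<forall>\<^sub>F m in sequentially. 3 * \<Lambda> m < \<eta> / 3 \<and> cmod (a m x - V1 x) + cmod (b m x - V2 x) < \<eta> / 3 \<and> m \<ge> j"
        using eventually_ge_at_top[of j] by eventually_elim auto
      then obtain m where m: "3 * \<Lambda> m < \<eta> / 3" "cmod (a m x - V1 x) + cmod (b m x - V2 x) < \<eta> / 3" "m \<ge> j"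
        by (auto simp: eventually_sequentially)
      obtain d where d: "d > 0" "\<And>y. norm (y - x) < d \<Longrightarrow>
         norm (g m y - g m x - (Re (y - x) *\<^sub>R a m x + Im (y - x) *\<^sub>R b m x)) \<le> (\<eta> / 3) * norm (y - x)"
        using dg[of m x] \<eta> unfolding has_derivative_within_alt by (metis UNIV_I divide_pos_pos zero_less_numeral)
      show "\<exists>d>0. \<forall>y\<in>S j. norm (y - x) < d \<longrightarrow>
         norm (G y - G x - (Re (y - x) *\<^sub>R V1 x + Im (y - x) *\<^sub>R V2 x)) \<le> \<eta> * norm (y - x)"
      proof (intro exI[of _ d] conjI ballI impI d(1))
        fix y assume y: "y \<in> S j" "norm (y - x) < d"
        \<comment> \<open>The remainder of \<open>G\<close> splits into the Lipschitz part, the remainder of \<open>g m\<close>, and the error of its gradient at \<open>x\<close>.\<close>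
        let ?T1 = "(G y - g m y) - (G x - g m x)"
        let ?T2 = "g m y - g m x - (Re (y - x) *\<^sub>R a m x + Im (y - x) *\<^sub>R b m x)"
        let ?T3 = "Re (y - x) *\<^sub>R (a m x - V1 x)"
        let ?T4 = "Im (y - x) *\<^sub>R (b m x - V2 x)"
        have "G y - G x - (Re (y - x) *\<^sub>R V1 x + Im (y - x) *\<^sub>R V2 x) = ?T1 + ?T2 + (?T3 + ?T4)"
          by (simp add: scaleR_diff_right)
        then have "norm (G y - G x - (Re (y - x) *\<^sub>R V1 x + Im (y - x) *\<^sub>R V2 x)) \<le> norm ?T1 + norm ?T2 + (norm ?T3 + norm ?T4)"
          by (metis norm_triangle_mono norm_triangle_ineq order_refl)
        moreover have "norm ?T1 \<le> (\<eta> / 3) * norm (y - x)"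
          by (rule order_trans[OF lip[OF m(3) y(1)]]) (use m(1) in \<open>intro mult_right_mono, auto\<close>)
        moreover have "norm ?T2 \<le> (\<eta> / 3) * norm (y - x)" using d(2) y(2) by blast
        moreover have "norm ?T3 + norm ?T4 \<le> (\<eta> / 3) * norm (y - x)"
        proof -
          have "norm ?T3 + norm ?T4 \<le> norm (y - x) * cmod (a m x - V1 x) + norm (y - x) * cmod (b m x - V2 x)"
            unfolding norm_scaleR real_norm_def by (intro add_mono mult_right_mono abs_Re_le_cmod abs_Im_le_cmod) auto
          also have "\<dots> = (cmod (a m x - V1 x) + cmod (b m x - V2 x)) * norm (y - x)" by (simp add: algebra_simps)
          also have "\<dots> \<le> (\<eta> / 3) * norm (y - x)" using m(2) by (intro mult_right_mono) auto
          finally show ?thesis .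
        qed
        ultimately have "norm (G y - G x - (Re (y - x) *\<^sub>R V1 x + Im (y - x) *\<^sub>R V2 x))
            \<le> (\<eta> / 3) * norm (y - x) + (\<eta> / 3) * norm (y - x) + (\<eta> / 3) * norm (y - x)" by linarith
        also have "\<dots> = \<eta> * norm (y - x)" by (simp add: field_simps)
        finally show "norm (G y - G x - (Re (y - x) *\<^sub>R V1 x + Im (y - x) *\<^sub>R V2 x)) \<le> \<eta> * norm (y - x)" .
      qed
    qed
  qed
qed

end

section \<open>The area inequality\<close>

text \<open>An isometry between the complex plane and coordinate vectors, for which determinants are defined.\<close>

definition to_vec :: "complex \<Rightarrow> real^2" where "to_vec z = vector [Re z, Im z]"
definition of_vec :: "real^2 \<Rightarrow> complex" where "of_vec x = Complex (x $ 1) (x $ 2)"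

lemma of_to_vec [simp]: "of_vec (to_vec z) = z" "to_vec (of_vec x) = x"
  by (auto simp: of_vec_def to_vec_def vec_eq_iff forall_2)

lemma linear_to_vec: "linear to_vec" and linear_of_vec: "linear of_vec"
  by (auto intro!: linearI simp: to_vec_def of_vec_def vec_eq_iff forall_2 complex_eq_iff)

lemma bounded_linear_to_vec: "bounded_linear to_vec" and bounded_linear_of_vec: "bounded_linear of_vec"
  using linear_to_vec linear_of_vec linear_conv_bounded_linear by blast+

lemma measurable_of_vec [measurable]: "of_vec \<in> borel_measurable borel"
  by (intro borel_measurable_continuous_onI linear_continuous_on bounded_linear_of_vec)

lemma lborel_of_vec: "lborel = distr lborel borel of_vec"
proof (rule lborel_eqI)
  fix l u :: complex assume le: "\<And>b. b \<in> Basis \<Longrightarrow> l \<bullet> b \<le> u \<bullet> b"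
  have "of_vec -` box l u = box (to_vec l) (to_vec u)"
    by (auto simp: box_complex mem_box_cart of_vec_def to_vec_def forall_2)
  then have "emeasure (distr lborel borel of_vec) (box l u) = emeasure lborel (box (to_vec l) (to_vec u))"
    by (simp add: emeasure_distr)
  also have "\<dots> = (\<Prod>b\<in>Basis. (to_vec u - to_vec l) \<bullet> b)"
  proof (intro emeasure_lborel_box)
    have "to_vec l $ i \<le> to_vec u $ i" for i
      using exhaust_2[of i] le[of 1] le[of \<i>] by (auto simp: to_vec_def)
    then show "to_vec l \<bullet> b \<le> to_vec u \<bullet> b" if "b \<in> Basis" for b
      using that by (auto simp: Basis_vec_def inner_axis)
  qed
  also have "(\<Prod>b\<in>Basis. (to_vec u - to_vec l) \<bullet> b) = (\<Prod>i\<in>UNIV. (to_vec u - to_vec l) $ i)"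
  proof -
    have B: "Basis = (\<lambda>i. axis i (1::real)) ` (UNIV :: 2 set)" by (auto simp: Basis_vec_def)
    have inj: "inj (\<lambda>i::2. axis i (1::real))" by (auto simp: inj_def axis_eq_axis)
    show ?thesis unfolding B prod.reindex[OF inj] by (simp add: inner_axis)
  qed
  also have "\<dots> = (\<Prod>b\<in>Basis. (u - l) \<bullet> b)"
    by (simp add: UNIV_2 to_vec_def Basis_complex_def)
  finally show "emeasure (distr lborel borel of_vec) (box l u) = (\<Prod>b\<in>Basis. (u - l) \<bullet> b)" .
qed simp

lemma nn_integral_of_vec:
  assumes "f \<in> borel_measurable borel"
  shows "(\<integral>\<^sup>+z. f z \<partial>lborel) = (\<integral>\<^sup>+x. f (of_vec x) \<partial>lborel)"
  by (subst lborel_of_vec, subst nn_integral_distr) (use assms in auto)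

text \<open>For derivatives relative to \<open>S\<close> the change of variables formula needs no regularity of \<open>S\<close> beyond
measurability, and it gives equality with the measure of the image of \<open>S\<close>.\<close>

lemma jacobian_integral_le_image:
  fixes f p q :: "complex \<Rightarrow> complex"
  assumes S [measurable]: "S \<in> sets borel" and pq [measurable]: "p \<in> borel_measurable borel" "q \<in> borel_measurable borel"
    and der: "\<And>z. z \<in> S \<Longrightarrow> (f has_derivative (\<lambda>v. Re v *\<^sub>R p z + Im v *\<^sub>R q z)) (at z within S)"
    and inj: "inj_on f S" and P: "f ` S \<subseteq> P" "compact P"
  shows "(\<integral>\<^sup>+z. ennreal \<bar>Re (p z) * Im (q z) - Im (p z) * Re (q z)\<bar> * indicator S z \<partial>lborel) \<le> emeasure lborel P"
proof -
  define S' where "S' = of_vec -` S"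
  define g where "g = to_vec \<circ> f \<circ> of_vec"
  define g' :: "real^2 \<Rightarrow> real^2 \<Rightarrow> real^2" where "g' x v = to_vec (v $ 1 *\<^sub>R p (of_vec x) + v $ 2 *\<^sub>R q (of_vec x))" for x v
  define d where "d z = \<bar>Re (p z) * Im (q z) - Im (p z) * Re (q z)\<bar>" for z
  have S'b: "S' \<in> sets borel" unfolding S'_def using measurable_sets[OF measurable_of_vec S] by simp
  then have S'l: "S' \<in> sets lebesgue" by simp
  have img: "of_vec ` S' = S" unfolding S'_def by (metis of_to_vec(1) surjI surj_image_vimage_eq)
  have der': "(g has_derivative g' x) (at x within S')" if x: "x \<in> S'" for x
  proof -
    have "of_vec x \<in> S" using x by (simp add: S'_def)
    then have "(f has_derivative (\<lambda>v. Re v *\<^sub>R p (of_vec x) + Im v *\<^sub>R q (of_vec x))) (at (of_vec x) within of_vec ` S')"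
      unfolding img by (rule der)
    moreover have "(of_vec has_derivative of_vec) (at x within S')"
      by (rule bounded_linear_imp_has_derivative[OF bounded_linear_of_vec])
    ultimately have "((\<lambda>x. f (of_vec x)) has_derivative (\<lambda>v. Re (of_vec v) *\<^sub>R p (of_vec x) + Im (of_vec v) *\<^sub>R q (of_vec x))) (at x within S')"
      by (rule has_derivative_in_compose[rotated])
    from bounded_linear.has_derivative[OF bounded_linear_to_vec this]
    show ?thesis by (simp add: g_def g'_def[abs_def] o_def of_vec_def)
  qed
  have inj': "inj_on g S'"
  proof (rule inj_onI)
    fix x y assume "x \<in> S'" "y \<in> S'" "g x = g y"
    then have "f (of_vec x) = f (of_vec y)" "of_vec x \<in> S" "of_vec y \<in> S"
      unfolding g_def S'_def by (auto dest: arg_cong[of _ _ of_vec])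
    then have "of_vec x = of_vec y" using inj by (auto dest: inj_onD)
    then show "x = y" by (metis of_to_vec(2))
  qed
  have det: "\<bar>det (matrix (g' x))\<bar> = d (of_vec x)" for x
    by (simp add: det_2 matrix_def g'_def d_def to_vec_def axis_def mult.commute)
  have gS: "g ` S' \<in> sets lebesgue"
    by (rule differentiable_image_in_sets_lebesgue[OF S'l])
       (auto simp: differentiable_on_def intro: differentiableI der')
  define P' where "P' = of_vec -` P"
  have gP: "g ` S' \<subseteq> P'" using P(1) by (auto simp: g_def P'_def S'_def)
  have Pb: "P \<in> sets borel" using P(2) by (simp add: borel_compact)
  have P'b: "P' \<in> sets borel" unfolding P'_def using measurable_sets[OF measurable_of_vec Pb] by simp
  have P'm: "emeasure lborel P' = emeasure lborel P"
  proof -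
    have "emeasure lborel P = emeasure (distr lborel borel of_vec) P"
      by (subst lborel_of_vec) (rule refl)
    then show ?thesis using Pb by (simp add: emeasure_distr P'_def)
  qed
  have "P' = to_vec ` P" unfolding P'_def by (force simp: image_iff intro: of_to_vec(2)[symmetric])
  then have P'c: "compact P'"
    using P(2) by (auto intro!: compact_continuous_image linear_continuous_on bounded_linear_to_vec)
  have gm: "g ` S' \<in> lmeasurable"
    using gS gP P'c by (meson bounded_set_imp_lmeasurable bounded_subset compact_imp_bounded)
  have "(\<lambda>x. 1 :: real^1) absolutely_integrable_on (g ` S')"
    using gm by (simp add: absolutely_integrable_on_const)
  then have ai: "(\<lambda>x. \<bar>det (matrix (g' x))\<bar> *\<^sub>R (1 :: real^1)) absolutely_integrable_on S'"
    and ie: "integral S' (\<lambda>x. \<bar>det (matrix (g' x))\<bar> *\<^sub>R (1 :: real^1)) = integral (g ` S') (\<lambda>_. 1)"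
    using has_absolute_integral_change_of_variables[OF S'l der' inj', of "\<lambda>_. 1" "integral (g ` S') (\<lambda>_. 1)"] by auto
  have ai': "(\<lambda>x. d (of_vec x)) absolutely_integrable_on S'"
    using absolutely_integrable_component[OF ai, of "axis 1 1"] by (simp add: det inner_axis)
  have ie': "integral S' (\<lambda>x. d (of_vec x)) = measure lebesgue (g ` S')"
  proof -
    have "integral S' (\<lambda>x. d (of_vec x)) = integral S' (\<lambda>x. (\<bar>det (matrix (g' x))\<bar> *\<^sub>R (1 :: real^1)) \<bullet> axis 1 1)"
      by (simp add: det inner_axis)
    also have "\<dots> = integral S' (\<lambda>x. \<bar>det (matrix (g' x))\<bar> *\<^sub>R (1 :: real^1)) \<bullet> axis 1 1"
      using ai by (intro integral_component_eq) (auto simp: absolutely_integrable_on_def)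
    also have "\<dots> = integral (g ` S') (\<lambda>_. (1 :: real^1) \<bullet> axis 1 1)"
      unfolding ie using gm by (intro integral_component_eq[symmetric]) (auto simp: integrable_on_const)
    also have "\<dots> = measure lebesgue (g ` S')" using gm by (simp add: inner_axis lmeasure_integral)
    finally show ?thesis .
  qed
  have si: "integrable lebesgue (\<lambda>x. indicator S' x *\<^sub>R d (of_vec x))"
    using ai' by (simp add: set_integrable_def)
  have [measurable]: "d \<in> borel_measurable borel" unfolding d_def by measurable
  have "(\<integral>\<^sup>+z. ennreal (d z) * indicator S z \<partial>lborel) = (\<integral>\<^sup>+x. ennreal (d (of_vec x)) * indicator S (of_vec x) \<partial>lborel)"
    by (rule nn_integral_of_vec) measurable
  also have "\<dots> = (\<integral>\<^sup>+x. ennreal (indicator S' x *\<^sub>R d (of_vec x)) \<partial>lebesgue)"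
    unfolding nn_integral_completion by (intro nn_integral_cong) (auto simp: indicator_def S'_def)
  also have "\<dots> = ennreal (LINT x:S'|lebesgue. d (of_vec x))"
    unfolding set_lebesgue_integral_def by (rule nn_integral_eq_integral[OF si]) (simp add: d_def)
  also have "(LINT x:S'|lebesgue. d (of_vec x)) = measure lebesgue (g ` S')"
    using set_lebesgue_integral_eq_integral(2)[OF ai'] ie' by simp
  also have "ennreal (measure lebesgue (g ` S')) = emeasure lebesgue (g ` S')"
    using gm by (simp add: emeasure_eq_measure2)
  also have "\<dots> \<le> emeasure lebesgue P'" using gP P'b by (intro emeasure_mono) auto
  also have "\<dots> = emeasure lborel P" using P'm P'b by simp
  finally show ?thesis by (simp add: d_def)
qed

text \<open>Apply the change of variables formula on the pieces \<open>S j\<close> and pass to the limit by monotone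
convergence. Only an inequality results, since the null set off the pieces may have a large image.\<close>

lemma (in compact_sobolev) jacobian_integral_le:
  fixes L :: "complex \<Rightarrow> complex"
  assumes L: "bounded_linear L" and \<Omega> [measurable]: "\<Omega> \<in> sets borel"
    and inj: "inj_on (\<lambda>z. L z + G z) \<Omega>" and P: "(\<lambda>z. L z + G z) ` \<Omega> \<subseteq> P" "compact P"
  defines "p \<equiv> (\<lambda>z. L 1 + V1 z)" and "q \<equiv> (\<lambda>z. L \<i> + V2 z)"
  shows "(\<integral>\<^sup>+z. ennreal \<bar>Re (p z) * Im (q z) - Im (p z) * Re (q z)\<bar> * indicator \<Omega> z \<partial>lborel) \<le> emeasure lborel P"
proof -
  obtain S where S: "\<And>j. S j \<in> sets borel" "\<And>j. S j \<subseteq> S (Suc j)" "AE z in lborel. \<exists>j. z \<in> S j"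
    "\<And>j z. z \<in> S j \<Longrightarrow> (G has_derivative (\<lambda>v. Re v *\<^sub>R V1 z + Im v *\<^sub>R V2 z)) (at z within S j)"
    by (rule differentiable_pieces) (rule that, assumption+)
  have [measurable]: "V1 \<in> borel_measurable borel" "V2 \<in> borel_measurable borel" using int1 int2 by auto
  have [measurable]: "p \<in> borel_measurable borel" "q \<in> borel_measurable borel" unfolding p_def q_def by measurable
  have inc: "incseq S" using S(2) by (rule incseq_SucI)
  let ?J = "\<lambda>z. ennreal \<bar>Re (p z) * Im (q z) - Im (p z) * Re (q z)\<bar>"
  have piece: "(\<integral>\<^sup>+z. ?J z * indicator (S j \<inter> \<Omega>) z \<partial>lborel) \<le> emeasure lborel P" for j
  proof (rule jacobian_integral_le_image)
    show "S j \<inter> \<Omega> \<in> sets borel" using S(1) by auto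
    show "inj_on (\<lambda>z. L z + G z) (S j \<inter> \<Omega>)" using inj by (rule inj_on_subset) auto
    show "(\<lambda>z. L z + G z) ` (S j \<inter> \<Omega>) \<subseteq> P" using P(1) by auto
    fix z assume z: "z \<in> S j \<inter> \<Omega>"
    have Lv: "L v = Re v *\<^sub>R L 1 + Im v *\<^sub>R L \<i>" for v
    proof -
      have "L v = L (Re v *\<^sub>R 1 + Im v *\<^sub>R \<i>)" by (rule arg_cong[of _ _ L]) (simp add: complex_eq_iff)
      then show ?thesis using L by (simp add: linear_simps)
    qed
    have "(G has_derivative (\<lambda>v. Re v *\<^sub>R V1 z + Im v *\<^sub>R V2 z)) (at z within S j \<inter> \<Omega>)"
      using S(4)[of z j] z by (auto intro: has_derivative_subset)
    then have "((\<lambda>z. L z + G z) has_derivative (\<lambda>v. L v + (Re v *\<^sub>R V1 z + Im v *\<^sub>R V2 z))) (at z within S j \<inter> \<Omega>)"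
      by (intro has_derivative_add bounded_linear_imp_has_derivative L)
    then show "((\<lambda>z. L z + G z) has_derivative (\<lambda>v. Re v *\<^sub>R p z + Im v *\<^sub>R q z)) (at z within S j \<inter> \<Omega>)"
      by (rule has_derivative_eq_rhs) (rule ext, subst Lv, simp add: p_def q_def scaleR_add_right)
  qed (use P in auto)
  have "(\<integral>\<^sup>+z. ?J z * indicator \<Omega> z \<partial>lborel) = (\<integral>\<^sup>+z. (SUP j. ?J z * indicator (S j \<inter> \<Omega>) z) \<partial>lborel)"
  proof (rule nn_integral_cong_AE)
    show "AE z in lborel. ?J z * indicator \<Omega> z = (SUP j. ?J z * indicator (S j \<inter> \<Omega>) z)"
      using S(3)
    proof eventually_elim
      case (elim z)
      then obtain j where j: "z \<in> S j" by blast
      show ?case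
      proof (rule antisym)
        have "?J z * indicator \<Omega> z = ?J z * indicator (S j \<inter> \<Omega>) z" using j by (simp add: indicator_def)
        also have "\<dots> \<le> (SUP j. ?J z * indicator (S j \<inter> \<Omega>) z)" by (rule SUP_upper) simp
        finally show "?J z * indicator \<Omega> z \<le> (SUP j. ?J z * indicator (S j \<inter> \<Omega>) z)" .
        show "(SUP j. ?J z * indicator (S j \<inter> \<Omega>) z) \<le> ?J z * indicator \<Omega> z"
          by (rule SUP_least) (auto simp: indicator_def)
      qed
    qed
  qed
  also have "\<dots> = (SUP j. \<integral>\<^sup>+z. ?J z * indicator (S j \<inter> \<Omega>) z \<partial>lborel)"
  proof (rule nn_integral_monotone_convergence_SUP)
    show "incseq (\<lambda>j z. ?J z * indicator (S j \<inter> \<Omega>) z)"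
      using inc by (auto simp: incseq_def le_fun_def indicator_def)
    have [measurable]: "S j \<in> sets borel" for j using S(1) .
    show "(\<lambda>z. ?J z * indicator (S j \<inter> \<Omega>) z) \<in> borel_measurable lborel" for j by measurable
  qed
  also have "\<dots> \<le> emeasure lborel P" by (intro SUP_least piece)
  finally show ?thesis .
qed

section \<open>The image of the rectangle\<close>

text \<open>By injectivity the image of the interior misses the boundary of \<open>P = L ` Q\<close>, and it is connected, so it
lies on one side. If it lay outside, it would be open, by invariance of domain, and relatively closed
in the complement of \<open>P\<close>, because \<open>f ` Q\<close> is compact; so it would be the whole complement, which is
connected but unbounded.\<close>

lemma homeomorphic_image_subset_by_boundary:
  fixes f L :: "complex \<Rightarrow> complex"
  assumes Q: "compact Q" "convex Q" "interior Q \<noteq> {}"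
    and f: "continuous_on Q f" "inj_on f Q"
    and L: "linear L" "inj L" and eq: "\<And>z. z \<in> frontier Q \<Longrightarrow> f z = L z"
  shows "f ` Q \<subseteq> L ` Q"
proof -
  define P where "P = L ` Q"
  have bl: "bounded_linear L" using L(1) linear_conv_bounded_linear by blast
  have Pc: "compact P" "convex P"
    unfolding P_def using Q L bl by (auto intro!: compact_continuous_image linear_continuous_on convex_linear_image)
  have clQ: "closed Q" using Q(1) by (rule compact_imp_closed)
  have Qd: "Q = interior Q \<union> frontier Q"
    using clQ interior_subset[of Q] by (auto simp: frontier_def closure_closed)
  have frQ: "frontier Q \<subseteq> Q" using clQ by (simp add: frontier_subset_closed)
  have frP: "frontier P = L ` frontier Q"
  proof -
    have "interior P = L ` interior Q"
      unfolding P_def by (rule interior_injective_linear_image[OF L])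
    then show ?thesis
      unfolding frontier_def using clQ compact_imp_closed[OF Pc(1)] L(2)
      by (simp add: P_def image_set_diff)
  qed
  let ?I = "interior Q"
  have fo: "open (f ` ?I)"
  proof (rule invariance_of_domain)
    show "continuous_on ?I f" "inj_on f ?I"
      using f interior_subset by (blast intro: continuous_on_subset inj_on_subset)+
  qed simp
  have fI: "connected (f ` ?I)"
  proof (rule connected_continuous_image)
    show "continuous_on ?I f" using f interior_subset by (blast intro: continuous_on_subset)
    show "connected ?I" using Q(2) by (simp add: convex_connected convex_interior)
  qed
  have disj: "f ` ?I \<inter> frontier P = {}"
  proof -
    have "f ` frontier Q = frontier P" using eq frP by auto
    moreover have "f ` ?I \<inter> f ` frontier Q = f ` (?I \<inter> frontier Q)"
      using f(2) frQ interior_subset by (intro inj_on_image_Int[symmetric]) auto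
    moreover have "?I \<inter> frontier Q = {}" by (auto simp: frontier_def)
    ultimately show ?thesis by simp
  qed
  have "f ` ?I \<subseteq> P"
  proof (rule ccontr)
    assume "\<not> f ` ?I \<subseteq> P"
    then have ne: "f ` ?I \<inter> - P \<noteq> {}" by auto
    have "f ` ?I \<subseteq> - P"
    proof (rule ccontr)
      assume "\<not> f ` ?I \<subseteq> - P"
      then have "f ` ?I \<inter> P \<noteq> {}" by auto
      moreover have "f ` ?I - P \<noteq> {}" using ne by auto
      ultimately have "f ` ?I \<inter> frontier P \<noteq> {}" using connected_Int_frontier[OF fI] by blast
      then show False using disj by simp
    qed
    have "f ` Q \<inter> - P = f ` ?I"
    proof -
      have "f ` frontier Q \<subseteq> P" using eq frQ by (auto simp: P_def)
      moreover have "f ` Q = f ` ?I \<union> f ` frontier Q" using Qd by (metis image_Un)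
      ultimately show ?thesis using \<open>f ` ?I \<subseteq> - P\<close> by blast
    qed
    then have "closedin (top_of_set (- P)) (f ` ?I)"
      using compact_imp_closed[OF compact_continuous_image[OF f(1) Q(1)]]
      by (metis closedin_closed Int_commute)
    moreover have "openin (top_of_set (- P)) (f ` ?I)"
      using fo \<open>f ` ?I \<subseteq> - P\<close> by (simp add: openin_open_eq compact_imp_closed[OF Pc(1)] open_Compl)
    moreover have "connected (- P)"
      using compact_imp_bounded[OF Pc(1)] Pc(2) by (intro connected_complement_bounded_convex) auto
    ultimately have "f ` ?I = - P" using Q(3) unfolding connected_clopen by blast
    moreover have "bounded (f ` ?I)"
      using compact_imp_bounded[OF compact_continuous_image[OF f(1) Q(1)]] interior_subset
      by (meson bounded_subset image_mono)
    ultimately have "bounded (- P)" by simp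
    then have "bounded (UNIV :: complex set)"
      using compact_imp_bounded[OF Pc(1)] by (metis Compl_partition bounded_Un)
    then show False by simp
  qed
  moreover have "f ` frontier Q \<subseteq> P" using eq frQ by (auto simp: P_def)
  ultimately show ?thesis unfolding P_def[symmetric] using Qd by (metis Un_least image_Un)
qed

lemma Q1_eq_cbox: "Q1 l = cbox 0 (Complex l 1)"
proof -
  have "z \<in> Q1 l \<longleftrightarrow> z \<in> cbox 0 (Complex l 1)" for z
    unfolding Q1_def cbox_complex by (cases z) auto
  then show ?thesis by blast
qed

lemma interior_Q1: "interior (Q1 l) = box 0 (Complex l 1)"
  by (simp add: Q1_eq_cbox)

lemma linear_linear_stretch: "linear (linear_stretch k n)"
  by (auto intro!: linearI simp: linear_stretch_def complex_eq_iff algebra_simps)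

lemma inj_linear_stretch: "k > 0 \<Longrightarrow> inj (linear_stretch k n)"
  by (auto simp: inj_def linear_stretch_def complex_eq_iff)

lemma admissible_image_subset:
  assumes "k > 0" "l > 0" "f \<in> admissible k l n" "\<And>z. z \<in> frontier (Q1 l) \<Longrightarrow> f z = linear_stretch k n z"
  shows "f ` Q1 l \<subseteq> linear_stretch k n ` Q1 l"
proof (rule homeomorphic_image_subset_by_boundary)
  obtain g where h: "homeomorphism (Q1 l) (f ` Q1 l) f g" using assms(3) by (auto simp: admissible_def)
  then show "continuous_on (Q1 l) f" by (simp add: homeomorphism_def)
  show "inj_on f (Q1 l)" using h by (metis homeomorphism_apply1 inj_on_inverseI)
  show "compact (Q1 l)" "convex (Q1 l)" by (simp_all add: Q1_eq_cbox)
  have "Complex (l/2) (1/2) \<in> box 0 (Complex l 1)" using assms by (simp add: box_complex)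
  then show "interior (Q1 l) \<noteq> {}" unfolding interior_Q1 by blast
qed (use assms linear_linear_stretch inj_linear_stretch in auto)

text \<open>By Cavalieri's principle: every vertical section is an interval of length \<open>1\<close>.\<close>

lemma emeasure_parallelogram:
  assumes "k > 0" "l > 0"
  shows "emeasure lborel (linear_stretch k n ` Q1 l) = ennreal (k * l)"
proof -
  let ?P = "linear_stretch k n ` Q1 l"
  have Pset: "?P = {z. 0 \<le> Re z \<and> Re z \<le> k * l \<and> 0 \<le> Im z - n / k * Re z \<and> Im z - n / k * Re z \<le> 1}"
  proof (intro set_eqI iffI)
    fix z assume "z \<in> ?P"
    then obtain w where "w \<in> Q1 l" "z = linear_stretch k n w" by blast
    then show "z \<in> {z. 0 \<le> Re z \<and> Re z \<le> k * l \<and> 0 \<le> Im z - n / k * Re z \<and> Im z - n / k * Re z \<le> 1}"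
      using assms by (auto simp: Q1_eq_cbox cbox_complex linear_stretch_def)
  next
    fix z assume z: "z \<in> {z. 0 \<le> Re z \<and> Re z \<le> k * l \<and> 0 \<le> Im z - n / k * Re z \<and> Im z - n / k * Re z \<le> 1}"
    have "linear_stretch k n (Complex (Re z / k) (Im z - n / k * Re z)) = z"
      using assms by (simp add: linear_stretch_def complex_eq_iff)
    moreover have "Complex (Re z / k) (Im z - n / k * Re z) \<in> Q1 l"
      using z assms by (auto simp: Q1_eq_cbox cbox_complex field_simps)
    ultimately show "z \<in> ?P" by (metis imageI)
  qed
  have [measurable]: "?P \<in> sets borel"
  proof -
    have "closed ?P" unfolding Pset by (intro closed_Collect_conj closed_Collect_le continuous_intros)
    then show ?thesis by (rule borel_closed)
  qed
  have "emeasure lborel ?P = (\<integral>\<^sup>+p. indicator ?P (Complex (fst p) (snd p)) \<partial>(lborel \<Otimes>\<^sub>M lborel))"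
    by (subst lborel_complex_eq_distr, subst nn_integral_indicator[symmetric], simp, subst nn_integral_distr)
       (auto simp: case_prod_beta)
  also have "\<dots> = (\<integral>\<^sup>+x. (\<integral>\<^sup>+y. indicator ?P (Complex x y) \<partial>lborel) \<partial>lborel)"
    using measurable_case_prod_Complex by (subst lborel.nn_integral_fst[symmetric]) (auto simp: case_prod_beta)
  also have "\<dots> = (\<integral>\<^sup>+x. indicator {0..k*l} x \<partial>lborel)"
  proof (rule nn_integral_cong)
    fix x :: real
    have "(\<integral>\<^sup>+y. indicator ?P (Complex x y) \<partial>lborel) = (\<integral>\<^sup>+y. indicator {0..k*l} x * indicator {n/k*x..n/k*x+1} y \<partial>lborel)"
      unfolding Pset by (intro nn_integral_cong) (auto simp: indicator_def)
    also have "\<dots> = indicator {0..k*l} x" by (simp add: nn_integral_cmult)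
    finally show "(\<integral>\<^sup>+y. indicator ?P (Complex x y) \<partial>lborel) = indicator {0..k*l} x" .
  qed
  also have "\<dots> = ennreal (k * l)" using assms by simp
  finally show ?thesis .
qed

section \<open>Controlling the derivatives by the distortion defect\<close>

definition distortion_of :: "complex \<Rightarrow> complex \<Rightarrow> real" where
  "distortion_of a b = (if cmod b < cmod a then (cmod a + cmod b) / (cmod a - cmod b) else 1)"

lemma distortion_of_ge_1: "distortion_of a b \<ge> 1"
  by (simp add: distortion_of_def)

lemma distortion_of_gt_1: "b \<noteq> 0 \<Longrightarrow> cmod b < cmod a \<Longrightarrow> distortion_of a b > 1"
  by (simp add: distortion_of_def)

text \<open>The alternative \<open>a = 0 \<and> b = 0\<close> is the other pointwise possibility for a map of finite distortion; there
the default value \<open>1\<close> of the distortion is consistent with the identities.\<close>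

lemma distortion_identities:
  assumes "cmod b < cmod a \<or> a = 0 \<and> b = 0"
  defines "K \<equiv> distortion_of a b" and "t \<equiv> cmod a - cmod b"
  shows "t \<ge> 0" "cmod a + cmod b = K * t" "(cmod a)\<^sup>2 - (cmod b)\<^sup>2 = K * t\<^sup>2" "cmod b = (K - 1) * t / 2"
proof -
  show t: "t \<ge> 0" using assms by auto
  show s: "cmod a + cmod b = K * t" using assms(1) by (auto simp: K_def t_def distortion_of_def)
  have "(cmod a)\<^sup>2 - (cmod b)\<^sup>2 = (cmod a + cmod b) * t" by (simp add: t_def power2_eq_square algebra_simps)
  then show "(cmod a)\<^sup>2 - (cmod b)\<^sup>2 = K * t\<^sup>2" by (simp add: s power2_eq_square)
  show "cmod b = (K - 1) * t / 2" using s by (simp add: t_def algebra_simps)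
qed

lemma two_mult_le_weighted: "\<eta> > 0 \<Longrightarrow> 2 * (x * y) \<le> \<eta> * x\<^sup>2 + y\<^sup>2 / (\<eta>::real)"
proof -
  assume e: "\<eta> > 0"
  have "0 \<le> (\<eta> * x - y)\<^sup>2 / \<eta>" using e by simp
  also have "\<dots> = \<eta> * x\<^sup>2 + y\<^sup>2 / \<eta> - 2 * (x * y)"
    using e by (simp add: power2_eq_square field_simps)
  finally show ?thesis by simp
qed

lemma le_one_plus_square: "(x::real) \<le> 1 + x\<^sup>2"
proof (cases "x \<le> 1")
  case True
  then show ?thesis using zero_le_power2[of x] by linarith
next
  case False
  then have "x * 1 \<le> x * x" by (intro mult_left_mono) auto
  then show ?thesis by (simp add: power2_eq_square)
qed

lemma gradient_le_distortion_jacobian: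
  assumes "cmod b < cmod a \<or> a = 0 \<and> b = 0"
  shows "cmod a + cmod b \<le> (distortion_of a b + ((cmod a)\<^sup>2 - (cmod b)\<^sup>2)) / 2"
proof -
  define K where "K = distortion_of a b"
  define t where "t = cmod a - cmod b"
  have "2 * t \<le> 1 + t\<^sup>2" using zero_le_power2[of "t - 1"] by (simp add: power2_eq_square algebra_simps)
  then have "K * (2 * t) \<le> K * (1 + t\<^sup>2)"
    using distortion_of_ge_1[of a b] by (intro mult_left_mono) (auto simp: K_def)
  then show ?thesis
    using distortion_identities(2,3)[OF assms] unfolding K_def[symmetric] t_def[symmetric]
    by (simp add: distrib_left)
qed

lemma unit_dual_exists:
  obtains \<beta> :: complex where "cmod \<beta> = 1" "\<beta> * b0 = complex_of_real (cmod b0)"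
proof (cases "b0 = 0")
  case True then show ?thesis using that[of 1] by simp
next
  case False
  have "cnj b0 / complex_of_real (cmod b0) * b0 = complex_of_real (cmod b0)"
  proof -
    have "cnj b0 * b0 = complex_of_real (cmod b0) * complex_of_real (cmod b0)"
      using complex_norm_square[of b0] by (simp add: power2_eq_square mult.commute)
    then show ?thesis using False by (simp add: divide_eq_eq)
  qed
  then show ?thesis using that[of "cnj b0 / complex_of_real (cmod b0)"] False by (simp add: norm_divide)
qed

text \<open>After rotation by \<open>\<beta>\<close> the number \<open>b0\<close> becomes \<open>\<bar>b0\<bar>\<close>, and \<open>q = \<beta> * b\<close> satisfies
\<open>\<bar>q - \<bar>b\<bar>\<bar>\<^sup>2 = 2 * \<bar>b\<bar> * (\<bar>b\<bar> - Re q)\<close>; the weighted arithmetic-geometric mean inequality separates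
the factors.\<close>

lemma phase_defect_bound:
  assumes "cmod \<beta> = 1" "\<beta> * b0 = complex_of_real (cmod b0)" "\<eta> > 0"
  shows "cmod (b - b0) \<le> \<bar>cmod b - cmod b0\<bar> + \<eta> * cmod b + (cmod b - Re (\<beta> * b)) / (2 * \<eta>)"
proof -
  define q where "q = \<beta> * b"
  have cq: "cmod q = cmod b" using assms(1) by (simp add: q_def norm_mult)
  define D where "D = cmod b - Re q"
  have D: "D \<ge> 0" using complex_Re_le_cmod[of q] cq by (simp add: D_def)
  have "(cmod (q - complex_of_real (cmod b)))\<^sup>2 = (Re q - cmod b)\<^sup>2 + (Im q)\<^sup>2" by (simp add: cmod_power2)
  also have "\<dots> = ((Re q)\<^sup>2 + (Im q)\<^sup>2) + (cmod b)\<^sup>2 - 2 * Re q * cmod b" by (simp add: power2_diff)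
  also have "(Re q)\<^sup>2 + (Im q)\<^sup>2 = (cmod b)\<^sup>2" using cmod_power2[of q] cq by simp
  also have "(cmod b)\<^sup>2 + (cmod b)\<^sup>2 - 2 * Re q * cmod b = 2 * cmod b * D" by (simp add: D_def power2_eq_square algebra_simps)
  also have "\<dots> \<le> (\<eta> * cmod b + D / (2 * \<eta>))\<^sup>2"
  proof -
    have "(\<eta> * cmod b + D / (2 * \<eta>))\<^sup>2 - 2 * cmod b * D = (\<eta> * cmod b - D / (2 * \<eta>))\<^sup>2"
      using assms(3) by (simp add: power2_sum power2_diff)
    then show ?thesis using zero_le_power2[of "\<eta> * cmod b - D / (2 * \<eta>)"] by linarith
  qed
  finally have "cmod (q - complex_of_real (cmod b)) \<le> \<eta> * cmod b + D / (2 * \<eta>)"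
    by (rule power2_le_imp_le) (use assms(3) D in simp)
  moreover have "cmod (b - b0) = cmod (q - complex_of_real (cmod b0))"
  proof -
    have "q - complex_of_real (cmod b0) = \<beta> * (b - b0)" using assms(2) by (simp add: q_def algebra_simps)
    then show ?thesis using assms(1) by (simp add: norm_mult)
  qed
  moreover have "cmod (q - complex_of_real (cmod b0)) \<le> cmod (q - complex_of_real (cmod b)) + \<bar>cmod b - cmod b0\<bar>"
  proof -
    have eq: "q - complex_of_real (cmod b0) = (q - complex_of_real (cmod b)) + complex_of_real (cmod b - cmod b0)" by simp
    show ?thesis unfolding eq by (rule order_trans[OF norm_triangle_ineq]) (simp only: norm_of_real order_refl)
  qed
  ultimately show ?thesis by (simp add: D_def q_def)
qed

text \<open>With \<open>t\<close> and \<open>\<sigma>2\<close> for the values of \<open>\<bar>a\<bar> - \<bar>b\<bar>\<close>, the two terms on the left are \<open>\<bar>b\<bar>\<close> and \<open>\<bar>b0\<bar>\<close>.\<close>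

lemma modulus_defect_bound:
  fixes K K0 t \<sigma>2 \<eta> :: real
  assumes K: "K \<ge> 1" and t: "t \<ge> 0" and s2: "\<sigma>2 > 0" and \<eta>: "\<eta> > 0"
  shows "\<bar>(K - 1) * t / 2 - (K0 - 1) * \<sigma>2 / 2\<bar>
     \<le> \<eta> * (K + \<sigma>2) / 4 + (K * (t - \<sigma>2)\<^sup>2 + \<sigma>2 * (K - K0)\<^sup>2) / (4 * \<eta>)"
proof -
  have "(K - 1) * t / 2 - (K0 - 1) * \<sigma>2 / 2 = ((K - 1) * (t - \<sigma>2) + \<sigma>2 * (K - K0)) / 2" by (simp add: field_simps)
  also have "\<bar>\<dots>\<bar> \<le> (\<bar>(K - 1) * (t - \<sigma>2)\<bar> + \<bar>\<sigma>2 * (K - K0)\<bar>) / 2" by simp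
  also have "\<bar>(K - 1) * (t - \<sigma>2)\<bar> = (K - 1) * \<bar>t - \<sigma>2\<bar>" using K by (simp add: abs_mult)
  also have "\<bar>\<sigma>2 * (K - K0)\<bar> = \<sigma>2 * \<bar>K - K0\<bar>" using s2 by (simp add: abs_mult)
  finally have 1: "\<bar>(K - 1) * t / 2 - (K0 - 1) * \<sigma>2 / 2\<bar> \<le> ((K - 1) * \<bar>t - \<sigma>2\<bar> + \<sigma>2 * \<bar>K - K0\<bar>) / 2" .
  define X where "X = K * (\<eta> + (t - \<sigma>2)\<^sup>2 / \<eta>)"
  define Y where "Y = \<sigma>2 * (\<eta> + (K - K0)\<^sup>2 / \<eta>)"
  have "(K - 1) * \<bar>t - \<sigma>2\<bar> \<le> K * \<bar>t - \<sigma>2\<bar>" by (intro mult_right_mono) auto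
  moreover have "2 * (1 * \<bar>t - \<sigma>2\<bar>) \<le> \<eta> * 1\<^sup>2 + \<bar>t - \<sigma>2\<bar>\<^sup>2 / \<eta>" by (rule two_mult_le_weighted[OF \<eta>])
  then have "K * (2 * \<bar>t - \<sigma>2\<bar>) \<le> X" unfolding X_def using K by (intro mult_left_mono) auto
  moreover have "2 * (1 * \<bar>K - K0\<bar>) \<le> \<eta> * 1\<^sup>2 + \<bar>K - K0\<bar>\<^sup>2 / \<eta>" by (rule two_mult_le_weighted[OF \<eta>])
  then have "\<sigma>2 * (2 * \<bar>K - K0\<bar>) \<le> Y" unfolding Y_def using s2 by (intro mult_left_mono) auto
  ultimately have "(K - 1) * \<bar>t - \<sigma>2\<bar> + \<sigma>2 * \<bar>K - K0\<bar> \<le> (X + Y) / 2"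
    by (simp add: mult.left_commute)
  also have "\<dots> = (K * (\<eta> + (t - \<sigma>2)\<^sup>2 / \<eta>) + \<sigma>2 * (\<eta> + (K - K0)\<^sup>2 / \<eta>)) / 2"
    by (simp add: X_def Y_def)
  also have "\<dots> = 2 * (\<eta> * (K + \<sigma>2) / 4 + (K * (t - \<sigma>2)\<^sup>2 + \<sigma>2 * (K - K0)\<^sup>2) / (4 * \<eta>))"
    using \<eta> by (simp add: field_simps)
  finally have "((K - 1) * \<bar>t - \<sigma>2\<bar> + \<sigma>2 * \<bar>K - K0\<bar>) / 2
     \<le> (2 * (\<eta> * (K + \<sigma>2) / 4 + (K * (t - \<sigma>2)\<^sup>2 + \<sigma>2 * (K - K0)\<^sup>2) / (4 * \<eta>))) / 2"
    by (rule divide_right_mono) simp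
  also have "\<dots> = \<eta> * (K + \<sigma>2) / 4 + (K * (t - \<sigma>2)\<^sup>2 + \<sigma>2 * (K - K0)\<^sup>2) / (4 * \<eta>)"
    by (rule nonzero_mult_div_cancel_left) simp
  finally show ?thesis by (rule order_trans[OF 1])
qed

text \<open>Here \<open>s2\<close> is the smaller singular value of the reference map, \<open>d\<close> its Jacobian, and \<open>\<kappa>\<close> bounds the
integral of the distortion. The case distinction reflects that \<open>m\<close> may vanish if \<open>b0 = 0\<close>.\<close>

definition defect_constant :: "complex \<Rightarrow> complex \<Rightarrow> real \<Rightarrow> real \<Rightarrow> real \<Rightarrow> real \<Rightarrow> real" where
  "defect_constant a0 b0 A T m c =
    (let s2 = cmod a0 - cmod b0; d = (cmod a0)\<^sup>2 - (cmod b0)\<^sup>2; \<kappa> = (distortion_of a0 b0 + 1) * A + T / c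
     in if b0 = 0 then (d * A + T / c) / 4
        else (\<kappa> + d * A) / 2 + T * s2 / (4 * m) + \<kappa> / 4 + T * s2\<^sup>2 / (4 * m) + s2 * A / 4 + s2 * T / (4 * c))"

text \<open>Integrating the identity for \<open>K - K0\<close> described at the beginning bounds \<open>\<integral>(K - K0)\<close> from below by the
integrals of the phase defect \<open>D = \<bar>b\<bar> - Re (\<beta> b)\<close> and of \<open>E = K (t - s2)\<^sup>2\<close>. Together with the hypothesis
this makes the integrals of \<open>D\<close>, \<open>E\<close> and \<open>(K - K0)\<^sup>2\<close> of order \<open>\<epsilon>\<close>, provided that \<open>m > 0\<close>. The pointwise
bounds for the modulus and the phase of \<open>b\<close> with weight \<open>\<eta> = sqrt \<epsilon>\<close> then give order \<open>sqrt \<epsilon>\<close>. If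
\<open>b0 = 0\<close>, then \<open>K0 = 1\<close> and \<open>\<bar>b\<bar> = (K - 1) t / 2\<close>, so \<open>(K - K0)\<^sup>2\<close> and the bound for \<open>\<integral>J\<close> suffice.\<close>

lemma integral_dbar_defect:
  fixes a b :: "'x \<Rightarrow> complex"
  assumes M: "finite_measure M" and A: "measure M (space M) = A"
    and ia: "integrable M a" and ib: "integrable M b"
    and ma: "(LINT z|M. a z - a0) = 0" and mb: "(LINT z|M. b z - b0) = 0"
    and ab: "AE z in M. cmod (b z) < cmod (a z) \<or> a z = 0 \<and> b z = 0"
    and ab0: "cmod b0 < cmod a0"
    and iJ: "integrable M (\<lambda>z. (cmod (a z))\<^sup>2 - (cmod (b z))\<^sup>2)"
    and J: "(LINT z|M. (cmod (a z))\<^sup>2 - (cmod (b z))\<^sup>2) \<le> ((cmod a0)\<^sup>2 - (cmod b0)\<^sup>2) * A"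
    and K0: "K0 = distortion_of a0 b0"
    and iK: "integrable M (\<lambda>z. distortion_of (a z) (b z))"
    and iK2: "integrable M (\<lambda>z. (distortion_of (a z) (b z) - K0)\<^sup>2)"
    and m: "m \<ge> 0" "b0 \<noteq> 0 \<Longrightarrow> m > 0" and c: "c > 0" and T: "T \<ge> 0" and \<epsilon>: "0 < \<epsilon>" "\<epsilon> \<le> 1"
    and main: "(LINT z|M. m * (distortion_of (a z) (b z) - K0) + c * (distortion_of (a z) (b z) - K0)\<^sup>2) \<le> \<epsilon> * T"
  shows "(LINT z|M. cmod (b z - b0)) \<le> sqrt \<epsilon> * defect_constant a0 b0 A T m c"
proof -
  interpret finite_measure M by (rule M)
  define s2 where "s2 = cmod a0 - cmod b0"
  define d where "d = (cmod a0)\<^sup>2 - (cmod b0)\<^sup>2"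
  define \<kappa> where "\<kappa> = (K0 + 1) * A + T / c"
  have s2: "s2 > 0" using ab0 by (simp add: s2_def)
  obtain \<alpha> where \<alpha>: "cmod \<alpha> = 1" "\<alpha> * a0 = complex_of_real (cmod a0)" by (rule unit_dual_exists)
  obtain \<beta> where \<beta>: "cmod \<beta> = 1" "\<beta> * b0 = complex_of_real (cmod b0)" by (rule unit_dual_exists)
  define K where "K z = distortion_of (a z) (b z)" for z
  define Jc where "Jc z = (cmod (a z))\<^sup>2 - (cmod (b z))\<^sup>2" for z
  define s where "s z = cmod (a z) + cmod (b z)" for z
  define t where "t z = cmod (a z) - cmod (b z)" for z
  define D where "D z = cmod (b z) - Re (\<beta> * b z)" for z
  define Da where "Da z = cmod (a z) - Re (\<alpha> * a z)" for z
  define E where "E z = Jc z - 2 * s2 * s z + s2\<^sup>2 * K z" for z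
  note iK' = iK[folded K_def] and iK2' = iK2[folded K_def] and iJ' = iJ[folded Jc_def]
  have isz: "integrable M s" unfolding s_def using ia ib by auto
  have iD: "integrable M D" "integrable M Da" unfolding D_def Da_def using ia ib by auto
  have iE: "integrable M E" unfolding E_def using iJ' isz iK' by auto
  have D0: "D z \<ge> 0" "Da z \<ge> 0" for z
    using complex_Re_le_cmod[of "\<beta> * b z"] complex_Re_le_cmod[of "\<alpha> * a z"] \<alpha> \<beta> by (auto simp: D_def Da_def norm_mult)
  have K1: "K z \<ge> 1" for z by (simp add: K_def distortion_of_ge_1)
  have K0s: "K0 = (cmod a0 + cmod b0) / s2" using ab0 by (simp add: K0 distortion_of_def s2_def)
  have K01: "K0 \<ge> 1" by (simp add: K0 distortion_of_ge_1)
  have A0: "A \<ge> 0" using A by auto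
  have AEid: "AE z in M. t z \<ge> 0 \<and> s z = K z * t z \<and> Jc z = K z * (t z)\<^sup>2 \<and> cmod (b z) = (K z - 1) * t z / 2"
    using ab
  proof eventually_elim
    case (elim z)
    show ?case using distortion_identities[OF elim] unfolding t_def s_def K_def Jc_def by blast
  qed
  have AEE: "AE z in M. E z = K z * (t z - s2)\<^sup>2"
    using AEid by eventually_elim (simp add: E_def power2_diff algebra_simps power2_eq_square)
  have AEs: "AE z in M. s z \<le> (K z + Jc z) / 2"
    using ab by eventually_elim (simp only: s_def K_def Jc_def gradient_le_distortion_jacobian)
  \<comment> \<open>The vanishing means of \<open>a - a0\<close> and \<open>b - b0\<close> turn the excess of \<open>s\<close> into the two phase defects.\<close>
  have ss: "(LINT z|M. s z) = (cmod a0 + cmod b0) * A + (LINT z|M. Da z) + (LINT z|M. D z)"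
  proof -
    define ra where "ra z = \<alpha> * (a z - a0)" for z
    define rb where "rb z = \<beta> * (b z - b0)" for z
    have int: "integrable M ra" "integrable M rb" unfolding ra_def rb_def using ia ib by auto
    have "(LINT z|M. ra z) = 0" "(LINT z|M. rb z) = 0" unfolding ra_def rb_def using ma mb by simp_all
    then have 1: "(LINT z|M. Re (ra z)) = 0" "(LINT z|M. Re (rb z)) = 0"
      using int by (simp_all add: integral_Re)
    have 2: "s z = (cmod a0 + cmod b0) + Da z + D z + Re (ra z) + Re (rb z)" for z
    proof -
      have "Re (ra z) = Re (\<alpha> * a z) - cmod a0" "Re (rb z) = Re (\<beta> * b z) - cmod b0"
        unfolding ra_def rb_def right_diff_distrib \<alpha>(2) \<beta>(2) by simp_all
      then show ?thesis by (simp add: s_def Da_def D_def)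
    qed
    have 3: "integrable M (\<lambda>z. Re (ra z))" "integrable M (\<lambda>z. Re (rb z))" using int by auto
    show ?thesis unfolding 2
      using iD 3 1 by (simp add: A)
  qed
  have Kint: "(LINT z|M. K z - K0) = (2 / s2) * ((LINT z|M. s z) - (cmod a0 + cmod b0) * A) - (1 / s2\<^sup>2) * ((LINT z|M. Jc z) - d * A) + (LINT z|M. E z) / s2\<^sup>2"
  proof -
    have k: "cmod a0 + cmod b0 = K0 * s2" using s2 unfolding K0s by simp
    have dd: "d = K0 * s2 * s2" unfolding k[symmetric] by (simp add: d_def s2_def power2_eq_square algebra_simps)
    have r1: "(LINT z|M. E z) = (LINT z|M. Jc z) - 2 * s2 * (LINT z|M. s z) + s2\<^sup>2 * (LINT z|M. K z)"
      unfolding E_def using iJ' isz iK' by simp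
    have r2: "(LINT z|M. K z - K0) = (LINT z|M. K z) - K0 * A" using iK' by (simp add: A mult.commute)
    show ?thesis using s2 unfolding r1 r2 k dd by (simp add: field_simps power2_eq_square)
  qed
  have E0: "(LINT z|M. E z) \<ge> 0"
  proof (rule integral_nonneg_AE)
    have Kpos: "K z \<ge> 0" for z using K1[of z] by linarith
    show "AE z in M. 0 \<le> E z" by (rule AE_mp[OF AEE], rule AE_I2) (auto simp: Kpos)
  qed
  have Kint_ge: "(LINT z|M. K z - K0) \<ge> (2 / s2) * (LINT z|M. D z) + (LINT z|M. E z) / s2\<^sup>2"
  proof -
    have "(LINT z|M. Da z) \<ge> 0" using D0 by simp
    then have "(2 / s2) * ((LINT z|M. s z) - (cmod a0 + cmod b0) * A) \<ge> (2 / s2) * (LINT z|M. D z)"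
      using s2 ss by (intro mult_left_mono) auto
    moreover have "(1 / s2\<^sup>2) * ((LINT z|M. Jc z) - d * A) \<le> 0"
      using J unfolding Jc_def d_def by (intro mult_nonneg_nonpos) auto
    ultimately show ?thesis unfolding Kint by linarith
  qed
  have DI: "(LINT z|M. D z) \<ge> 0" using D0 by simp
  have K2I: "(LINT z|M. (K z - K0)\<^sup>2) \<ge> 0" by simp
  have "(LINT z|M. m * (K z - K0) + c * (K z - K0)\<^sup>2) = m * (LINT z|M. K z - K0) + c * (LINT z|M. (K z - K0)\<^sup>2)"
    using iK' iK2' by simp
  then have main': "m * (LINT z|M. K z - K0) + c * (LINT z|M. (K z - K0)\<^sup>2) \<le> \<epsilon> * T"
    using main by (simp add: K_def)
  have "m * ((2 / s2) * (LINT z|M. D z) + (LINT z|M. E z) / s2\<^sup>2) \<le> m * (LINT z|M. K z - K0)"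
    using Kint_ge m(1) by (rule mult_left_mono)
  then have tot: "m * ((2 / s2) * (LINT z|M. D z)) + m * ((LINT z|M. E z) / s2\<^sup>2) + c * (LINT z|M. (K z - K0)\<^sup>2) \<le> \<epsilon> * T"
    using main' by (simp add: distrib_left)
  have p1: "m * ((2 / s2) * (LINT z|M. D z)) \<ge> 0" "m * ((LINT z|M. E z) / s2\<^sup>2) \<ge> 0" "c * (LINT z|M. (K z - K0)\<^sup>2) \<ge> 0"
    using m(1) s2 DI E0 c by simp_all
  have bK2: "(LINT z|M. (K z - K0)\<^sup>2) \<le> \<epsilon> * T / c"
    using tot p1 c by (simp add: field_simps)
  define \<eta> where "\<eta> = sqrt \<epsilon>"
  have \<eta>: "\<eta> > 0" "\<eta> * \<eta> = \<epsilon>" using \<epsilon> by (simp_all add: \<eta>_def)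
  have div: "\<epsilon> * x / \<eta> = \<eta> * x" for x using \<eta> by (simp add: field_simps)
  have ibb: "integrable M (\<lambda>z. cmod (b z - b0))" using ib by auto
  have "(LINT z|M. cmod (b z - b0)) \<le> sqrt \<epsilon> *
     (if b0 = 0 then (d * A + T / c) / 4
      else (\<kappa> + d * A) / 2 + T * s2 / (4 * m) + \<kappa> / 4 + T * s2\<^sup>2 / (4 * m) + s2 * A / 4 + s2 * T / (4 * c))"
  proof (cases "b0 = 0")
    case True
    have K0e: "K0 = 1" using K0s True ab0 by (simp add: s2_def)
    have "AE z in M. cmod (b z - b0) \<le> \<eta> / 4 * Jc z + (1 / (4 * \<eta>)) * (K z - K0)\<^sup>2"
      using AEid
    proof eventually_elim
      case (elim z)
      have "4 * cmod (b z - b0) = 2 * (t z * (K z - 1))" using elim True by (simp add: mult.commute)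
      also have "\<dots> \<le> \<eta> * (t z)\<^sup>2 + (K z - 1)\<^sup>2 / \<eta>" by (rule two_mult_le_weighted[OF \<eta>(1)])
      also have "\<eta> * (t z)\<^sup>2 \<le> \<eta> * Jc z"
        using elim \<eta> K1[of z] mult_right_mono[of 1 "K z" "(t z)\<^sup>2"] by (intro mult_left_mono) auto
      finally show ?case using K0e by simp
    qed
    then have "(LINT z|M. cmod (b z - b0)) \<le> (LINT z|M. \<eta> / 4 * Jc z + (1 / (4 * \<eta>)) * (K z - K0)\<^sup>2)"
      using ibb iJ' iK2' by (intro integral_mono_AE) auto
    also have "\<dots> = \<eta> / 4 * (LINT z|M. Jc z) + (1 / (4 * \<eta>)) * (LINT z|M. (K z - K0)\<^sup>2)"
      using iJ' iK2' by simp
    also have "\<dots> \<le> \<eta> / 4 * (d * A) + (1 / (4 * \<eta>)) * (\<epsilon> * T / c)"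
      using \<eta> J bK2 unfolding Jc_def d_def by (intro add_mono mult_left_mono) auto
    also have "(1 / (4 * \<eta>)) * (\<epsilon> * T / c) = \<eta> / 4 * (T / c)"
      using \<eta>(1) by (simp add: \<eta>(2)[symmetric])
    finally show ?thesis using True by (simp add: \<eta>_def algebra_simps)
  next
    case False
    then have m0: "m > 0" by (rule m(2))
    have bD: "(LINT z|M. D z) \<le> \<epsilon> * (T * s2 / (2 * m))"
    proof -
      have "m * ((2 / s2) * (LINT z|M. D z)) \<le> \<epsilon> * T" using tot p1 by linarith
      then show ?thesis using m0 s2 by (simp add: field_simps)
    qed
    have bE: "(LINT z|M. E z) \<le> \<epsilon> * (T * s2\<^sup>2 / m)"
    proof -
      have "m * ((LINT z|M. E z) / s2\<^sup>2) \<le> \<epsilon> * T" using tot p1 by linarith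
      then show ?thesis using m0 s2 by (simp add: field_simps)
    qed
    have bK: "(LINT z|M. K z) \<le> \<kappa>"
    proof -
      have "K z \<le> (K0 + 1) + (K z - K0)\<^sup>2" for z
      proof -
        have "K z - K0 \<le> 1 + (K z - K0)\<^sup>2" by (rule le_one_plus_square)
        then show ?thesis by linarith
      qed
      then have "(LINT z|M. K z) \<le> (LINT z|M. (K0 + 1) + (K z - K0)\<^sup>2)"
        using iK' iK2' by (intro Bochner_Integration.integral_mono) auto
      also have "\<dots> = (K0 + 1) * A + (LINT z|M. (K z - K0)\<^sup>2)" using iK2' by (simp add: A algebra_simps)
      also have "(LINT z|M. (K z - K0)\<^sup>2) \<le> T / c"
      proof -
        have "\<epsilon> * T / c \<le> 1 * T / c" using \<epsilon> T c by (intro divide_right_mono mult_right_mono) auto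
        then show ?thesis using bK2 by simp
      qed
      finally show ?thesis by (simp add: \<kappa>_def)
    qed
    have bJ: "(LINT z|M. Jc z) \<le> d * A" using J unfolding Jc_def d_def .
    have b0e: "cmod b0 = (K0 - 1) * s2 / 2"
      using s2 unfolding K0s by (simp add: s2_def field_simps)
    let ?R = "\<lambda>z. \<eta> / 2 * (K z + Jc z) + (1 / (2 * \<eta>)) * D z + (\<eta> / 4 * (K z + s2) + (1 / (4 * \<eta>)) * (E z + s2 * (K z - K0)\<^sup>2))"
    have "AE z in M. cmod (b z - b0) \<le> ?R z"
      using AEid AEE AEs
    proof eventually_elim
      case (elim z)
      have "\<bar>cmod (b z) - cmod b0\<bar> \<le> \<eta> * (K z + s2) / 4 + (E z + s2 * (K z - K0)\<^sup>2) / (4 * \<eta>)"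
      proof -
        have tz: "t z \<ge> 0" and bz: "cmod (b z) = (K z - 1) * t z / 2" and Ez: "E z = K z * (t z - s2)\<^sup>2"
          using elim by blast+
        show ?thesis unfolding bz b0e Ez by (rule modulus_defect_bound[OF K1 tz s2 \<eta>(1)])
      qed
      moreover have "cmod (b z) \<le> (K z + Jc z) / 2"
      proof -
        have "cmod (b z) \<le> s z" by (simp add: s_def)
        then show ?thesis using elim by linarith
      qed
      then have "\<eta> * cmod (b z) \<le> \<eta> / 2 * (K z + Jc z)" using \<eta>(1) mult_left_mono[of "cmod (b z)" _ \<eta>] by fastforce
      moreover have "D z / (2 * \<eta>) = (1 / (2 * \<eta>)) * D z" by simp
      ultimately show ?case
        using phase_defect_bound[OF \<beta> \<eta>(1), of "b z"] unfolding D_def[symmetric] by simp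
    qed
    then have "(LINT z|M. cmod (b z - b0)) \<le> (LINT z|M. ?R z)"
      using ibb iJ' iK2' iK' iD iE by (intro integral_mono_AE) auto
    also have "\<dots> = \<eta> / 2 * ((LINT z|M. K z) + (LINT z|M. Jc z)) + (1 / (2 * \<eta>)) * (LINT z|M. D z)
        + (\<eta> / 4 * ((LINT z|M. K z) + s2 * A) + (1 / (4 * \<eta>)) * ((LINT z|M. E z) + s2 * (LINT z|M. (K z - K0)\<^sup>2)))"
      using iJ' iK2' iK' iD iE by (simp add: A mult.commute)
    also have "\<dots> \<le> \<eta> / 2 * (\<kappa> + d * A) + (1 / (2 * \<eta>)) * (\<epsilon> * (T * s2 / (2 * m)))
        + (\<eta> / 4 * (\<kappa> + s2 * A) + (1 / (4 * \<eta>)) * (\<epsilon> * (T * s2\<^sup>2 / m) + s2 * (\<epsilon> * T / c)))"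
      using \<eta>(1) s2 by (intro add_mono mult_left_mono bK bJ bD bE bK2 order_refl) auto
    also have "\<dots> = \<eta> * ((\<kappa> + d * A) / 2 + T * s2 / (4 * m) + \<kappa> / 4 + T * s2\<^sup>2 / (4 * m) + s2 * A / 4 + s2 * T / (4 * c))"
      unfolding \<eta>(2)[symmetric] using \<eta>(1) m0 c by (simp add: field_simps)
    finally show ?thesis using False by (simp add: \<eta>_def)
  qed
  then show ?thesis by (simp only: defect_constant_def Let_def s2_def d_def \<kappa>_def K0)
qed

section \<open>Admissible maps and the linear stretch\<close>

lemma AE_Q1_iff: "AE z in lborel. z \<in> Q1 l \<longleftrightarrow> z \<in> box 0 (Complex l 1)"
proof -
  have "negligible (cbox 0 (Complex l 1) - box 0 (Complex l 1))" by (rule negligible_frontier_interval)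
  then have "cbox 0 (Complex l 1) - box 0 (Complex l 1) \<in> null_sets lebesgue"
    by (simp add: negligible_iff_null_sets)
  then have "AE z in lebesgue. z \<notin> cbox 0 (Complex l 1) - box 0 (Complex l 1)" by (rule AE_not_in)
  then have "AE z in lborel. z \<notin> cbox 0 (Complex l 1) - box 0 (Complex l 1)" by (simp only: AE_completion_iff)
  then show ?thesis
    by eventually_elim (use box_subset_cbox in \<open>auto simp: Q1_eq_cbox\<close>)
qed

text \<open>If \<open>\<bar>b\<bar> \<ge> \<bar>a\<bar>\<close>, the Jacobian is not positive, so the distortion inequality forces \<open>\<bar>a\<bar> + \<bar>b\<bar> = 0\<close>.\<close>

lemma finite_distortion_pointwise:
  assumes "finite_distortion \<Omega> f" "\<Omega> \<in> sets lebesgue"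
  shows "AE z in lborel. z \<in> \<Omega> \<longrightarrow>
     cmod (dzbar \<Omega> f z) < cmod (dz \<Omega> f z) \<or> dz \<Omega> f z = 0 \<and> dzbar \<Omega> f z = 0"
proof -
  obtain K :: "complex \<Rightarrow> ereal" where "AE z in lebesgue_on \<Omega>. 1 \<le> K z \<and> K z < \<infinity> \<and>
           ereal ((norm_D \<Omega> f z)\<^sup>2) \<le> K z * ereal (Jac \<Omega> f z)"
    using assms(1) unfolding finite_distortion_def by blast
  then have "AE z in lebesgue. z \<in> \<Omega> \<longrightarrow> 1 \<le> K z \<and> K z < \<infinity> \<and>
           ereal ((norm_D \<Omega> f z)\<^sup>2) \<le> K z * ereal (Jac \<Omega> f z)"
    using assms(2) by (subst (asm) AE_restrict_space_iff) auto
  then have "AE z in lborel. z \<in> \<Omega> \<longrightarrow> 1 \<le> K z \<and> K z < \<infinity> \<and>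
           ereal ((norm_D \<Omega> f z)\<^sup>2) \<le> K z * ereal (Jac \<Omega> f z)"
    by (simp add: AE_completion_iff)
  then show ?thesis
  proof eventually_elim
    case (elim z)
    show ?case
    proof
      assume z: "z \<in> \<Omega>"
      define p where "p = cmod (dz \<Omega> f z)"
      define q where "q = cmod (dzbar \<Omega> f z)"
      have pq: "p \<ge> 0" "q \<ge> 0" by (simp_all add: p_def q_def)
      obtain r where r: "K z = ereal r" "r \<ge> 1"
        using elim z by (cases "K z") (auto simp: one_ereal_def)
      then have le: "(p + q)\<^sup>2 \<le> r * (p\<^sup>2 - q\<^sup>2)"
        using elim z by (simp add: norm_D_def Jac_def p_def q_def)
      show "cmod (dzbar \<Omega> f z) < cmod (dz \<Omega> f z) \<or> dz \<Omega> f z = 0 \<and> dzbar \<Omega> f z = 0"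
      proof (cases "q < p")
        case True then show ?thesis by (simp add: p_def q_def)
      next
        case False
        then have "p\<^sup>2 \<le> q\<^sup>2" using pq by (intro power_mono) auto
        then have "r * (p\<^sup>2 - q\<^sup>2) \<le> 0" using r by (intro mult_nonneg_nonpos) auto
        then have "(p + q)\<^sup>2 \<le> 0" using le by linarith
        then have "p + q = 0" by simp
        then have "p = 0" "q = 0" using pq by linarith+
        then show ?thesis by (simp add: p_def q_def)
      qed
    qed
  qed
qed

definition stretch_dz :: "real \<Rightarrow> real \<Rightarrow> complex" where "stretch_dz k n = Complex ((k + 1) / 2) (n / 2)"
definition stretch_dzbar :: "real \<Rightarrow> real \<Rightarrow> complex" where "stretch_dzbar k n = Complex ((k - 1) / 2) (n / 2)"

lemma stretch_jacobian: "(cmod (stretch_dz k n))\<^sup>2 - (cmod (stretch_dzbar k n))\<^sup>2 = k"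
  unfolding cmod_power2 by (simp add: stretch_dz_def stretch_dzbar_def power2_eq_square field_simps)

lemma stretch_dzbar_less: "k > 0 \<Longrightarrow> cmod (stretch_dzbar k n) < cmod (stretch_dz k n)"
  using stretch_jacobian[of k n] by (intro power2_less_imp_less[of "cmod (stretch_dzbar k n)"]) auto

text \<open>The choice in \<open>weak_deriv\<close> agrees with the classical derivative only almost everywhere, by uniqueness.\<close>

lemma weak_deriv_linear_stretch:
  "AE z in lborel. z \<in> box 0 c \<longrightarrow> weak_deriv (box 0 c) v (linear_stretch k n) z = linear_stretch k n v"
proof -
  have bl: "bounded_linear (linear_stretch k n)"
    using linear_linear_stretch linear_conv_bounded_linear by blast
  have "is_weak_deriv (box 0 c) v (linear_stretch k n) (weak_deriv (box 0 c) v (linear_stretch k n))"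
    unfolding weak_deriv_def
    by (rule someI[of _ "\<lambda>_. linear_stretch k n v"]) (rule is_weak_deriv_linear[OF bl])
  from weak_deriv_unique[OF this is_weak_deriv_linear[OF bl]]
  show ?thesis by (simp add: AE_completion_iff)
qed

lemma mean_distortion_eq_nn_integral:
  assumes "AE z in lborel. z \<in> box 0 (Complex l 1) \<longrightarrow> dz (box 0 (Complex l 1)) f z = a z"
    "AE z in lborel. z \<in> box 0 (Complex l 1) \<longrightarrow> dzbar (box 0 (Complex l 1)) f z = b z"
  shows "mean_distortion \<phi> l f
    = (\<integral>\<^sup>+z. ennreal (\<phi> (distortion_of (a z) (b z))) * indicator (box 0 (Complex l 1)) z \<partial>lborel)"
  unfolding mean_distortion_def interior_Q1 nn_integral_completion
proof (rule nn_integral_cong_AE)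
  show "AE z in lborel. ennreal (\<phi> (lin_dist (box 0 (Complex l 1)) f z)) * indicator (Q1 l) z
      = ennreal (\<phi> (distortion_of (a z) (b z))) * indicator (box 0 (Complex l 1)) z"
    using assms AE_Q1_iff[of l]
    by eventually_elim (auto simp: indicator_def lin_dist_def distortion_of_def)
qed

lemma emeasure_rectangle: "l > 0 \<Longrightarrow> emeasure lborel (box 0 (Complex l 1)) = ennreal l"
  by (subst emeasure_lborel_box) (auto simp: Basis_complex_def)

lemma mean_distortion_linear_stretch:
  assumes "l > 0"
  shows "mean_distortion \<phi> l (linear_stretch k n)
    = ennreal (\<phi> (distortion_of (stretch_dz k n) (stretch_dzbar k n))) * ennreal l"
proof -
  let ?\<Omega> = "box 0 (Complex l 1)"
  have 1: "linear_stretch k n 1 = Complex k n" "linear_stretch k n \<i> = \<i>"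
    by (auto simp: linear_stretch_def complex_eq_iff)
  have "mean_distortion \<phi> l (linear_stretch k n)
    = (\<integral>\<^sup>+z. ennreal (\<phi> (distortion_of (stretch_dz k n) (stretch_dzbar k n))) * indicator ?\<Omega> z \<partial>lborel)"
  proof (rule mean_distortion_eq_nn_integral)
    note w = weak_deriv_linear_stretch[of "Complex l 1" 1 k n, unfolded 1] weak_deriv_linear_stretch[of "Complex l 1" \<i> k n, unfolded 1]
    show "AE z in lborel. z \<in> ?\<Omega> \<longrightarrow> dz ?\<Omega> (linear_stretch k n) z = stretch_dz k n"
      using w by eventually_elim (simp add: dz_def stretch_dz_def complex_eq_iff)
    show "AE z in lborel. z \<in> ?\<Omega> \<longrightarrow> dzbar ?\<Omega> (linear_stretch k n) z = stretch_dzbar k n"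
      using w by eventually_elim (simp add: dzbar_def stretch_dzbar_def complex_eq_iff)
  qed
  also have "\<dots> = ennreal (\<phi> (distortion_of (stretch_dz k n) (stretch_dzbar k n))) * ennreal l"
    using assms by (simp add: nn_integral_cmult_indicator emeasure_rectangle)
  finally show ?thesis .
qed

section \<open>Stability of the linear stretch\<close>

lemma AE_restrict_space_lborel:
  assumes "AE z in lborel. z \<in> \<Omega> \<longrightarrow> P z" "\<Omega> \<in> sets borel"
  shows "AE z in restrict_space lborel \<Omega>. P z"
  using assms by (subst AE_restrict_space_iff) auto

lemma jacobian_wirtinger: "Re (a + b) * Im (\<i> * (a - b)) - Im (a + b) * Re (\<i> * (a - b)) = (cmod a)\<^sup>2 - (cmod b)\<^sup>2"
  unfolding cmod_power2 by (simp add: power2_eq_square algebra_simps)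

definition displacement :: "real \<Rightarrow> real \<Rightarrow> real \<Rightarrow> (complex \<Rightarrow> complex) \<Rightarrow> complex \<Rightarrow> complex" where
  "displacement k l n f z = (if z \<in> Q1 l then f z - linear_stretch k n z else 0)"

lemma continuous_displacement:
  assumes f: "continuous_on (Q1 l) f" and eq: "\<And>z. z \<in> frontier (Q1 l) \<Longrightarrow> f z = linear_stretch k n z"
  shows "continuous_on UNIV (displacement k l n f)"
proof -
  have bl: "bounded_linear (linear_stretch k n)"
    using linear_linear_stretch linear_conv_bounded_linear by blast
  have clQ: "closed (Q1 l)" unfolding Q1_eq_cbox by (rule closed_cbox)
  have "continuous_on (Q1 l \<union> closure (- Q1 l)) (\<lambda>z. if z \<in> Q1 l then f z - linear_stretch k n z else 0)"
  proof (rule continuous_on_cases[OF clQ])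
    show "continuous_on (Q1 l) (\<lambda>z. f z - linear_stretch k n z)"
      by (intro continuous_intros f linear_continuous_on bl)
    show "\<forall>z. z \<in> Q1 l \<and> z \<notin> Q1 l \<or> z \<in> closure (- Q1 l) \<and> z \<in> Q1 l \<longrightarrow> f z - linear_stretch k n z = 0"
    proof (intro allI impI)
      fix z assume "z \<in> Q1 l \<and> z \<notin> Q1 l \<or> z \<in> closure (- Q1 l) \<and> z \<in> Q1 l"
      then have "z \<in> frontier (Q1 l)" using clQ by (auto simp: frontier_closures closure_closed)
      then show "f z - linear_stretch k n z = 0" using eq by simp
    qed
  qed auto
  moreover have "Q1 l \<union> closure (- Q1 l) = UNIV" using closure_subset[of "- Q1 l"] by auto
  ultimately show ?thesis by (simp add: displacement_def[abs_def])
qed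

text \<open>The quadratic term of the support function makes \<open>(K - K0)\<^sup>2\<close>, and hence \<open>K\<close>, integrable. In the integral
of the support inequality the constant term contributes \<open>T\<close>, and the rest is the third claim.\<close>

lemma convexity_deficit:
  assumes M: "finite_measure M" and Km [measurable]: "K \<in> borel_measurable M"
    and K1: "\<And>z. K z \<ge> (1::real)" and K01: "K0 \<ge> 1"
    and m: "m \<ge> 0" and c: "c > 0" and ge1: "\<And>t. t \<ge> 1 \<Longrightarrow> \<phi> t \<ge> 1"
    and lower: "\<And>t. t \<ge> 1 \<Longrightarrow> \<phi> t \<ge> \<phi> K0 + m * (t - K0) + c * (t - K0)\<^sup>2"
    and T: "T = \<phi> K0 * measure M (space M)" and \<epsilon>: "\<epsilon> \<ge> 0"
    and mean: "(\<integral>\<^sup>+z. ennreal (\<phi> (K z)) \<partial>M) \<le> ennreal (T + \<epsilon> * T)"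
  shows "integrable M K" and "integrable M (\<lambda>z. (K z - K0)\<^sup>2)"
    and "(LINT z|M. m * (K z - K0) + c * (K z - K0)\<^sup>2) \<le> \<epsilon> * T"
proof -
  interpret finite_measure M by (rule M)
  have \<phi>0: "\<phi> K0 \<ge> 0" using ge1[OF K01] by simp
  \<comment> \<open>A nonnegative minorant of \<open>\<phi> (K z)\<close> that is quadratic in \<open>K\<close>, using \<open>\<phi> K0 \<ge> 0\<close> and \<open>m * K z \<ge> 0\<close>.\<close>
  define y where "y z = max 0 (c * (K z - K0)\<^sup>2 - m * K0)" for z
  have "integrable M y"
  proof (rule integrableI_bounded)
    show "y \<in> borel_measurable M" unfolding y_def by measurable
    have "(\<integral>\<^sup>+z. ennreal (norm (y z)) \<partial>M) \<le> (\<integral>\<^sup>+z. ennreal (\<phi> (K z)) \<partial>M)"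
    proof (rule nn_integral_mono, rule ennreal_leI)
      fix z
      have mK: "m * K z \<ge> 0" using m K1[of z] by simp
      have "c * (K z - K0)\<^sup>2 - m * K0 \<le> \<phi> (K z)"
        using lower[OF K1, of z] \<phi>0 mK unfolding right_diff_distrib by linarith
      moreover have "0 \<le> \<phi> (K z)" using ge1[OF K1, of z] by simp
      ultimately show "norm (y z) \<le> \<phi> (K z)" by (simp add: y_def)
    qed
    also have "\<dots> < \<infinity>" using mean by (rule le_less_trans) simp
    finally show "(\<integral>\<^sup>+z. ennreal (norm (y z)) \<partial>M) < \<infinity>" .
  qed
  then have iy: "integrable M (\<lambda>z. (y z + m * K0) / c)" by simp
  have iK2: "integrable M (\<lambda>z. (K z - K0)\<^sup>2)"
  proof (rule Bochner_Integration.integrable_bound[OF iy])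
    show "(\<lambda>z. (K z - K0)\<^sup>2) \<in> borel_measurable M" by measurable
    have "(K z - K0)\<^sup>2 \<le> (y z + m * K0) / c" for z
    proof -
      have "c * (K z - K0)\<^sup>2 - m * K0 \<le> y z" by (simp add: y_def)
      then show ?thesis using c by (simp add: pos_le_divide_eq mult.commute)
    qed
    then show "AE z in M. norm ((K z - K0)\<^sup>2) \<le> norm ((y z + m * K0) / c)"
      by (intro AE_I2) (metis abs_ge_self order_trans real_norm_def abs_power2)
  qed
  have iK: "integrable M K"
  proof (rule Bochner_Integration.integrable_bound)
    show "integrable M (\<lambda>z. (K0 + 1) + (K z - K0)\<^sup>2)" using iK2 by simp
    show "K \<in> borel_measurable M" by (rule Km)
    have "norm (K z) \<le> norm ((K0 + 1) + (K z - K0)\<^sup>2)" for z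
    proof -
      have "K z - K0 \<le> 1 + (K z - K0)\<^sup>2" by (rule le_one_plus_square)
      then show ?thesis using K1[of z] K01 by simp
    qed
    then show "AE z in M. norm (K z) \<le> norm ((K0 + 1) + (K z - K0)\<^sup>2)" by simp
  qed
  have iq: "integrable M (\<lambda>z. m * (K z - K0) + c * (K z - K0)\<^sup>2)" using iK iK2 by simp
  have main: "(LINT z|M. m * (K z - K0) + c * (K z - K0)\<^sup>2) \<le> \<epsilon> * T"
  proof -
    have i: "integrable M (\<lambda>z. \<phi> K0 + (m * (K z - K0) + c * (K z - K0)\<^sup>2))" using iq by simp
    have "(LINT z|M. \<phi> K0 + (m * (K z - K0) + c * (K z - K0)\<^sup>2)) \<le> T + \<epsilon> * T"
    proof (rule integral_real_bounded)
      have "(\<integral>\<^sup>+z. ennreal (\<phi> K0 + (m * (K z - K0) + c * (K z - K0)\<^sup>2)) \<partial>M) \<le> (\<integral>\<^sup>+z. ennreal (\<phi> (K z)) \<partial>M)"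
        using lower[OF K1] by (intro nn_integral_mono ennreal_leI) (simp add: add.assoc)
      then show "(\<integral>\<^sup>+z. ennreal (\<phi> K0 + (m * (K z - K0) + c * (K z - K0)\<^sup>2)) \<partial>M) \<le> ennreal (T + \<epsilon> * T)"
        using mean by (rule order_trans)
      show "T + \<epsilon> * T \<ge> 0" using T \<epsilon> \<phi>0 by simp
    qed
    moreover have "(LINT z|M. \<phi> K0 + (m * (K z - K0) + c * (K z - K0)\<^sup>2))
       = T + (LINT z|M. m * (K z - K0) + c * (K z - K0)\<^sup>2)"
      using iq by (subst Bochner_Integration.integral_add) (simp_all add: T mult.commute)
    ultimately show ?thesis by simp
  qed
  show "integrable M K" "integrable M (\<lambda>z. (K z - K0)\<^sup>2)"
    "(LINT z|M. m * (K z - K0) + c * (K z - K0)\<^sup>2) \<le> \<epsilon> * T" by fact+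
qed

lemma integrable_wirtinger:
  fixes a b :: "'x \<Rightarrow> complex"
  assumes iK: "integrable M (\<lambda>z. distortion_of (a z) (b z))"
    and iJ: "integrable M (\<lambda>z. (cmod (a z))\<^sup>2 - (cmod (b z))\<^sup>2)"
    and ab: "AE z in M. cmod (b z) < cmod (a z) \<or> a z = 0 \<and> b z = 0"
    and meas: "a \<in> borel_measurable M" "b \<in> borel_measurable M"
  shows "integrable M a" and "integrable M b"
proof -
  let ?B = "\<lambda>z. (distortion_of (a z) (b z) + ((cmod (a z))\<^sup>2 - (cmod (b z))\<^sup>2)) / 2"
  have i: "integrable M ?B" using iK iJ by simp
  have le: "AE z in M. cmod (a z) + cmod (b z) \<le> norm (?B z)"
    using ab
  proof eventually_elim
    case (elim z)
    show ?case using gradient_le_distortion_jacobian[OF elim] unfolding real_norm_def by linarith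
  qed
  show "integrable M a"
    by (rule Bochner_Integration.integrable_bound[OF i meas(1)], rule AE_mp[OF le], rule AE_I2)
       (use norm_ge_zero in \<open>auto elim: order_trans[rotated]\<close>)
  show "integrable M b"
    by (rule Bochner_Integration.integrable_bound[OF i meas(2)], rule AE_mp[OF le], rule AE_I2)
       (use norm_ge_zero in \<open>auto elim: order_trans[rotated]\<close>)
qed

text \<open>The weak derivative of \<open>f - L\<close> on the rectangle extends by zero. As \<open>W\<close> is determined only on the
rectangle, and there only up to null sets, \<open>w\<close> stands for a representative for which the extension is
Borel measurable.\<close>

lemma displacement_weak_derivative:
  fixes f G L W w :: "complex \<Rightarrow> complex"
  assumes L: "bounded_linear L" and W: "is_weak_deriv (box a b) v f W" and v: "\<bar>Re v\<bar> \<le> 1" "\<bar>Im v\<bar> \<le> 1"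
    and cG: "continuous_on UNIV G" and G_out: "\<And>z. z \<notin> box a b \<Longrightarrow> G z = 0"
    and G_eq: "\<And>z. z \<in> box a b \<Longrightarrow> f z - L z = G z" and ne: "a \<in> cbox a b"
    and w: "AE z in lborel. indicator (box a b) z *\<^sub>R W z = w z"
    and iV: "integrable lborel (\<lambda>z. indicator (box a b) z *\<^sub>R (w z - L v))"
    and h: "flat_generated h"
  shows "(LINT z|lborel. frechet_derivative h (at z) v *\<^sub>R G z)
    = - (LINT z|lborel. h z *\<^sub>R (indicator (box a b) z *\<^sub>R (w z - L v)))"
proof -
  define V where "V z = indicator (box a b) z *\<^sub>R (w z - L v)" for z
  define \<Omega> where "\<Omega> = box a b"
  note iV = iV[folded V_def \<Omega>_def]
  have V: "V z = indicator \<Omega> z *\<^sub>R (w z - L v)" for z by (simp add: V_def \<Omega>_def)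
  have [measurable]: "\<Omega> \<in> sets borel" by (simp add: \<Omega>_def)
  have Vm: "V \<in> borel_measurable borel" using iV by auto
  have ae: "AE z in lebesgue. indicator \<Omega> z *\<^sub>R (W z - L v) = V z"
    using AE_completion[OF w] unfolding \<Omega>_def[symmetric] by eventually_elim (auto simp: V indicator_def)
  have gi: "set_integrable lebesgue \<Omega> (\<lambda>z. W z - L v)"
  proof -
    have "integrable lebesgue V" using iV integrable_lebesgue_iff(1)[OF Vm] by blast
    moreover have Wm: "(\<lambda>z. indicator \<Omega> z *\<^sub>R W z) \<in> borel_measurable lebesgue"
      using W unfolding \<Omega>_def is_weak_deriv_def by (auto intro: locally_integrable_measurable)
    have "(\<lambda>z. indicator \<Omega> z *\<^sub>R L v) \<in> borel_measurable borel" by measurable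
    then have "(\<lambda>z. indicator \<Omega> z *\<^sub>R W z - indicator \<Omega> z *\<^sub>R L v) \<in> borel_measurable lebesgue"
      using Wm by (intro borel_measurable_diff) (simp_all add: measurable_completion)
    then have "(\<lambda>z. indicator \<Omega> z *\<^sub>R (W z - L v)) \<in> borel_measurable lebesgue" by (simp add: scaleR_diff_right)
    ultimately show ?thesis unfolding set_integrable_def
      using ae by (blast intro: integrable_cong_AE[THEN iffD2] borel_measurable_integrable)
  qed
  have "is_weak_deriv \<Omega> v G (\<lambda>z. W z - L v)"
  proof (rule is_weak_deriv_cong)
    show "is_weak_deriv \<Omega> v (\<lambda>z. f z - L z) (\<lambda>z. W z - L v)"
      unfolding \<Omega>_def by (rule is_weak_deriv_diff[OF W is_weak_deriv_linear[OF L]])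
  qed (use G_eq in \<open>simp add: \<Omega>_def\<close>)
  then have "(LINT z|lborel. frechet_derivative h (at z) v *\<^sub>R G z) = - (LINT z:\<Omega>|lebesgue. h z *\<^sub>R (W z - L v))"
    unfolding \<Omega>_def
    by (rule zero_extension_weak_derivative[OF _ v cG _ _ h])
       (use G_out gi ne in \<open>auto simp: \<Omega>_def\<close>)
  also have "(LINT z:\<Omega>|lebesgue. h z *\<^sub>R (W z - L v)) = (LINT z|lborel. h z *\<^sub>R V z)"
  proof -
    have hm: "h \<in> borel_measurable borel"
      using flat_generated_continuous[OF h] by (rule borel_measurable_continuous_onI)
    have "(LINT z:\<Omega>|lebesgue. h z *\<^sub>R (W z - L v)) = (LINT z|lebesgue. h z *\<^sub>R (indicator \<Omega> z *\<^sub>R (W z - L v)))"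
      unfolding set_lebesgue_integral_def by (simp add: mult.commute)
    also have "\<dots> = (LINT z|lebesgue. h z *\<^sub>R V z)"
    proof (rule integral_cong_AE)
      have "h \<in> borel_measurable lebesgue" using hm by (simp add: measurable_completion)
      moreover have "V \<in> borel_measurable lebesgue" using Vm by (simp add: measurable_completion)
      moreover note borel_measurable_integrable[OF gi[unfolded set_integrable_def]]
      ultimately show "(\<lambda>z. h z *\<^sub>R (indicator \<Omega> z *\<^sub>R (W z - L v))) \<in> borel_measurable lebesgue"
        "(\<lambda>z. h z *\<^sub>R V z) \<in> borel_measurable lebesgue"
        by - (rule borel_measurable_scaleR; assumption)+
      show "AE z in lebesgue. h z *\<^sub>R (indicator \<Omega> z *\<^sub>R (W z - L v)) = h z *\<^sub>R V z"
        using ae by eventually_elim simp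
    qed
    also have "\<dots> = (LINT z|lborel. h z *\<^sub>R V z)"
      using hm Vm by (intro integrable_lebesgue_iff(2)) (rule borel_measurable_scaleR)
    finally show ?thesis .
  qed
  finally show ?thesis by (simp add: V_def)
qed

text \<open>The displacement is a compactly supported Sobolev function, so its gradient has mean zero, and the area
inequality for \<open>f = f\<^sup>* + G\<close> together with the inclusion of the images bounds the integral of the
Jacobian by the area \<open>k * l\<close>. These are the hypotheses of \<open>integral_dbar_defect\<close>; the conclusion follows
by the Cauchy type estimate, with a disc of radius \<open>l + 1\<close> that contains the rectangle.\<close>

lemma admissible_L1_estimate:
  assumes kl: "k > 0" "l > 0" and f: "f \<in> admissible k l n"
    and bd: "\<And>z. z \<in> frontier (Q1 l) \<Longrightarrow> f z = linear_stretch k n z"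
    and K0: "K0 = distortion_of (stretch_dz k n) (stretch_dzbar k n)"
    and m: "m \<ge> 0" "stretch_dzbar k n \<noteq> 0 \<Longrightarrow> m > 0" and c: "c > 0"
    and ge1: "\<And>t. t \<ge> 1 \<Longrightarrow> \<phi> t \<ge> 1"
    and lower: "\<And>t. t \<ge> 1 \<Longrightarrow> \<phi> t \<ge> \<phi> K0 + m * (t - K0) + c * (t - K0)\<^sup>2"
    and \<epsilon>: "0 < \<epsilon>" "\<epsilon> \<le> 1"
    and le: "mean_distortion \<phi> l f \<le> ennreal (1 + \<epsilon>) * mean_distortion \<phi> l (linear_stretch k n)"
  shows "(\<integral>\<^sup>+z. ennreal (cmod (displacement k l n f z)) \<partial>lborel)
     \<le> ennreal ((2 * (l + 1) + 1) * (2 * (sqrt \<epsilon> * defect_constant (stretch_dz k n) (stretch_dzbar k n) l (\<phi> K0 * l) m c)))"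
proof -
  define \<Omega> where "\<Omega> = box 0 (Complex l 1)"
  define Q where "Q = cbox 0 (Complex l 1)"
  define L where "L = linear_stretch k n"
  define G where "G = displacement k l n f"
  define a0 where "a0 = stretch_dz k n"
  define b0 where "b0 = stretch_dzbar k n"
  define W1 where "W1 = weak_deriv \<Omega> 1 f"
  define W2 where "W2 = weak_deriv \<Omega> \<i> f"
  have Q1Q: "Q1 l = Q" by (simp add: Q_def Q1_eq_cbox)
  have intQ: "interior (Q1 l) = \<Omega>" by (simp add: \<Omega>_def interior_Q1)
  have \<Omega>Q: "\<Omega> \<subseteq> Q" unfolding \<Omega>_def Q_def by (rule box_subset_cbox)
  have [measurable]: "\<Omega> \<in> sets borel" by (simp add: \<Omega>_def)
  have bl: "bounded_linear L"
    unfolding L_def using linear_linear_stretch linear_conv_bounded_linear by blast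
  have L1: "L 1 = Complex k n" "L \<i> = \<i>" by (auto simp: L_def linear_stretch_def complex_eq_iff)
  have ab0: "L 1 = a0 + b0" "L \<i> = \<i> * (a0 - b0)"
    by (auto simp: L1 a0_def b0_def stretch_dz_def stretch_dzbar_def complex_eq_iff field_simps)
  obtain fi where hom: "homeomorphism (Q1 l) (f ` Q1 l) f fi" using f by (auto simp: admissible_def)
  have cf: "continuous_on Q f" using hom by (simp add: homeomorphism_def Q1Q)
  have injf: "inj_on f Q" using hom unfolding Q1Q by (metis homeomorphism_apply1 inj_on_inverseI)
  have fd: "finite_distortion \<Omega> f" using f by (simp add: admissible_def intQ)
  have wd: "is_weak_deriv \<Omega> 1 f W1" "is_weak_deriv \<Omega> \<i> f W2"
  proof -
    have ex: "\<exists>g. is_weak_deriv \<Omega> 1 f g" "\<exists>g. is_weak_deriv \<Omega> \<i> f g"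
      using fd by (auto simp: finite_distortion_def W11_def)
    show "is_weak_deriv \<Omega> 1 f W1" "is_weak_deriv \<Omega> \<i> f W2"
      unfolding W1_def W2_def weak_deriv_def by (rule someI_ex[OF ex(1)], rule someI_ex[OF ex(2)])
  qed
  have G_eq: "G z = f z - L z" if "z \<in> Q" for z using that by (simp add: G_def displacement_def L_def Q1Q)
  have G_out: "G z = 0" if "z \<notin> \<Omega>" for z
  proof (cases "z \<in> Q")
    case True
    then have "z \<in> frontier (Q1 l)" using that
      by (simp add: frontier_def intQ Q1Q) (simp add: Q_def \<Omega>_def)
    then show ?thesis using bd G_eq[OF True] by (simp add: L_def)
  next
    case False then show ?thesis by (simp add: G_def displacement_def Q1Q)
  qed
  have cG: "continuous_on UNIV G"
    unfolding G_def using cf bd by (intro continuous_displacement) (auto simp: Q1Q)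
  have wm: "(\<lambda>z. indicator \<Omega> z *\<^sub>R W1 z) \<in> borel_measurable lebesgue" "(\<lambda>z. indicator \<Omega> z *\<^sub>R W2 z) \<in> borel_measurable lebesgue"
    using wd unfolding \<Omega>_def is_weak_deriv_def by (auto intro: locally_integrable_measurable)
  obtain w1 where w1 [measurable]: "w1 \<in> borel_measurable borel" and aw1: "AE z in lborel. indicator \<Omega> z *\<^sub>R W1 z = w1 z"
    using lborel_measurable_representative[OF wm(1)] by blast
  obtain w2 where w2 [measurable]: "w2 \<in> borel_measurable borel" and aw2: "AE z in lborel. indicator \<Omega> z *\<^sub>R W2 z = w2 z"
    using lborel_measurable_representative[OF wm(2)] by blast
  \<comment> \<open>Borel representatives of the Wirtinger derivatives of \<open>f\<close>.\<close>
  define a where "a z = (w1 z - \<i> * w2 z) / 2" for z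
  define b where "b z = (w1 z + \<i> * w2 z) / 2" for z
  have [measurable]: "a \<in> borel_measurable borel" "b \<in> borel_measurable borel" unfolding a_def b_def by measurable
  have w_ab: "w1 z = a z + b z" "w2 z = \<i> * (a z - b z)" for z
    by (simp_all add: a_def b_def complex_eq_iff field_simps)
  have az: "AE z in lborel. z \<in> \<Omega> \<longrightarrow> dz \<Omega> f z = a z" and bz: "AE z in lborel. z \<in> \<Omega> \<longrightarrow> dzbar \<Omega> f z = b z"
  proof -
    show "AE z in lborel. z \<in> \<Omega> \<longrightarrow> dz \<Omega> f z = a z"
      using aw1 aw2 by eventually_elim (auto simp: dz_def a_def W1_def W2_def)
    show "AE z in lborel. z \<in> \<Omega> \<longrightarrow> dzbar \<Omega> f z = b z"
      using aw1 aw2 by eventually_elim (auto simp: dzbar_def b_def W1_def W2_def)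
  qed
  define M where "M = restrict_space lborel \<Omega>"
  have em: "emeasure M (space M) = ennreal l"
    using emeasure_rectangle[OF kl(2)] by (simp add: M_def space_restrict_space emeasure_restrict_space \<Omega>_def)
  have fin: "finite_measure M" by (rule finite_measureI) (simp add: em)
  then interpret finite_measure M .
  have mM: "measure M (space M) = l" using em kl by (simp add: measure_def)
  have AEM: "AE z in M. P z" if "AE z in lborel. z \<in> \<Omega> \<longrightarrow> P z" for P
    using that unfolding M_def by (rule AE_restrict_space_lborel) simp
  have meas: "q \<in> borel_measurable M" if "q \<in> borel_measurable borel" for q :: "complex \<Rightarrow> 'y::topological_space"
    using that unfolding M_def by (intro measurable_restrict_space1) simp
  have nnM: "(\<integral>\<^sup>+z. q z \<partial>M) = (\<integral>\<^sup>+z. q z * indicator \<Omega> z \<partial>lborel)" for q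
    unfolding M_def by (rule nn_integral_restrict_space) simp
  have intM: "integrable M q \<longleftrightarrow> integrable lborel (\<lambda>z. indicator \<Omega> z *\<^sub>R q z)"
    and integralM: "(LINT z|M. q z) = (LINT z|lborel. indicator \<Omega> z *\<^sub>R q z)"
    for q :: "complex \<Rightarrow> 'y::{banach, second_countable_topology}"
    unfolding M_def by (simp_all add: integrable_restrict_space integral_restrict_space)
  have ab: "AE z in M. cmod (b z) < cmod (a z) \<or> a z = 0 \<and> b z = 0"
  proof (rule AEM)
    have "\<Omega> \<in> sets lebesgue" by simp
    from finite_distortion_pointwise[OF fd this] az bz
    show "AE z in lborel. z \<in> \<Omega> \<longrightarrow> cmod (b z) < cmod (a z) \<or> a z = 0 \<and> b z = 0"
      by eventually_elim auto
  qed
  define K where "K z = distortion_of (a z) (b z)" for z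
  have [measurable]: "K \<in> borel_measurable borel" unfolding K_def distortion_of_def by measurable
  have K1: "K z \<ge> 1" for z by (simp add: K_def distortion_of_ge_1)
  have K01: "K0 \<ge> 1" by (simp add: K0 distortion_of_ge_1)
  have \<phi>0: "\<phi> K0 \<ge> 0" using ge1[OF K01] by simp
  define T where "T = \<phi> K0 * l"
  have T: "T \<ge> 0" using \<phi>0 kl by (simp add: T_def)
  have mean: "(\<integral>\<^sup>+z. ennreal (\<phi> (K z)) \<partial>M) \<le> ennreal (T + \<epsilon> * T)"
  proof -
    have "(\<integral>\<^sup>+z. ennreal (\<phi> (K z)) \<partial>M) = mean_distortion \<phi> l f"
      unfolding nnM K_def using mean_distortion_eq_nn_integral[of l f a b \<phi>] az bz by (simp add: \<Omega>_def)
    also have "\<dots> \<le> ennreal (1 + \<epsilon>) * (ennreal (\<phi> K0) * ennreal l)"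
      using le unfolding mean_distortion_linear_stretch[OF kl(2)] K0 .
    also have "\<dots> = ennreal (T + \<epsilon> * T)"
      using \<phi>0 kl \<epsilon> by (simp add: T_def ennreal_mult[symmetric] algebra_simps)
    finally show ?thesis .
  qed
  have Km: "K \<in> borel_measurable M" by (rule meas) measurable
  have iK: "integrable M K" and iK2: "integrable M (\<lambda>z. (K z - K0)\<^sup>2)"
    and main: "(LINT z|M. m * (K z - K0) + c * (K z - K0)\<^sup>2) \<le> \<epsilon> * T"
    using \<epsilon> by (intro convexity_deficit[OF fin Km K1 K01 m(1) c ge1 lower _ _ mean]; simp add: T_def mM)+
  define Jc where "Jc z = (cmod (a z))\<^sup>2 - (cmod (b z))\<^sup>2" for z
  have [measurable]: "Jc \<in> borel_measurable borel" unfolding Jc_def by measurable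
  have iJ: "integrable M Jc"
  proof -
    have "integrable lebesgue (\<lambda>z. indicator \<Omega> z *\<^sub>R Jac \<Omega> f z)"
      using fd by (simp add: finite_distortion_def set_integrable_def)
    moreover have "AE z in lborel. indicator \<Omega> z *\<^sub>R Jac \<Omega> f z = indicator \<Omega> z *\<^sub>R Jc z"
      using az bz by eventually_elim (auto simp: Jac_def Jc_def indicator_def)
    then have "AE z in lebesgue. indicator \<Omega> z *\<^sub>R Jac \<Omega> f z = indicator \<Omega> z *\<^sub>R Jc z" by (rule AE_completion)
    moreover have mb: "(\<lambda>z. indicator \<Omega> z *\<^sub>R Jc z) \<in> borel_measurable borel" by measurable
    moreover from this have "(\<lambda>z. indicator \<Omega> z *\<^sub>R Jc z) \<in> borel_measurable lebesgue" by (simp add: measurable_completion)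
    ultimately have "integrable lebesgue (\<lambda>z. indicator \<Omega> z *\<^sub>R Jc z)"
      by (blast intro: integrable_cong_AE[THEN iffD1] borel_measurable_integrable)
    then show ?thesis unfolding intM using integrable_lebesgue_iff(1)[OF mb] by blast
  qed
  have ia: "integrable M a" and ib: "integrable M b"
    by (rule integrable_wirtinger[OF iK[unfolded K_def[abs_def]] iJ[unfolded Jc_def[abs_def]] ab], (rule meas, measurable)+)+
  define V1 where "V1 z = indicator \<Omega> z *\<^sub>R (w1 z - L 1)" for z
  define V2 where "V2 z = indicator \<Omega> z *\<^sub>R (w2 z - L \<i>)" for z
  have iV: "integrable lborel V1" "integrable lborel V2"
  proof -
    have "integrable M (\<lambda>z. w1 z - L 1)" "integrable M (\<lambda>z. w2 z - L \<i>)" unfolding w_ab using ia ib by auto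
    then show "integrable lborel V1" "integrable lborel V2" unfolding intM V1_def V2_def by simp_all
  qed
  interpret compact_sobolev G V1 V2 Q
  proof
    show "(LINT z|lborel. frechet_derivative h (at z) 1 *\<^sub>R G z) = - (LINT z|lborel. h z *\<^sub>R V1 z)" if "flat_generated h" for h
      unfolding V1_def \<Omega>_def
      by (rule displacement_weak_derivative[OF bl wd(1)[unfolded \<Omega>_def] _ _ cG _ _ _ aw1[unfolded \<Omega>_def] iV(1)[unfolded V1_def \<Omega>_def] that])
         (use G_out G_eq \<Omega>Q kl in \<open>auto simp: \<Omega>_def cbox_complex\<close>)
    show "(LINT z|lborel. frechet_derivative h (at z) \<i> *\<^sub>R G z) = - (LINT z|lborel. h z *\<^sub>R V2 z)" if "flat_generated h" for h
      unfolding V2_def \<Omega>_def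
      by (rule displacement_weak_derivative[OF bl wd(2)[unfolded \<Omega>_def] _ _ cG _ _ _ aw2[unfolded \<Omega>_def] iV(2)[unfolded V2_def \<Omega>_def] that])
         (use G_out G_eq \<Omega>Q kl in \<open>auto simp: \<Omega>_def cbox_complex\<close>)
    show "G z = 0" if "z \<notin> Q" for z using G_out \<Omega>Q that by blast
  qed (use cG iV in \<open>auto simp: Q_def\<close>)
  \<comment> \<open>The combinations with \<open>\<plusminus> \<i>\<close> are twice the Wirtinger derivatives of the displacement.\<close>
  have V_ab: "V1 z + \<i> * V2 z = 2 * (indicator \<Omega> z *\<^sub>R (b z - b0))" "V1 z - \<i> * V2 z = 2 * (indicator \<Omega> z *\<^sub>R (a z - a0))" for z
    unfolding V1_def V2_def w_ab ab0 by (auto simp: indicator_def algebra_simps)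
  have mb: "(LINT z|M. b z - b0) = 0" and ma: "(LINT z|M. a z - a0) = 0"
  proof -
    have "(LINT z|lborel. V1 z + \<i> * V2 z) = 0" "(LINT z|lborel. V1 z - \<i> * V2 z) = 0"
      using iV integral_gradient_0 by simp_all
    then have "2 * (LINT z|lborel. indicator \<Omega> z *\<^sub>R (b z - b0)) = 0" "2 * (LINT z|lborel. indicator \<Omega> z *\<^sub>R (a z - a0)) = 0"
      unfolding V_ab integral_mult_right_zero by simp_all
    then show "(LINT z|M. b z - b0) = 0" "(LINT z|M. a z - a0) = 0" unfolding integralM by simp_all
  qed
  \<comment> \<open>The area inequality for \<open>f\<close>, with the area of the parallelogram as upper bound.\<close>
  have J: "(LINT z|M. Jc z) \<le> ((cmod a0)\<^sup>2 - (cmod b0)\<^sup>2) * l"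
  proof -
    have LG: "L z + G z = f z" if "z \<in> \<Omega>" for z using G_eq[of z] that \<Omega>Q by auto
    have sub: "f ` Q \<subseteq> L ` Q"
      using admissible_image_subset[OF kl f bd] by (simp add: Q1Q L_def)
    have "(\<integral>\<^sup>+z. ennreal \<bar>Re (L 1 + V1 z) * Im (L \<i> + V2 z) - Im (L 1 + V1 z) * Re (L \<i> + V2 z)\<bar> * indicator \<Omega> z \<partial>lborel)
       \<le> emeasure lborel (L ` Q)"
    proof (rule jacobian_integral_le[OF bl])
      show "inj_on (\<lambda>z. L z + G z) \<Omega>"
        using inj_on_subset[OF injf \<Omega>Q] by (subst inj_on_cong[OF LG])
      have "(\<lambda>z. L z + G z) ` \<Omega> = f ` \<Omega>" using LG by (rule image_cong[OF refl])
      also have "\<dots> \<subseteq> L ` Q" using \<Omega>Q by (rule subset_trans[OF image_mono sub])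
      finally show "(\<lambda>z. L z + G z) ` \<Omega> \<subseteq> L ` Q" .
      show "compact (L ` Q)" by (intro compact_continuous_image linear_continuous_on bl) (simp add: Q_def)
    qed simp
    also have "emeasure lborel (L ` Q) = ennreal (k * l)"
      using emeasure_parallelogram[OF kl] by (simp add: L_def Q1Q)
    finally have 1: "(\<integral>\<^sup>+z. ennreal \<bar>Re (L 1 + V1 z) * Im (L \<i> + V2 z) - Im (L 1 + V1 z) * Re (L \<i> + V2 z)\<bar> * indicator \<Omega> z \<partial>lborel)
       \<le> ennreal (k * l)" .
    have "(\<integral>\<^sup>+z. ennreal (Jc z) \<partial>M) \<le> ennreal (k * l)"
      unfolding nnM
    proof (rule order_trans[OF nn_integral_mono 1])
      fix z
      have "ennreal (Jc z) \<le> ennreal \<bar>Re (L 1 + V1 z) * Im (L \<i> + V2 z) - Im (L 1 + V1 z) * Re (L \<i> + V2 z)\<bar>" if "z \<in> \<Omega>"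
      proof -
        have "L 1 + V1 z = a z + b z" "L \<i> + V2 z = \<i> * (a z - b z)"
          using that by (simp_all add: V1_def V2_def w_ab)
        then show ?thesis by (simp only: jacobian_wirtinger Jc_def) (intro ennreal_leI abs_ge_self)
      qed
      then show "ennreal (Jc z) * indicator \<Omega> z \<le> ennreal \<bar>Re (L 1 + V1 z) * Im (L \<i> + V2 z) - Im (L 1 + V1 z) * Re (L \<i> + V2 z)\<bar> * indicator \<Omega> z"
        by (cases "z \<in> \<Omega>") auto
    qed
    then have "(LINT z|M. Jc z) \<le> k * l"
      using kl by (intro integral_real_bounded) auto
    then show ?thesis by (simp add: a0_def b0_def stretch_jacobian)
  qed
  have est: "(LINT z|M. cmod (b z - b0)) \<le> sqrt \<epsilon> * defect_constant a0 b0 l T m c"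
  proof (rule integral_dbar_defect[OF fin mM ia ib ma mb ab])
    show "cmod b0 < cmod a0" using kl by (simp add: a0_def b0_def stretch_dzbar_less)
    show "b0 \<noteq> 0 \<Longrightarrow> m > 0" using m(2) by (simp add: b0_def)
    show "K0 = distortion_of a0 b0" by (simp add: K0 a0_def b0_def)
  qed (use iJ J iK iK2 m c T \<epsilon> main in \<open>simp_all add: Jc_def[abs_def] K_def[abs_def]\<close>)
  have "(\<integral>\<^sup>+z. ennreal (cmod (G z)) \<partial>lborel) \<le> ennreal (2 * (l + 1) + 1) * (\<integral>\<^sup>+z. ennreal (cmod (V1 z + \<i> * V2 z)) \<partial>lborel)"
  proof (rule L1_dbar_bound)
    show "Q \<subseteq> cball 0 (l + 1)"
    proof
      fix z assume "z \<in> Q"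
      then have "\<bar>Re z\<bar> \<le> l" "\<bar>Im z\<bar> \<le> 1" by (auto simp: Q_def cbox_complex)
      then show "z \<in> cball 0 (l + 1)" using cmod_le[of z] by simp
    qed
  qed (use kl in simp)
  also have "(\<integral>\<^sup>+z. ennreal (cmod (V1 z + \<i> * V2 z)) \<partial>lborel) = (\<integral>\<^sup>+z. ennreal (2 * cmod (b z - b0)) \<partial>M)"
    unfolding nnM V_ab by (intro nn_integral_cong) (auto simp: indicator_def norm_mult simp del: right_diff_distrib_numeral)
  also have "\<dots> = ennreal (LINT z|M. 2 * cmod (b z - b0))"
    using ib by (intro nn_integral_eq_integral) auto
  also have "(LINT z|M. 2 * cmod (b z - b0)) = 2 * (LINT z|M. cmod (b z - b0))" by simp
  also have "ennreal (2 * (l + 1) + 1) * ennreal (2 * (LINT z|M. cmod (b z - b0)))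
     \<le> ennreal (2 * (l + 1) + 1) * ennreal (2 * (sqrt \<epsilon> * defect_constant a0 b0 l T m c))"
    using est by (intro mult_left_mono ennreal_leI) auto
  also have "\<dots> = ennreal ((2 * (l + 1) + 1) * (2 * (sqrt \<epsilon> * defect_constant a0 b0 l T m c)))"
  proof -
    have "0 \<le> (LINT z|M. cmod (b z - b0))" by simp
    then have "0 \<le> sqrt \<epsilon> * defect_constant a0 b0 l T m c" using est by linarith
    then show ?thesis using kl by (intro ennreal_mult[symmetric]) auto
  qed
  finally show ?thesis by (simp add: G_def T_def a0_def b0_def)
qed

lemma cmod_displacement_le:
  assumes kl: "k > 0" "l > 0" and f: "f \<in> admissible k l n"
    and bd: "\<And>z. z \<in> frontier (Q1 l) \<Longrightarrow> f z = linear_stretch k n z"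
  shows "cmod (displacement k l n f z) \<le> 2 * (k * l + \<bar>n\<bar> * l + 1)"
proof (cases "z \<in> Q1 l")
  case True
  have stretch: "cmod (linear_stretch k n w) \<le> k * l + \<bar>n\<bar> * l + 1" if "w \<in> Q1 l" for w
  proof -
    have w: "0 \<le> Re w" "Re w \<le> l" "\<bar>Im w\<bar> \<le> 1" using that by (auto simp: Q1_def)
    have "cmod (linear_stretch k n w) \<le> \<bar>k * Re w\<bar> + \<bar>n * Re w + Im w\<bar>"
      using cmod_le[of "linear_stretch k n w"] by (simp add: linear_stretch_def)
    also have "\<dots> \<le> k * Re w + (\<bar>n\<bar> * Re w + \<bar>Im w\<bar>)"
      using w kl abs_triangle_ineq[of "n * Re w" "Im w"] by (simp add: abs_mult)
    also have "\<dots> \<le> k * l + (\<bar>n\<bar> * l + 1)"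
      using w kl by (intro add_mono mult_left_mono) auto
    finally show ?thesis by simp
  qed
  obtain w where "w \<in> Q1 l" "f z = linear_stretch k n w"
    using admissible_image_subset[OF kl f bd] True by blast
  then have "cmod (f z) \<le> k * l + \<bar>n\<bar> * l + 1" using stretch by simp
  then show ?thesis
    using True stretch[OF True] norm_triangle_ineq4[of "f z" "linear_stretch k n z"]
    by (simp add: displacement_def)
next
  case False
  then show ?thesis using kl by (simp add: displacement_def)
qed

text \<open>Pointwise, \<open>\<bar>g\<bar>\<^sup>p \<le> M\<^sup>p\<^sup>-\<^sup>1 * \<bar>g\<bar>\<close>.\<close>

lemma integral_powr_le:
  assumes p: "p \<ge> 1" and M: "\<And>z. cmod (g z) \<le> M" and B: "B \<ge> 0"
    and le: "(\<integral>\<^sup>+z. ennreal (cmod (g z)) \<partial>N) \<le> ennreal B" and g: "g \<in> borel_measurable N"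
  shows "(LINT z|N. cmod (g z) powr p) \<le> M powr (p - 1) * B"
proof (rule integral_real_bounded)
  have "(\<integral>\<^sup>+z. ennreal (cmod (g z) powr p) \<partial>N) \<le> (\<integral>\<^sup>+z. ennreal (M powr (p - 1)) * ennreal (cmod (g z)) \<partial>N)"
  proof (rule nn_integral_mono)
    fix z
    have "cmod (g z) powr p = cmod (g z) powr (p - 1) * cmod (g z)"
      using powr_add[of "cmod (g z)" "p - 1" 1] by simp
    also have "\<dots> \<le> M powr (p - 1) * cmod (g z)"
      using M[of z] p by (intro mult_right_mono powr_mono2) auto
    finally show "ennreal (cmod (g z) powr p) \<le> ennreal (M powr (p - 1)) * ennreal (cmod (g z))"
      by (simp add: ennreal_mult[symmetric])
  qed
  also have "\<dots> = ennreal (M powr (p - 1)) * (\<integral>\<^sup>+z. ennreal (cmod (g z)) \<partial>N)"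
    using g by (intro nn_integral_cmult) simp
  also have "\<dots> \<le> ennreal (M powr (p - 1)) * ennreal B" using le by (rule mult_left_mono) simp
  also have "\<dots> = ennreal (M powr (p - 1) * B)" using B by (simp add: ennreal_mult)
  finally show "(\<integral>\<^sup>+z. ennreal (cmod (g z) powr p) \<partial>N) \<le> ennreal (M powr (p - 1) * B)" .
qed (use B in simp)

theorem theorem5p3:
  fixes p k l n :: real and \<phi> :: "real \<Rightarrow> real"
  assumes "p \<ge> 1" and "k > 0" and "l > 0"
    and "\<phi> \<in> {1..} \<rightarrow> {1..}"
    and "mono_on {1..} \<phi>"
    and "strictly_convex_on {1..} \<phi>"
    and "\<phi> 1 = 1"
    and "\<exists>c0>0. AE t in lebesgue_on {1..}. \<exists>d. has_second_deriv \<phi> d t \<and> d > c0"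
  shows "\<exists>\<epsilon>0>0. \<exists>C>0. \<forall>f \<in> admissible k l n. \<forall>\<epsilon>.
           (\<forall>z \<in> frontier (Q1 l). f z = linear_stretch k n z) \<and>
           0 < \<epsilon> \<and> \<epsilon> < \<epsilon>0 \<and>
           mean_distortion \<phi> l f \<le> ennreal (1 + \<epsilon>) * mean_distortion \<phi> l (linear_stretch k n)
           \<longrightarrow> (LINT z:Q1 l|lebesgue. cmod (f z - linear_stretch k n z) powr p) powr (1 / p)
                 \<le> C * \<epsilon> powr (1 / (2 * p))"
proof -
  define a0 where "a0 = stretch_dz k n"
  define b0 where "b0 = stretch_dzbar k n"
  define K0 where "K0 = distortion_of a0 b0"
  have K01: "K0 \<ge> 1" by (simp add: K0_def distortion_of_ge_1)
  have K0gt: "K0 > 1" if "b0 \<noteq> 0"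
    using distortion_of_gt_1[OF that] stretch_dzbar_less[OF assms(2)] by (simp add: K0_def a0_def b0_def)
  obtain c0 where c0: "c0 > 0" "AE t in lebesgue_on {1..}. \<exists>d. has_second_deriv \<phi> d t \<and> d > c0"
    using assms(8) by blast
  obtain m where m: "m \<ge> 0" "K0 > 1 \<longrightarrow> m > 0"
    and lower: "\<forall>t\<ge>1. \<phi> t \<ge> \<phi> K0 + m * (t - K0) + c0 / 16 * (t - K0)\<^sup>2"
    using quadratic_support[OF assms(4,6,7) c0(2,1) K01] by blast
  \<comment> \<open>\<open>D\<close> is the constant of the \<open>L\<^sup>1\<close> estimate, replaced below by \<open>max 1 D\<close> to make \<open>C\<close> positive, and \<open>B\<close> bounds the displacement.\<close>
  define D where "D = (2 * (l + 1) + 1) * (2 * defect_constant a0 b0 l (\<phi> K0 * l) m (c0 / 16))"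
  define B where "B = 2 * (k * l + \<bar>n\<bar> * l + 1)"
  define C where "C = (B powr (p - 1) * max 1 D) powr (1 / p)"
  have B: "B > 0" using assms(2,3) by (simp add: B_def add_pos_nonneg add_nonneg_pos)
  have "C > 0" using B by (simp add: C_def)
  moreover have "(LINT z:Q1 l|lebesgue. cmod (f z - linear_stretch k n z) powr p) powr (1 / p)
                 \<le> C * \<epsilon> powr (1 / (2 * p))"
    if f: "f \<in> admissible k l n" and bd: "\<And>z. z \<in> frontier (Q1 l) \<Longrightarrow> f z = linear_stretch k n z"
      and \<epsilon>: "0 < \<epsilon>" "\<epsilon> \<le> 1"
      and le: "mean_distortion \<phi> l f \<le> ennreal (1 + \<epsilon>) * mean_distortion \<phi> l (linear_stretch k n)"
    for f \<epsilon>
  proof -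
    define G where "G = displacement k l n f"
    have cf: "continuous_on (Q1 l) f" using f by (auto simp: admissible_def homeomorphism_def)
    have Gm: "G \<in> borel_measurable borel"
      unfolding G_def by (intro borel_measurable_continuous_onI continuous_displacement cf bd)
    have "(\<integral>\<^sup>+z. ennreal (cmod (G z)) \<partial>lborel)
        \<le> ennreal ((2 * (l + 1) + 1) * (2 * (sqrt \<epsilon> * defect_constant a0 b0 l (\<phi> K0 * l) m (c0 / 16))))"
      unfolding G_def a0_def b0_def
    proof (rule admissible_L1_estimate[OF assms(2,3) f bd _ m(1) _ _ _ _ \<epsilon> le])
      show "K0 = distortion_of (stretch_dz k n) (stretch_dzbar k n)" by (simp add: K0_def a0_def b0_def)
      show "m > 0" if "stretch_dzbar k n \<noteq> 0" using that K0gt m(2) by (simp add: b0_def)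
      show "\<phi> t \<ge> 1" if "t \<ge> 1" for t using assms(4) that by auto
      show "\<phi> t \<ge> \<phi> K0 + m * (t - K0) + c0 / 16 * (t - K0)\<^sup>2" if "t \<ge> 1" for t using lower that by blast
    qed (use c0 in auto)
    also have "\<dots> = ennreal (D * sqrt \<epsilon>)" by (simp add: D_def mult_ac)
    also have "\<dots> \<le> ennreal (max 1 D * sqrt \<epsilon>)" using \<epsilon> by (intro ennreal_leI mult_right_mono) auto
    finally have L1: "(\<integral>\<^sup>+z. ennreal (cmod (G z)) \<partial>lborel) \<le> ennreal (max 1 D * sqrt \<epsilon>)" .
    have "(LINT z:Q1 l|lebesgue. cmod (f z - linear_stretch k n z) powr p) = (LINT z|lebesgue. cmod (G z) powr p)"
      unfolding set_lebesgue_integral_def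
      by (intro Bochner_Integration.integral_cong) (auto simp: G_def displacement_def)
    also have "\<dots> = (LINT z|lborel. cmod (G z) powr p)"
      using Gm by (intro integrable_lebesgue_iff(2)) measurable
    also have "\<dots> \<le> B powr (p - 1) * (max 1 D * sqrt \<epsilon>)"
    proof (rule integral_powr_le[OF assms(1) _ _ L1])
      show "cmod (G z) \<le> B" for z
        unfolding G_def B_def by (rule cmod_displacement_le[OF assms(2,3) f bd])
      show "G \<in> borel_measurable lborel" using Gm by simp
      show "0 \<le> max 1 D * sqrt \<epsilon>" using \<epsilon> by simp
    qed
    finally have "(LINT z:Q1 l|lebesgue. cmod (f z - linear_stretch k n z) powr p)
        \<le> B powr (p - 1) * max 1 D * sqrt \<epsilon>" by (simp add: mult.assoc)
    moreover have "0 \<le> (LINT z:Q1 l|lebesgue. cmod (f z - linear_stretch k n z) powr p)"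
      unfolding set_lebesgue_integral_def by (intro Bochner_Integration.integral_nonneg) simp
    ultimately have "(LINT z:Q1 l|lebesgue. cmod (f z - linear_stretch k n z) powr p) powr (1 / p)
        \<le> (B powr (p - 1) * max 1 D * sqrt \<epsilon>) powr (1 / p)"
      using assms(1) by (intro powr_mono2) auto
    also have "\<dots> = C * sqrt \<epsilon> powr (1 / p)"
      using \<epsilon> by (simp add: C_def powr_mult)
    also have "sqrt \<epsilon> powr (1 / p) = \<epsilon> powr (1 / (2 * p))"
      using \<epsilon> by (simp add: powr_half_sqrt[symmetric] powr_powr)
    finally show ?thesis .
  qed
  ultimately show ?thesis by (intro exI[of _ 1] conjI zero_less_one exI[of _ C] ballI allI impI) auto
qed

end
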